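(* Let $(M,\varphi,\zeta,\eta,\langle\cdot,\cdot\rangle)$ be an almost contact metric manifold of dimension $2n+1$. The $U(n)$-components of the two-form $d(\xi_\zeta\eta)$ are as follows (repeated indices summed over $i=1,\dots,2n$; $X,Y$ arbitrary vector fields). 1. The component along $F$ is $(d\xi_\zeta\eta)_{\mathbb RF}=\frac1n\langle d\xi_\zeta\eta,F\rangle F$, where $$\langle d\xi_\zeta\eta,F\rangle=-d(d^*F(\zeta))(\zeta)+\tfrac1n d^*\eta\,d^*F(\zeta)+2(\xi_{(7)e_i}\eta)(\varphi\xi_{(8)e_i}\zeta)+2(\xi_{(10)e_i}\eta)(\varphi\xi_{(11)\zeta}e_i).$$ 2. The $[\lambda^{1,1}]$-component is $$\begin{aligned} (d\xi_\zeta\eta)_{[\lambda^{1,1}]}(X,Y)={}&-\tfrac1n d(d^*F(\zeta))(\zeta)F(X,Y)+\tfrac1{n^2}d^*\eta\,d^*F(\zeta)F(X,Y)+2((\nabla^{U(n)}_\zeta\xi_{(7)})_X\eta)(Y)\\ &-\tfrac2n d^*\eta(\xi_{(7)X}\eta)(Y)+\tfrac2n d^*F(\zeta)(\xi_{(8)X}\eta)(\varphi Y)-2(\xi_{(7)X}\eta)(\xi_{(8)Y}\zeta)\\ &+2(\xi_{(7)Y}\eta)(\xi_{(8)X}\zeta)+2(\xi_{(9)X}\eta)(\xi_{(10)Y}\zeta)-2(\xi_{(9)Y}\eta)(\xi_{(10)X}\zeta)\\ &+2(\xi_{(10)X}\eta)(\xi_{(11)\zeta}Y)-2(\xi_{(10)Y}\eta)(\xi_{(11)\zeta}X).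 \end{aligned}$$ 3. The $[\![\lambda^{2,0}]\!]$-component is $$\begin{aligned} (d\xi_\zeta\eta)_{[\![\lambda^{2,0}]\!]}(X,Y)={}&2((\nabla^{U(n)}_\zeta\xi_{(10)})_X\eta)(Y)-\tfrac2n d^*F(\zeta)\langle\xi_{(11)\zeta}X,\varphi Y\rangle-2(\xi_{(7)X}\eta)(\xi_{(9)Y}\zeta)\\ &+2(\xi_{(7)Y}\eta)(\xi_{(9)X}\zeta)+2(\xi_{(7)X}\eta)(\xi_{(11)\zeta}Y)-2(\xi_{(7)Y}\eta)(\xi_{(11)\zeta}X)\\ &-\tfrac2n d^*\eta(\xi_{(10)X}\eta)(Y)+2(\xi_{(8)X}\eta)(\xi_{(10)Y}\zeta)-2(\xi_{(8)Y}\eta)(\xi_{(10)X}\zeta). \end{aligned}$$ 4. The remaining component is $(d\xi_\zeta\eta)_{\eta\wedge[\![\lambda^{1,0}]\!]}=\eta\wedge(\zeta\lrcorner d\xi_\zeta\eta)$, where $$\begin{aligned} (\zeta\lrcorner d\xi_\zeta\eta)(X)={}&((\nabla^{U(n)}_\zeta\xi_{(12)})_\zeta\eta)(X)+(\xi_{(12)\zeta}\eta)(\xi_{(11)\zeta}X)-\tfrac1{2n}d^*\eta(\xi_{(12)\zeta}\eta)(X)\\ &-(\xi_{(8)\xi_{(12)\zeta}\zeta}\eta)(X)-(\xi_{(9)\xi_{(12)\zeta}\zeta}\eta)(X)-\tfrac1{2n}d^*F(\zeta)(\xi_{(12)\zeta}\eta)(\varphi X)\\ &+(\xi_{(7)\xi_{(12)\zeta}\zeta}\eta)(X)+(\xi_{(10)\xi_{(12)\zeta}\zeta}\eta)(X).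 \end{aligned}$$
   Context: Almost contact metric manifold: a $(2n+1)$-dimensional smooth manifold $M$ with a $(1,1)$-tensor $\varphi$, a vector field $\zeta$ (Reeb vector field), a one-form $\eta$ and a Riemannian metric $\langle\cdot,\cdot\rangle$ such that $\varphi^2=-I+\eta\otimes\zeta$, $\eta(\zeta)=1$, $\langle\varphi X,\varphi Y\rangle=\langle X,Y\rangle-\eta(X)\eta(Y)$. Then $\varphi\zeta=0$, $\eta\circ\varphi=0$, $\eta=\langle\zeta,\cdot\rangle$. The fundamental two-form is $F(X,Y)=\langle X,\varphi Y\rangle$. $\nabla$ is the Levi-Civita connection; $d^*$ is the coderivative, $d^*\alpha=-\sum_{i=1}^{2n+1}(\nabla_{e_i}\alpha)(e_i,\cdot,\dots)$; so $d^*\eta$ and $d^*F(\zeta)$ are functions. Conventions: $d\alpha(X,Y)=(\nabla_X\alpha)(Y)-(\nabla_Y\alpha)(X)$ for one-forms; $(\alpha\wedge\beta)(X,Y)=\alpha(X)\beta(Y)-\alpha(Y)\beta(X)$; for two-forms $\langle\alpha,\beta\rangle=\frac12\sum_{i,j=1}^{2n+1}\alpha(e_i,e_j)\beta(e_i,e_j)$; $\lrcorner$ is the interior product. $\{e_1,\dots,e_{2n},e_{2n+1}=\zeta\}$ is a local orthonormal frame. Components of a two-form $\alpha$: $2\alpha_{[\lambda^{1,1}]}(X,Y)=\alpha(\varphi^2X,\varphi^2Y)+\alpha(\varphi X,\varphi Y)$; $2\alpha_{[\![\lambda^{2,0}]\!]}(X,Y)=\alpha(\varphi^2X,\varphi^2Y)-\alpha(\varphi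 X,\varphi Y)$; $\alpha_{\eta\wedge[\![\lambda^{1,0}]\!]}=\eta\wedge(\zeta\lrcorner\alpha)$; $\alpha_{\mathbb RF}=\frac1n\langle\alpha,F\rangle F$ (which is part of $\alpha_{[\lambda^{1,1}]}$). Intrinsic torsion: $\xi_X=-\frac12\varphi\circ\nabla_X\varphi+\nabla_X\eta\otimes\zeta-\frac12\eta\otimes\nabla_X\zeta$ (a skew-symmetric endomorphism for each $X$); $\nabla^{U(n)}=\nabla+\xi$ is the minimal connection, satisfying $\nabla^{U(n)}\varphi=0$, $\nabla^{U(n)}\eta=0$. For $\xi$, its components and their covariant derivatives, the endomorphism acts on $\eta$ as a derivation: $(\xi_X\eta)(Y)=-\eta(\xi_XY)$, $((\nabla^{U(n)}_Z\xi_{(i)})_X\eta)(Y)=-\eta((\nabla^{U(n)}_Z\xi_{(i)})_XY)$. Thus $\xi_X\eta=-\nabla_X\eta$. Components of $\xi$ used (Chinea–González-Dávila). Let $H=\zeta^\perp$, $X_H=X-\eta(X)\zeta$. - $\xi_{(11)}$: $(\xi_{(11)})_XY=\eta(X)(\xi_\zeta Y_H)_H$. - $\xi_{(12)}$: $(\xi_{(12)})_XY=\eta(X)\big(\eta(Y)\xi_\zeta\zeta-\langle\xi_\zeta\zeta,Y\rangle\zeta\big)$. - $\xi_{(5)},\dots,\xi_{(10)}$: let $B(X,Y)=(\xi_{X_H}\eta)(Y_H)$, a bilinear form on $H$. Write $B=B_5+B_8+B_9+B_6+B_7+B_{10}$, where $B_5$ is a multiple of $\langle\cdot,\cdot\rangle|_H$;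 $B_8$ is symmetric, $\varphi$-invariant ($B_8(\varphi X,\varphi Y)=B_8(X,Y)$) and trace-free; $B_9$ is symmetric with $B_9(\varphi X,\varphi Y)=-B_9(X,Y)$; $B_6$ is a multiple of $F|_H$; $B_7$ is skew, $\varphi$-invariant and orthogonal to $F$; $B_{10}$ is skew with $B_{10}(\varphi X,\varphi Y)=-B_{10}(X,Y)$. Then $\xi_{(i)}$ ($5\le i\le 10$) is determined by $(\xi_{(i)X}\eta)(Y)=B_i(X_H,Y_H)$, i.e. $\langle\xi_{(i)X}Y,Z\rangle=\eta(Y)B_i(X_H,Z_H)-\eta(Z)B_i(X_H,Y_H)$. Explicitly $B_5=\frac{d^*\eta}{2n}\langle\cdot,\cdot\rangle|_H$ and $B_6=-\frac{d^*F(\zeta)}{2n}F|_H$. *)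

theory Defs
  imports "HOL-Analysis.Analysis" "HOL-Library.Function_Algebras"
begin

section \<open>Smooth maps between Euclidean spaces\<close>

fun Ck_on :: "nat \<Rightarrow> 'e::euclidean_space set \<Rightarrow> ('e \<Rightarrow> 'f::real_normed_vector) \<Rightarrow> bool" where
  "Ck_on 0 S f \<longleftrightarrow> continuous_on S f"
| "Ck_on (Suc k) S f \<longleftrightarrow>
     (\<forall>x\<in>S. f differentiable (at x)) \<and> (\<forall>v. Ck_on k S (\<lambda>x. frechet_derivative f (at x) v))"

text \<open>Meant for open \<open>S\<close>.\<close>

definition smooth_on :: "'e::euclidean_space set \<Rightarrow> ('e \<Rightarrow> 'f::real_normed_vector) \<Rightarrow> bool" where
  "smooth_on S f \<longleftrightarrow> (\<forall>k. Ck_on k S f)"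


section \<open>The vector space of real-valued operators on functions\<close>

instantiation "fun" :: (type, real_vector) real_vector
begin

definition scaleR_fun :: "real \<Rightarrow> ('a \<Rightarrow> 'b) \<Rightarrow> 'a \<Rightarrow> 'b" where
  "scaleR_fun a f = (\<lambda>x. a *\<^sub>R f x)"

instance
  by standard (auto simp: scaleR_fun_def fun_eq_iff scaleR_add_right scaleR_add_left)

end

text \<open>A tangent vector is identified with the directional derivative it induces on functions; it
  is extended by \<open>0\<close> to functions that are not smooth near its base point.\<close>

type_synonym 'a tvec = "('a \<Rightarrow> real) \<Rightarrow> real"
type_synonym 'a vfield = "'a \<Rightarrow> 'a tvec"
type_synonym 'a form1 = "'a \<Rightarrow> 'a tvec \<Rightarrow> real"
type_synonym 'a form2 = "'a \<Rightarrow> 'a tvec \<Rightarrow> 'a tvec \<Rightarrow> real"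
type_synonym 'a tensor12 = "'a \<Rightarrow> 'a tvec \<Rightarrow> 'a tvec \<Rightarrow> 'a tvec"


section \<open>Manifolds with an almost contact metric structure\<close>

text \<open>The underlying set of the manifold is the type \<open>'a\<close>, the model space is \<open>'e\<close>. Tensor fields
  are given pointwise; their values matter only on tangent vectors at the respective point.
  \<open>nabla M p v Y\<close> is \<open>\<nabla>\<^sub>v Y\<close> for a tangent vector \<open>v\<close> at \<open>p\<close> and a vector field \<open>Y\<close> that is smooth
  on some neighbourhood of \<open>p\<close>.\<close>

record ('a, 'e) acm =
  atlas :: "('a set \<times> ('a \<Rightarrow> 'e)) set"
  phi   :: "'a \<Rightarrow> 'a tvec \<Rightarrow> 'a tvec"
  zeta  :: "'a vfield"
  eta   :: "'a form1"
  met   :: "'a form2"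
  nabla :: "'a \<Rightarrow> 'a tvec \<Rightarrow> 'a vfield \<Rightarrow> 'a tvec"

definition smooth_atlas ::
  "('a::{t2_space,second_countable_topology} set \<times> ('a \<Rightarrow> 'e::euclidean_space)) set \<Rightarrow> bool" where
  "smooth_atlas A \<longleftrightarrow>
     (\<Union>(U, c)\<in>A. U) = UNIV \<and>
     (\<forall>(U, c)\<in>A. open U \<and> open (c ` U) \<and> homeomorphism U (c ` U) c (inv_into U c)) \<and>
     (\<forall>(U, c)\<in>A. \<forall>(V, d)\<in>A. smooth_on (c ` (U \<inter> V)) (d \<circ> inv_into U c))"

definition smooth_fun ::
  "('a::topological_space, 'e::euclidean_space, 'm) acm_scheme \<Rightarrow> 'a set \<Rightarrow> ('a \<Rightarrow> real) \<Rightarrow> bool" where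
  "smooth_fun M W f \<longleftrightarrow> open W \<and> (\<forall>(U, c)\<in>atlas M. smooth_on (c ` (U \<inter> W)) (f \<circ> inv_into U c))"

definition smooth_fun_near ::
  "('a::topological_space, 'e::euclidean_space, 'm) acm_scheme \<Rightarrow> 'a \<Rightarrow> ('a \<Rightarrow> real) \<Rightarrow> bool" where
  "smooth_fun_near M p f \<longleftrightarrow> (\<exists>W. p \<in> W \<and> smooth_fun M W f)"

definition chart_vec ::
  "('a::topological_space, 'e::euclidean_space, 'm) acm_scheme \<Rightarrow> 'a set \<Rightarrow> ('a \<Rightarrow> 'e) \<Rightarrow> 'a \<Rightarrow> 'e \<Rightarrow> 'a tvec" where
  "chart_vec M U c p w =
     (\<lambda>f. if smooth_fun_near M p f then frechet_derivative (f \<circ> inv_into U c) (at (c p)) w else 0)"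

definition tangent_space ::
  "('a::topological_space, 'e::euclidean_space, 'm) acm_scheme \<Rightarrow> 'a \<Rightarrow> 'a tvec set" where
  "tangent_space M p = {chart_vec M U c p w | U c w. (U, c) \<in> atlas M \<and> p \<in> U}"

definition smooth_vfield ::
  "('a::topological_space, 'e::euclidean_space, 'm) acm_scheme \<Rightarrow> 'a set \<Rightarrow> 'a vfield \<Rightarrow> bool" where
  "smooth_vfield M W X \<longleftrightarrow> open W \<and> (\<forall>p\<in>W. X p \<in> tangent_space M p) \<and>
     (\<forall>V f. V \<subseteq> W \<and> smooth_fun M V f \<longrightarrow> smooth_fun M V (\<lambda>q. X q f))"

definition smooth_vfield_near ::
  "('a::topological_space, 'e::euclidean_space, 'm) acm_scheme \<Rightarrow> 'a \<Rightarrow> 'a vfield \<Rightarrow> bool" where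
  "smooth_vfield_near M p X \<longleftrightarrow> (\<exists>W. p \<in> W \<and> smooth_vfield M W X)"

definition linear_at ::
  "('a::topological_space, 'e::euclidean_space, 'm) acm_scheme \<Rightarrow> 'a \<Rightarrow> ('a tvec \<Rightarrow> 'b::real_vector) \<Rightarrow> bool" where
  "linear_at M p L \<longleftrightarrow> (\<forall>v\<in>tangent_space M p. \<forall>w\<in>tangent_space M p. \<forall>a b.
     L (a *\<^sub>R v + b *\<^sub>R w) = a *\<^sub>R L v + b *\<^sub>R L w)"

definition riemannian_metric ::
  "('a::topological_space, 'e::euclidean_space, 'm) acm_scheme \<Rightarrow> bool" where
  "riemannian_metric M \<longleftrightarrow>
     (\<forall>p. \<forall>v\<in>tangent_space M p. linear_at M p (met M p v)) \<and>
     (\<forall>p. \<forall>v\<in>tangent_space M p. \<forall>w\<in>tangent_space M p. met M p v w = met M p w v) \<and>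
     (\<forall>p. \<forall>v\<in>tangent_space M p. v \<noteq> 0 \<longrightarrow> met M p v v > 0) \<and>
     (\<forall>W X Y. smooth_vfield M W X \<and> smooth_vfield M W Y \<longrightarrow> smooth_fun M W (\<lambda>q. met M q (X q) (Y q)))"

definition almost_contact_metric_manifold ::
  "nat \<Rightarrow> ('a::{t2_space,second_countable_topology}, 'e::euclidean_space, 'm) acm_scheme \<Rightarrow> bool" where
  "almost_contact_metric_manifold n M \<longleftrightarrow>
     n \<ge> 1 \<and> DIM('e) = 2 * n + 1 \<and> smooth_atlas (atlas M) \<and> riemannian_metric M \<and>
     (\<forall>p. \<forall>v\<in>tangent_space M p. phi M p v \<in> tangent_space M p) \<and>
     (\<forall>p. linear_at M p (phi M p)) \<and>
     (\<forall>W X. smooth_vfield M W X \<longrightarrow> smooth_vfield M W (\<lambda>q. phi M q (X q))) \<and>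
     smooth_vfield M UNIV (zeta M) \<and>
     (\<forall>p. linear_at M p (eta M p)) \<and>
     (\<forall>W X. smooth_vfield M W X \<longrightarrow> smooth_fun M W (\<lambda>q. eta M q (X q))) \<and>
     (\<forall>p. \<forall>v\<in>tangent_space M p. phi M p (phi M p v) = - v + eta M p v *\<^sub>R zeta M p) \<and>
     (\<forall>p. eta M p (zeta M p) = 1) \<and>
     (\<forall>p. \<forall>v\<in>tangent_space M p. \<forall>w\<in>tangent_space M p.
        met M p (phi M p v) (phi M p w) = met M p v w - eta M p v * eta M p w)"

text \<open>In the torsion condition, \<open>X p (\<lambda>q. Y q f) - Y p (\<lambda>q. X q f)\<close> is \<open>[X, Y]\<^sub>p f\<close>.\<close>

definition levi_civita ::
  "('a::topological_space, 'e::euclidean_space, 'm) acm_scheme \<Rightarrow> bool" where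
  "levi_civita M \<longleftrightarrow>
     (\<forall>p. \<forall>v\<in>tangent_space M p. \<forall>Y. smooth_vfield_near M p Y \<longrightarrow> nabla M p v Y \<in> tangent_space M p) \<and>
     (\<forall>p Y. smooth_vfield_near M p Y \<longrightarrow> linear_at M p (\<lambda>v. nabla M p v Y)) \<and>
     (\<forall>W X Y. smooth_vfield M W X \<and> smooth_vfield M W Y \<longrightarrow>
        smooth_vfield M W (\<lambda>q. nabla M q (X q) Y)) \<and>
     (\<forall>p. \<forall>v\<in>tangent_space M p. \<forall>W Y Z. p \<in> W \<and> smooth_vfield M W Y \<and> (\<forall>q\<in>W. Y q = Z q) \<longrightarrow>
        nabla M p v Y = nabla M p v Z) \<and>
     (\<forall>p. \<forall>v\<in>tangent_space M p. \<forall>Y Z. smooth_vfield_near M p Y \<and> smooth_vfield_near M p Z \<longrightarrow>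
        nabla M p v (\<lambda>q. Y q + Z q) = nabla M p v Y + nabla M p v Z) \<and>
     (\<forall>p. \<forall>v\<in>tangent_space M p. \<forall>f Y. smooth_fun_near M p f \<and> smooth_vfield_near M p Y \<longrightarrow>
        nabla M p v (\<lambda>q. f q *\<^sub>R Y q) = v f *\<^sub>R Y p + f p *\<^sub>R nabla M p v Y) \<and>
     (\<forall>p X Y f. smooth_vfield_near M p X \<and> smooth_vfield_near M p Y \<and> smooth_fun_near M p f \<longrightarrow>
        nabla M p (X p) Y f - nabla M p (Y p) X f = X p (\<lambda>q. Y q f) - Y p (\<lambda>q. X q f)) \<and>
     (\<forall>p. \<forall>v\<in>tangent_space M p. \<forall>Y Z. smooth_vfield_near M p Y \<and> smooth_vfield_near M p Z \<longrightarrow>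
        v (\<lambda>q. met M q (Y q) (Z q)) =
          met M p (nabla M p v Y) (Z p) + met M p (Y p) (nabla M p v Z))"


section \<open>Covariant derivatives, exterior derivative, coderivative\<close>

text \<open>A smooth local extension of a tangent vector; tensorial expressions do not depend on the
  choice.\<close>

definition local_ext ::
  "('a::topological_space, 'e::euclidean_space, 'm) acm_scheme \<Rightarrow> 'a \<Rightarrow> 'a tvec \<Rightarrow> 'a vfield" where
  "local_ext M p v = (SOME Y. smooth_vfield_near M p Y \<and> Y p = v)"

definition nabla_form1 ::
  "('a::topological_space, 'e::euclidean_space, 'm) acm_scheme \<Rightarrow> 'a form1 \<Rightarrow>
   'a \<Rightarrow> 'a tvec \<Rightarrow> 'a tvec \<Rightarrow> real" where
  "nabla_form1 M \<alpha> p v x = (let X = local_ext M p x in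
     v (\<lambda>q. \<alpha> q (X q)) - \<alpha> p (nabla M p v X))"

definition nabla_form2 ::
  "('a::topological_space, 'e::euclidean_space, 'm) acm_scheme \<Rightarrow> 'a form2 \<Rightarrow>
   'a \<Rightarrow> 'a tvec \<Rightarrow> 'a tvec \<Rightarrow> 'a tvec \<Rightarrow> real" where
  "nabla_form2 M \<alpha> p v x y = (let X = local_ext M p x; Y = local_ext M p y in
     v (\<lambda>q. \<alpha> q (X q) (Y q)) - \<alpha> p (nabla M p v X) y - \<alpha> p x (nabla M p v Y))"

definition nabla_endo ::
  "('a::topological_space, 'e::euclidean_space, 'm) acm_scheme \<Rightarrow> ('a \<Rightarrow> 'a tvec \<Rightarrow> 'a tvec) \<Rightarrow>
   'a \<Rightarrow> 'a tvec \<Rightarrow> 'a tvec \<Rightarrow> 'a tvec" where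
  "nabla_endo M A p v x = (let X = local_ext M p x in
     nabla M p v (\<lambda>q. A q (X q)) - A p (nabla M p v X))"

definition d1 ::
  "('a::topological_space, 'e::euclidean_space, 'm) acm_scheme \<Rightarrow> 'a form1 \<Rightarrow> 'a form2" where
  "d1 M \<alpha> p x y = nabla_form1 M \<alpha> p x y - nabla_form1 M \<alpha> p y x"

text \<open>An orthonormal basis \<open>e 0, \<dots>, e (2n)\<close> of the tangent space whose last vector is \<open>\<zeta>\<close>
  (so indices are shifted by one).\<close>

definition adapted_frame ::
  "('a::topological_space, 'e::euclidean_space, 'm) acm_scheme \<Rightarrow> 'a \<Rightarrow> (nat \<Rightarrow> 'a tvec) \<Rightarrow> bool" where
  "adapted_frame M p e \<longleftrightarrow>
     (\<forall>i<DIM('e). e i \<in> tangent_space M p) \<and>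
     (\<forall>i<DIM('e). \<forall>j<DIM('e). met M p (e i) (e j) = (if i = j then 1 else 0)) \<and>
     e (DIM('e) - 1) = zeta M p"

text \<open>Used only in expressions that do not depend on the choice of the frame.\<close>

definition frame ::
  "('a::topological_space, 'e::euclidean_space, 'm) acm_scheme \<Rightarrow> 'a \<Rightarrow> nat \<Rightarrow> 'a tvec" where
  "frame M p = (SOME e. adapted_frame M p e)"

definition codiff1 ::
  "('a::topological_space, 'e::euclidean_space, 'm) acm_scheme \<Rightarrow> 'a form1 \<Rightarrow> 'a \<Rightarrow> real" where
  "codiff1 M \<alpha> p = - (\<Sum>i<DIM('e). nabla_form1 M \<alpha> p (frame M p i) (frame M p i))"

definition codiff2 ::
  "('a::topological_space, 'e::euclidean_space, 'm) acm_scheme \<Rightarrow> 'a form2 \<Rightarrow> 'a form1" where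
  "codiff2 M \<alpha> p x = - (\<Sum>i<DIM('e). nabla_form2 M \<alpha> p (frame M p i) (frame M p i) x)"

definition inner2 ::
  "('a::topological_space, 'e::euclidean_space, 'm) acm_scheme \<Rightarrow> 'a form2 \<Rightarrow> 'a form2 \<Rightarrow> 'a \<Rightarrow> real" where
  "inner2 M \<alpha> \<beta> p = 1/2 * (\<Sum>i<DIM('e). \<Sum>j<DIM('e).
     \<alpha> p (frame M p i) (frame M p j) * \<beta> p (frame M p i) (frame M p j))"

definition wedge11 :: "'a form1 \<Rightarrow> 'a form1 \<Rightarrow> 'a form2" where
  "wedge11 \<alpha> \<beta> p x y = \<alpha> p x * \<beta> p y - \<alpha> p y * \<beta> p x"

definition int_prod :: "'a vfield \<Rightarrow> 'a form2 \<Rightarrow> 'a form1" where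
  "int_prod X \<alpha> p y = \<alpha> p (X p) y"


section \<open>Fundamental form and components of two-forms\<close>

definition fund_form :: "('a, 'e, 'm) acm_scheme \<Rightarrow> 'a form2" where
  "fund_form M p x y = met M p x (phi M p y)"

definition comp_F ::
  "nat \<Rightarrow> ('a::topological_space, 'e::euclidean_space, 'm) acm_scheme \<Rightarrow> 'a form2 \<Rightarrow> 'a form2" where
  "comp_F n M \<alpha> p x y = 1 / real n * inner2 M \<alpha> (fund_form M) p * fund_form M p x y"

definition comp_11 :: "('a, 'e, 'm) acm_scheme \<Rightarrow> 'a form2 \<Rightarrow> 'a form2" where
  "comp_11 M \<alpha> p x y =
     1/2 * (\<alpha> p (phi M p (phi M p x)) (phi M p (phi M p y)) + \<alpha> p (phi M p x) (phi M p y))"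

definition comp_20 :: "('a, 'e, 'm) acm_scheme \<Rightarrow> 'a form2 \<Rightarrow> 'a form2" where
  "comp_20 M \<alpha> p x y =
     1/2 * (\<alpha> p (phi M p (phi M p x)) (phi M p (phi M p y)) - \<alpha> p (phi M p x) (phi M p y))"

definition comp_eta :: "('a, 'e, 'm) acm_scheme \<Rightarrow> 'a form2 \<Rightarrow> 'a form2" where
  "comp_eta M \<alpha> = wedge11 (eta M) (int_prod (zeta M) \<alpha>)"


section \<open>Intrinsic torsion and its components\<close>

definition xi ::
  "('a::topological_space, 'e::euclidean_space, 'm) acm_scheme \<Rightarrow> 'a tensor12" where
  "xi M p x y =
     - ((1/2) *\<^sub>R phi M p (nabla_endo M (phi M) p x y))
     + nabla_form1 M (eta M) p x y *\<^sub>R zeta M p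
     - (1/2 * eta M p y) *\<^sub>R nabla M p x (zeta M)"

text \<open>Action of an endomorphism \<open>A\<close> of the tangent space at \<open>p\<close> on \<open>\<eta>\<close> as a derivation.\<close>

definition act_eta :: "('a, 'e, 'm) acm_scheme \<Rightarrow> 'a \<Rightarrow> ('a tvec \<Rightarrow> 'a tvec) \<Rightarrow> 'a tvec \<Rightarrow> real" where
  "act_eta M p A y = - eta M p (A y)"

definition hor :: "('a, 'e, 'm) acm_scheme \<Rightarrow> 'a \<Rightarrow> 'a tvec \<Rightarrow> 'a tvec" where
  "hor M p x = x - eta M p x *\<^sub>R zeta M p"

definition horizontal ::
  "('a::topological_space, 'e::euclidean_space, 'm) acm_scheme \<Rightarrow> 'a \<Rightarrow> 'a tvec set" where
  "horizontal M p = {x \<in> tangent_space M p. met M p (zeta M p) x = 0}"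

definition B_form ::
  "('a::topological_space, 'e::euclidean_space, 'm) acm_scheme \<Rightarrow> 'a form2" where
  "B_form M p x y = act_eta M p (xi M p (hor M p x)) (hor M p y)"

definition bilinear_hor ::
  "('a::topological_space, 'e::euclidean_space, 'm) acm_scheme \<Rightarrow> 'a \<Rightarrow>
   ('a tvec \<Rightarrow> 'a tvec \<Rightarrow> real) \<Rightarrow> bool" where
  "bilinear_hor M p b \<longleftrightarrow> (\<forall>x\<in>horizontal M p. \<forall>y\<in>horizontal M p. \<forall>z\<in>horizontal M p. \<forall>r s.
     b (r *\<^sub>R x + s *\<^sub>R y) z = r * b x z + s * b y z \<and>
     b z (r *\<^sub>R x + s *\<^sub>R y) = r * b z x + s * b z y)"

definition B_decomposition ::
  "('a::topological_space, 'e::euclidean_space, 'm) acm_scheme \<Rightarrow> 'a \<Rightarrow>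
   (nat \<Rightarrow> 'a tvec \<Rightarrow> 'a tvec \<Rightarrow> real) \<Rightarrow> bool" where
  "B_decomposition M p b \<longleftrightarrow>
     (let H = horizontal M p; \<phi> = phi M p; F = fund_form M p; e = frame M p;
          symm = (\<lambda>a. \<forall>x\<in>H. \<forall>y\<in>H. a y x = a x y);
          skew = (\<lambda>a. \<forall>x\<in>H. \<forall>y\<in>H. a y x = - a x y);
          inv = (\<lambda>a. \<forall>x\<in>H. \<forall>y\<in>H. a (\<phi> x) (\<phi> y) = a x y);
          antiinv = (\<lambda>a. \<forall>x\<in>H. \<forall>y\<in>H. a (\<phi> x) (\<phi> y) = - a x y)
      in (\<forall>i\<in>{5..10}. bilinear_hor M p (b i)) \<and>
         (\<forall>x\<in>H. \<forall>y\<in>H. B_form M p x y = b 5 x y + b 8 x y + b 9 x y + b 6 x y + b 7 x y + b 10 x y) \<and>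
         (\<exists>c. \<forall>x\<in>H. \<forall>y\<in>H. b 5 x y = c * met M p x y) \<and>
         symm (b 8) \<and> inv (b 8) \<and> (\<Sum>i<DIM('e) - 1. b 8 (e i) (e i)) = 0 \<and>
         symm (b 9) \<and> antiinv (b 9) \<and>
         (\<exists>c. \<forall>x\<in>H. \<forall>y\<in>H. b 6 x y = c * F x y) \<and>
         skew (b 7) \<and> inv (b 7) \<and>
         (\<Sum>i<DIM('e) - 1. \<Sum>j<DIM('e) - 1. b 7 (e i) (e j) * F (e i) (e j)) = 0 \<and>
         skew (b 10) \<and> antiinv (b 10))"

text \<open>The decomposition exists and is unique as a family of forms on the horizontal space.\<close>

definition B_comp ::
  "('a::topological_space, 'e::euclidean_space, 'm) acm_scheme \<Rightarrow> nat \<Rightarrow> 'a form2" where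
  "B_comp M i p = (SOME b. B_decomposition M p b) i"

text \<open>Only the indices \<open>5, \<dots>, 12\<close> are meaningful.\<close>

definition xi_comp ::
  "('a::topological_space, 'e::euclidean_space, 'm) acm_scheme \<Rightarrow> nat \<Rightarrow> 'a tensor12" where
  "xi_comp M i p x y =
     (let z = zeta M p; h = hor M p in
      if i = 11 then eta M p x *\<^sub>R h (xi M p z (h y))
      else if i = 12 then
        eta M p x *\<^sub>R (eta M p y *\<^sub>R xi M p z z - met M p (xi M p z z) y *\<^sub>R z)
      else (THE v. v \<in> tangent_space M p \<and> (\<forall>w\<in>tangent_space M p.
        met M p v w = eta M p y * B_comp M i p (h x) (h w) - eta M p w * B_comp M i p (h x) (h y))))"

definition nablaU ::
  "('a::topological_space, 'e::euclidean_space, 'm) acm_scheme \<Rightarrow> 'a \<Rightarrow> 'a tvec \<Rightarrow> 'a vfield \<Rightarrow> 'a tvec" where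
  "nablaU M p v Y = nabla M p v Y + xi M p v (Y p)"

definition nablaU_tensor12 ::
  "('a::topological_space, 'e::euclidean_space, 'm) acm_scheme \<Rightarrow> 'a tensor12 \<Rightarrow>
   'a \<Rightarrow> 'a tvec \<Rightarrow> 'a tvec \<Rightarrow> 'a tvec \<Rightarrow> 'a tvec" where
  "nablaU_tensor12 M T p v x y = (let X = local_ext M p x; Y = local_ext M p y in
     nablaU M p v (\<lambda>q. T q (X q) (Y q)) - T p (nablaU M p v X) y - T p x (nablaU M p v Y))"

definition xi_zeta_eta ::
  "('a::topological_space, 'e::euclidean_space, 'm) acm_scheme \<Rightarrow> 'a form1" where
  "xi_zeta_eta M p y = act_eta M p (xi M p (zeta M p)) y"

end

theory Submission
  imports Defs
begin

text \<open>Put \<open>\<theta> = \<xi>\<^sub>\<zeta>\<eta>\<close>. Since \<open>\<theta> = - d\<eta>(\<zeta>, \<cdot>)\<close>, Cartan's formula and \<open>d\<^sup>2 = 0\<close> give \<open>d\<theta> = - L\<^sub>\<zeta> d\<eta>\<close>, so no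
  curvature enters. Moreover \<open>d\<eta> = - 2K - \<eta> \<and> \<theta>\<close> with \<open>K = B\<^sub>6 + B\<^sub>7 + B\<^sub>1\<^sub>0\<close>. Expressing the Lie derivative
  through the minimal connection, whose torsion is given by \<open>\<xi>\<close>, and identifying forms with
  endomorphisms, one obtains on \<open>H\<close>
  \<open>d\<theta> = 2 \<nabla>\<^sub>\<zeta>K + 2 (KC - CK) - 2 (KS + SK)\<close>, where \<open>S = B\<^sub>5 + B\<^sub>8 + B\<^sub>9\<close>, \<open>C = \<xi>\<^sub>(\<^sub>1\<^sub>1\<^sub>)\<^sub>\<zeta>\<close> and \<open>\<nabla>\<close> is the minimal
  connection. Each of \<open>B\<^sub>5, \<dots>, B\<^sub>1\<^sub>0, C\<close> commutes or anticommutes with \<open>\<phi>\<close>, and this sorts the products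
  into the two components; the pairing with \<open>F\<close> is a trace. The derivatives of the \<open>B\<^sub>i\<close> make sense
  because local smooth orthonormal frames show that the \<open>B\<^sub>i\<close>, their traces and the associated
  endomorphisms are smooth.\<close>

section \<open>Smooth maps between Euclidean spaces\<close>

text \<open>Two obstacles shape the proof. The notions rest on arbitrary choices (extensions of
  vectors, frames, the decomposition of the form on \<open>H\<close>), and tensors are unconstrained
  off the tangent spaces, so that neither smoothness nor bilinearity is visible. The forms on
  \<open>H\<close> are therefore extended by zero along \<zeta> and given by closed formulas in
  \<phi> and two traces. The other obstacle is that a Lie derivative does not respect \<phi>. The
  minimal connection does: it is metric and keeps \<phi>, \<eta>, \<zeta> and F parallel, so its
  derivative along \<zeta> commutes with the type decomposition, kills constant traces, and acts on
  the F-component only through the coefficient. The price is torsion: [\<zeta>,X] is the derivative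
  of X along \<zeta> minus \<xi>_\<zeta> X + \<nabla>_X \<zeta>, and on \<open>H\<close> the latter
  is C minus the endomorphism of the sum of all six forms. In the resulting products the skew forms
  cancel among themselves, KK - KK = 0, which is why only S remains beside C.\<close>

lemma Ck_on_SucD:
  "Ck_on (Suc k) S f \<Longrightarrow> x \<in> S \<Longrightarrow> (f has_derivative frechet_derivative f (at x)) (at x)"
  by (simp add: frechet_derivative_works)

lemma Ck_on_cong:
  assumes "open S"
  shows "(\<And>x. x \<in> S \<Longrightarrow> f x = g x) \<Longrightarrow> Ck_on k S f \<Longrightarrow> Ck_on k S g"
proof (induction k arbitrary: f g)
  case 0
  then show ?case using continuous_on_cong[of S S f g] by simp
next
  case (Suc k)
  have d: "(g has_derivative frechet_derivative f (at x)) (at x)" if "x \<in> S" for x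
    using has_derivative_transform_within_open[OF Ck_on_SucD[OF Suc.prems(2) that] assms that]
      Suc.prems(1) by simp
  have "Ck_on k S (\<lambda>x. frechet_derivative g (at x) v)" for v
    by (rule Suc.IH[of "\<lambda>x. frechet_derivative f (at x) v"])
      (use Suc.prems(2) frechet_derivative_at[OF d] in auto)
  then show ?case using d by (auto simp: differentiable_def)
qed

text \<open>The recursion of \<open>Ck_on\<close> mentions \<open>frechet_derivative\<close>;
  uniqueness of the derivative allows any explicit candidate \<open>f'\<close> in its place. The
  calculus rules below are proved this way.\<close>

lemma Ck_on_deriv:
  assumes "open S" "\<And>x. x \<in> S \<Longrightarrow> (f has_derivative f' x) (at x)"
    and "\<And>v. Ck_on k S (\<lambda>x. f' x v)"
  shows "Ck_on (Suc k) S f"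
proof -
  have "Ck_on k S (\<lambda>x. frechet_derivative f (at x) v)" for v
    by (rule Ck_on_cong[OF assms(1) _ assms(3)[of v]]) (metis assms(2) frechet_derivative_at)
  then show ?thesis
    using assms(2) by (auto simp: differentiable_def)
qed

lemma Ck_on_subset: "Ck_on k S f \<Longrightarrow> T \<subseteq> S \<Longrightarrow> Ck_on k T f"
  by (induction k arbitrary: f) (auto intro: continuous_on_subset)

lemma Ck_on_Suc_imp: "Ck_on (Suc k) S f \<Longrightarrow> Ck_on k S f"
proof (induction k arbitrary: f)
  case 0
  then show ?case
    by (auto intro!: continuous_at_imp_continuous_on differentiable_imp_continuous_within)
next
  case (Suc k)
  have "Ck_on k S (\<lambda>x. frechet_derivative f (at x) v)" for v
    by (rule Suc.IH) (use Suc.prems in auto)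
  then show ?case using Suc.prems by simp
qed

lemma Ck_on_const: "open S \<Longrightarrow> Ck_on k S (\<lambda>x. c)"
proof (induction k arbitrary: c)
  case (Suc k)
  then show ?case by (intro Ck_on_deriv[where f' = "\<lambda>x v. 0"]) auto
qed simp

lemma Ck_on_linear:
  assumes "open S" "bounded_linear L"
  shows "Ck_on k S f \<Longrightarrow> Ck_on k S (\<lambda>x. L (f x))"
proof (induction k arbitrary: f)
  case 0
  then show ?case by (simp add: bounded_linear.continuous_on[OF assms(2)])
next
  case (Suc k)
  show ?case
    by (rule Ck_on_deriv[OF assms(1) bounded_linear.has_derivative[OF assms(2) Ck_on_SucD[OF Suc.prems]]])
      (use Suc in auto)
qed

lemma Ck_on_add:
  assumes "open S"
  shows "Ck_on k S f \<Longrightarrow> Ck_on k S g \<Longrightarrow> Ck_on k S (\<lambda>x. f x + g x)"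
proof (induction k arbitrary: f g)
  case 0
  then show ?case by (simp add: continuous_on_add)
next
  case (Suc k)
  show ?case
    by (rule Ck_on_deriv[OF assms has_derivative_add[OF Ck_on_SucD[OF Suc.prems(1)] Ck_on_SucD[OF Suc.prems(2)]]])
      (use Suc in auto)
qed

lemma Ck_on_sum:
  assumes "open S" "\<And>i. i \<in> I \<Longrightarrow> Ck_on k S (f i)"
  shows "Ck_on k S (\<lambda>x. \<Sum>i\<in>I. f i x)"
  using assms(2) by (induction I rule: infinite_finite_induct)
    (auto intro: Ck_on_const Ck_on_add assms(1))

lemma Ck_on_scaleR:
  assumes "open S"
  shows "Ck_on k S f \<Longrightarrow> Ck_on k S g \<Longrightarrow> Ck_on k S (\<lambda>x. f x *\<^sub>R g x)"
proof (induction k arbitrary: f g)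
  case 0
  then show ?case by (simp add: continuous_on_scaleR)
next
  case (Suc k)
  note fg = Ck_on_Suc_imp[OF Suc.prems(1)] Ck_on_Suc_imp[OF Suc.prems(2)]
  have "Ck_on k S (\<lambda>x. f x *\<^sub>R frechet_derivative g (at x) v + frechet_derivative f (at x) v *\<^sub>R g x)" for v
    by (rule Ck_on_add[OF assms Suc.IH[OF fg(1)] Suc.IH[OF _ fg(2)]]) (use Suc.prems in auto)
  then show ?case
    by (rule Ck_on_deriv[OF assms, rotated])
      (rule has_derivative_scaleR[OF Ck_on_SucD[OF Suc.prems(1)] Ck_on_SucD[OF Suc.prems(2)]])
qed

text \<open>In the chain rule the direction fed to the derivative of \<open>g\<close> varies with
  \<open>x\<close>, whereas \<open>Ck_on\<close> speaks of fixed directions only. Expanding that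
  direction in \<open>Basis\<close> leaves finitely many fixed ones with scalar
  coefficients.\<close>

lemma Ck_on_compose:
  fixes f :: "'e::euclidean_space \<Rightarrow> 'f::euclidean_space"
  assumes "open S" "open T" "f ` S \<subseteq> T"
  shows "Ck_on k S f \<Longrightarrow> Ck_on k T g \<Longrightarrow> Ck_on k S (\<lambda>x. g (f x))"
proof (induction k arbitrary: g)
  case 0
  then show ?case using assms(3) continuous_on_compose2[of T g S f] by auto
next
  case (Suc k)
  let ?f' = "\<lambda>x. frechet_derivative f (at x)" and ?g' = "\<lambda>y. frechet_derivative g (at y)"
  have d: "((\<lambda>x. g (f x)) has_derivative (\<lambda>v. ?g' (f x) (?f' x v))) (at x)" if "x \<in> S" for x
    using has_derivative_compose[OF Ck_on_SucD[OF Suc.prems(1) that]] Ck_on_SucD[OF Suc.prems(2)] assms(3) that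
    by blast
  have e: "?g' (f x) (?f' x v) = (\<Sum>b\<in>Basis. (?f' x v \<bullet> b) *\<^sub>R ?g' (f x) b)" if "x \<in> S" for x v
  proof -
    have l: "linear (?g' (f x))"
      using Ck_on_SucD[OF Suc.prems(2)] assms(3) that has_derivative_linear by blast
    have "?g' (f x) (?f' x v) = ?g' (f x) (\<Sum>b\<in>Basis. (?f' x v \<bullet> b) *\<^sub>R b)"
      by (simp add: euclidean_representation)
    then show ?thesis by (simp add: linear_sum[OF l] linear_scale[OF l])
  qed
  have "Ck_on k S (\<lambda>x. \<Sum>b\<in>Basis. (?f' x v \<bullet> b) *\<^sub>R ?g' (f x) b)" for v
    by (rule Ck_on_sum[OF assms(1) Ck_on_scaleR[OF assms(1)
          Ck_on_linear[OF assms(1) bounded_linear_inner_left] Suc.IH[OF Ck_on_Suc_imp[OF Suc.prems(1)]]]])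
      (use Suc.prems in auto)
  then have "Ck_on k S (\<lambda>x. ?g' (f x) (?f' x v))" for v
    by (rule Ck_on_cong[OF assms(1), rotated]) (simp add: e)
  then show ?case by (rule Ck_on_deriv[OF assms(1), rotated]) (rule d)
qed

text \<open>With r = 1 / sqrt f the derivative is - r^3 f' / 2, a product of r itself and the
  derivative of f, so the induction closes. It serves to normalize vector fields.\<close>

lemma Ck_on_inverse_sqrt:
  assumes "open S" "\<And>x. x \<in> S \<Longrightarrow> f x > (0::real)"
  shows "Ck_on k S f \<Longrightarrow> Ck_on k S (\<lambda>x. 1 / sqrt (f x))"
proof (induction k)
  case 0
  have "\<forall>x\<in>S. sqrt (f x) \<noteq> 0" using assms(2) by force
  with 0 show ?case
    by (simp add: continuous_on_divide continuous_on_real_sqrt)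
next
  case (Suc k)
  let ?f' = "\<lambda>x. frechet_derivative f (at x)" and ?r = "\<lambda>x. 1 / sqrt (f x)"
  have d: "(?r has_derivative (\<lambda>v. (- (1/2)) *\<^sub>R ?r x *\<^sub>R ?r x *\<^sub>R ?r x *\<^sub>R ?f' x v)) (at x)" if "x \<in> S" for x
  proof -
    have p: "f x > 0" using assms that by auto
    have "((\<lambda>t. 1 / sqrt t) has_field_derivative (- (1/2) * (1 / sqrt (f x))^3)) (at (f x))"
      using p by (auto intro!: derivative_eq_intros simp: field_simps power3_eq_cube)
    from has_derivative_compose[OF Ck_on_SucD[OF Suc.prems that] this[unfolded has_field_derivative_def]]
    show ?thesis by (simp add: power3_eq_cube mult_ac)
  qed
  note r = Suc.IH[OF Ck_on_Suc_imp[OF Suc.prems]] and s = Ck_on_scaleR[OF assms(1)]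
  have "Ck_on k S (\<lambda>x. (- (1/2)) *\<^sub>R ?r x *\<^sub>R ?r x *\<^sub>R ?r x *\<^sub>R ?f' x v)" for v
    by (rule s[OF Ck_on_const[OF assms(1)] s[OF r s[OF r s[OF r]]]]) (use Suc.prems in auto)
  then show ?case by (rule Ck_on_deriv[OF assms(1), rotated]) (rule d)
qed

lemma smooth_on_subset: "smooth_on S f \<Longrightarrow> T \<subseteq> S \<Longrightarrow> smooth_on T f"
  unfolding smooth_on_def using Ck_on_subset by blast

lemma smooth_on_cong:
  "open S \<Longrightarrow> (\<And>x. x \<in> S \<Longrightarrow> f x = g x) \<Longrightarrow> smooth_on S f \<Longrightarrow> smooth_on S g"
  unfolding smooth_on_def by (blast intro: Ck_on_cong)

lemma smooth_on_compose:
  fixes f :: "'e::euclidean_space \<Rightarrow> 'f::euclidean_space"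
  shows "open S \<Longrightarrow> open T \<Longrightarrow> f ` S \<subseteq> T \<Longrightarrow> smooth_on S f \<Longrightarrow> smooth_on T g \<Longrightarrow> smooth_on S (\<lambda>x. g (f x))"
  unfolding smooth_on_def using Ck_on_compose by blast

lemma smooth_on_derivative:
  assumes "smooth_on S f" "x \<in> S"
  shows "(f has_derivative frechet_derivative f (at x)) (at x)"
  using assms Ck_on_SucD unfolding smooth_on_def by blast

lemma smooth_on_frechet_derivative:
  "smooth_on S f \<Longrightarrow> smooth_on S (\<lambda>x. frechet_derivative f (at x) v)"
  unfolding smooth_on_def using Ck_on.simps(2) by blast

section \<open>Smooth functions and vector fields\<close>

locale smooth_manifold =
  fixes M :: "('a::{t2_space,second_countable_topology}, 'e::euclidean_space, 'm) acm_scheme"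
  assumes atlas: "smooth_atlas (atlas M)"
begin

abbreviation "T \<equiv> tangent_space M"
abbreviation "sf \<equiv> smooth_fun_near M"
abbreviation "sv \<equiv> smooth_vfield_near M"

section \<open>Charts and smooth real functions\<close>

lemma chart_at: "\<exists>U c. (U, c) \<in> atlas M \<and> p \<in> U"
proof -
  have "p \<in> (\<Union>(U, c)\<in>atlas M. U)" using atlas unfolding smooth_atlas_def by simp
  then show ?thesis by auto
qed

lemma chartD:
  assumes "(U, c) \<in> atlas M"
  shows chart_open: "open U" and chart_image_open: "open (c ` U)"
    and chart_homeo: "homeomorphism U (c ` U) c (inv_into U c)"
  using atlas assms unfolding smooth_atlas_def by fastforce+

lemma chart_inj: "(U, c) \<in> atlas M \<Longrightarrow> inj_on c U"
  using chart_homeo by (metis homeomorphism_def inj_on_inverseI)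

lemma chart_inv [simp]: "(U, c) \<in> atlas M \<Longrightarrow> q \<in> U \<Longrightarrow> inv_into U c (c q) = q"
  using chart_inj by simp

lemma chart_open_image: "(U, c) \<in> atlas M \<Longrightarrow> open V \<Longrightarrow> V \<subseteq> U \<Longrightarrow> open (c ` V)"
  by (rule openin_open_trans[OF homeomorphism_imp_open_map[OF chart_homeo open_subset] chart_image_open])

lemma transition_smooth:
  "(U, c) \<in> atlas M \<Longrightarrow> (V, d) \<in> atlas M \<Longrightarrow> smooth_on (c ` (U \<inter> V)) (d \<circ> inv_into U c)"
  using atlas unfolding smooth_atlas_def by fastforce

text \<open>In any other chart the function is its given representation composed with a smooth
  transition map, so a single chart decides.\<close>

lemma smooth_fun_chartI:
  assumes c: "(U, c) \<in> atlas M" and V: "open V" "V \<subseteq> U" and s: "smooth_on (c ` V) (f \<circ> inv_into U c)"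
  shows "smooth_fun M V f"
  unfolding smooth_fun_def
proof (intro conjI V ballI, clarify)
  fix U' c' assume c': "(U', c') \<in> atlas M"
  have o: "open (c' ` (U' \<inter> V))" using chart_open_image[OF c'] chart_open[OF c'] V by blast
  have t: "smooth_on (c' ` (U' \<inter> V)) (c \<circ> inv_into U' c')"
    by (rule smooth_on_subset[OF transition_smooth[OF c' c]]) (use V in auto)
  have im: "(c \<circ> inv_into U' c') ` (c' ` (U' \<inter> V)) \<subseteq> c ` V"
    using c' by auto
  show "smooth_on (c' ` (U' \<inter> V)) (f \<circ> inv_into U' c')"
  proof (rule smooth_on_cong[OF o _ smooth_on_compose[OF o chart_open_image[OF c V] im t s]])
    fix x assume "x \<in> c' ` (U' \<inter> V)"
    then obtain q where "q \<in> U'" "q \<in> V" "x = c' q" by blast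
    then show "(f \<circ> inv_into U c) ((c \<circ> inv_into U' c') x) = (f \<circ> inv_into U' c') x"
      using c c' V by auto
  qed
qed

lemma smooth_fun_chartD:
  assumes "smooth_fun M W f" "(U, c) \<in> atlas M" "V \<subseteq> U" "V \<subseteq> W"
  shows "smooth_on (c ` V) (f \<circ> inv_into U c)"
  using assms smooth_on_subset[of "c ` (U \<inter> W)" _ "c ` V"] unfolding smooth_fun_def by blast

lemma smooth_fun_subset: "smooth_fun M W f \<Longrightarrow> open V \<Longrightarrow> V \<subseteq> W \<Longrightarrow> smooth_fun M V f"
  unfolding smooth_fun_def by (auto intro: smooth_on_subset[OF _ image_mono])

lemma smooth_fun_cong:
  assumes "smooth_fun M W f" "\<And>q. q \<in> W \<Longrightarrow> f q = g q"
  shows "smooth_fun M W g"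
  unfolding smooth_fun_def
proof (intro conjI ballI, use assms in \<open>simp add: smooth_fun_def\<close>, clarify)
  fix U c assume c: "(U, c) \<in> atlas M"
  show "smooth_on (c ` (U \<inter> W)) (g \<circ> inv_into U c)"
    by (rule smooth_on_cong[of _ "f \<circ> inv_into U c"])
      (use assms c chart_open_image[OF c, of "U \<inter> W"] chart_open[OF c] in
        \<open>auto simp: smooth_fun_def\<close>)
qed

lemma smooth_fun_lift:
  assumes "open W" and "\<And>U c. (U, c) \<in> atlas M \<Longrightarrow> open (c ` (U \<inter> W)) \<Longrightarrow>
     smooth_on (c ` (U \<inter> W)) (\<lambda>x. f (inv_into U c x))"
  shows "smooth_fun M W f"
  unfolding smooth_fun_def o_def
proof (intro conjI ballI assms(1), clarify)
  fix U c assume c: "(U, c) \<in> atlas M"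
  show "smooth_on (c ` (U \<inter> W)) (\<lambda>x. f (inv_into U c x))"
    by (rule assms(2)[OF c chart_open_image[OF c]]) (use assms(1) chart_open[OF c] in auto)
qed

lemma smooth_fun_open: "smooth_fun M W f \<Longrightarrow> open W"
  by (simp add: smooth_fun_def)

lemma smooth_funD: "smooth_fun M W f \<Longrightarrow> (U, c) \<in> atlas M \<Longrightarrow> Ck_on k (c ` (U \<inter> W)) (\<lambda>x. f (inv_into U c x))"
  unfolding smooth_fun_def smooth_on_def o_def by blast

lemma smooth_fun_const: "open W \<Longrightarrow> smooth_fun M W (\<lambda>q. a)"
  by (rule smooth_fun_lift) (auto simp: smooth_on_def intro: Ck_on_const)

lemma smooth_fun_add: "smooth_fun M W f \<Longrightarrow> smooth_fun M W g \<Longrightarrow> smooth_fun M W (\<lambda>q. f q + g q)"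
  by (rule smooth_fun_lift) (auto simp: smooth_on_def smooth_fun_open intro: Ck_on_add[OF _ smooth_funD smooth_funD])

lemma smooth_fun_mult: 
  assumes "smooth_fun M W f" "smooth_fun M W g" 
  shows "smooth_fun M W (\<lambda>q. f q * g q)"
proof (rule smooth_fun_lift)
  fix U c assume c: "(U, c) \<in> atlas M" and o: "open (c ` (U \<inter> W))"
  show "smooth_on (c ` (U \<inter> W)) (\<lambda>x. f (inv_into U c x) * g (inv_into U c x))"
    unfolding smooth_on_def
    using Ck_on_scaleR[OF o smooth_funD[OF assms(1) c] smooth_funD[OF assms(2) c]] by simp
qed (use assms smooth_fun_open in blast)

lemma smooth_fun_inverse_sqrt:
  assumes "smooth_fun M W f" "\<And>q. q \<in> W \<Longrightarrow> f q > 0"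
  shows "smooth_fun M W (\<lambda>q. 1 / sqrt (f q))"
proof (rule smooth_fun_lift)
  fix U c assume c: "(U, c) \<in> atlas M" and o: "open (c ` (U \<inter> W))"
  show "smooth_on (c ` (U \<inter> W)) (\<lambda>x. 1 / sqrt (f (inv_into U c x)))"
    unfolding smooth_on_def
    by (intro allI Ck_on_inverse_sqrt[OF o _ smooth_funD[OF assms(1) c]]) (use assms(2) c in auto)
qed (use assms smooth_fun_open in blast)

lemma sf_obtain:
  assumes "sf p f" "eventually P (nhds p)"
  obtains W where "open W" "p \<in> W" "smooth_fun M W f" "\<And>q. q \<in> W \<Longrightarrow> P q"
proof -
  obtain W where W: "p \<in> W" "smooth_fun M W f" using assms(1) unfolding smooth_fun_near_def by blast
  obtain V where V: "open V" "p \<in> V" "\<forall>q\<in>V. P q" using assms(2) unfolding eventually_nhds by blast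
  have o: "open W" using W smooth_fun_open by blast
  show ?thesis
    by (rule that[of "W \<inter> V"]) (use W V o smooth_fun_subset[OF W(2), of "W \<inter> V"] in auto)
qed

lemma sf_eventually: "sf p f \<Longrightarrow> \<forall>\<^sub>F q in nhds p. sf q f"
  unfolding smooth_fun_near_def eventually_nhds using smooth_fun_open by blast

lemma sf_eventually_smooth: "sf p f \<Longrightarrow> \<exists>W. open W \<and> p \<in> W \<and> smooth_fun M W f"
  unfolding smooth_fun_near_def using smooth_fun_open by blast

lemma sf_pair:
  assumes "sf p f" "sf p g"
  obtains W where "open W" "p \<in> W" "smooth_fun M W f" "smooth_fun M W g"
proof -
  obtain V where V: "p \<in> V" "open V" "smooth_fun M V g" using sf_eventually_smooth[OF assms(2)] by blast
  obtain W where W: "open W" "p \<in> W" "smooth_fun M W f" "\<And>q. q \<in> W \<Longrightarrow> q \<in> V"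
    using sf_obtain[OF assms(1), of "\<lambda>q. q \<in> V"] V eventually_nhds by blast
  show ?thesis by (rule that[OF W(1-3)]) (use V W smooth_fun_subset in blast)
qed

lemma sf_cong:
  assumes "sf p f" "\<forall>\<^sub>F q in nhds p. f q = g q" shows "sf p g"
  by (rule sf_obtain[OF assms]) (auto simp: smooth_fun_near_def intro: smooth_fun_cong)

lemma sf_const [intro]: "sf p (\<lambda>q. a)"
  unfolding smooth_fun_near_def using smooth_fun_const open_UNIV by blast

lemma sf_add [intro]: "sf p f \<Longrightarrow> sf p g \<Longrightarrow> sf p (\<lambda>q. f q + g q)"
  by (erule (1) sf_pair) (auto simp: smooth_fun_near_def intro: smooth_fun_add)

lemma sf_mult [intro]: "sf p f \<Longrightarrow> sf p g \<Longrightarrow> sf p (\<lambda>q. f q * g q)"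
  by (erule (1) sf_pair) (auto simp: smooth_fun_near_def intro: smooth_fun_mult)

lemma sf_uminus [intro]: "sf p f \<Longrightarrow> sf p (\<lambda>q. - f q)"
  using sf_mult[OF sf_const[of p "-1"], of f] by simp

lemma sf_diff [intro]: "sf p f \<Longrightarrow> sf p g \<Longrightarrow> sf p (\<lambda>q. f q - g q)"
  using sf_add[OF _ sf_uminus, of p f g] by simp

lemma sf_sum [intro]: "(\<And>i. i \<in> I \<Longrightarrow> sf p (f i)) \<Longrightarrow> sf p (\<lambda>q. \<Sum>i\<in>I. f i q)"
  by (induction I rule: infinite_finite_induct) auto

lemma sf_comp_chart_differentiable:
  assumes "sf p f" "(U, c) \<in> atlas M" "p \<in> U"
  shows "((f \<circ> inv_into U c) has_derivative frechet_derivative (f \<circ> inv_into U c) (at (c p))) (at (c p))"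
proof -
  obtain W where W: "open W" "p \<in> W" "smooth_fun M W f" using sf_eventually_smooth[OF assms(1)] by blast
  show ?thesis
    by (rule smooth_on_derivative[OF smooth_fun_chartD[OF W(3) assms(2), of "U \<inter> W"]])
      (use assms W in auto)
qed

lemma chart_eventually:
  assumes "(U, c) \<in> atlas M" "p \<in> U" "\<forall>\<^sub>F q in nhds p. P q"
  shows "\<forall>\<^sub>F x in nhds (c p). P (inv_into U c x)"
proof -
  obtain V where V: "open V" "p \<in> V" "\<forall>q\<in>V. P q" using assms(3) unfolding eventually_nhds by blast
  have "open (c ` (U \<inter> V))" using chart_open_image[OF assms(1)] chart_open[OF assms(1)] V by blast
  moreover have "c p \<in> c ` (U \<inter> V)" "\<forall>x\<in>c ` (U \<inter> V). P (inv_into U c x)"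
    using assms V by auto
  ultimately show ?thesis unfolding eventually_nhds by blast
qed

lemma sf_isCont: 
  assumes "sf p f" shows "isCont f p"
proof -
  obtain U c where c: "(U, c) \<in> atlas M" "p \<in> U" using chart_at by blast
  have "isCont (f \<circ> inv_into U c) (c p)"
    using sf_comp_chart_differentiable[OF assms c] has_derivative_continuous by blast
  moreover have "isCont c p"
    using chart_homeo[OF c(1)] chart_open[OF c(1)] c(2)
    unfolding homeomorphism_def using continuous_on_eq_continuous_at by blast
  ultimately have "isCont (\<lambda>q. (f \<circ> inv_into U c) (c q)) p" using isCont_o2 by blast
  moreover have "\<forall>\<^sub>F q in nhds p. (f \<circ> inv_into U c) (c q) = f q"
    unfolding eventually_nhds using c chart_open by fastforce
  ultimately show ?thesis using isCont_cong[of "\<lambda>q. (f \<circ> inv_into U c) (c q)" f p] by simp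
qed

lemma sf_inverse_sqrt [intro]:
  assumes "sf p f" "f p > 0"
  shows "sf p (\<lambda>q. 1 / sqrt (f q))"
proof -
  have "\<forall>\<^sub>F q in nhds p. f q > 0"
    using order_tendstoD(1)[OF sf_isCont[OF assms(1), unfolded continuous_within tendsto_at_iff_tendsto_nhds] assms(2)] .
  with assms(1) show ?thesis
    by (rule sf_obtain) (auto simp: smooth_fun_near_def intro: smooth_fun_inverse_sqrt)
qed

section \<open>Tangent vectors as derivations, dimension of the tangent space\<close>

lemma chart_vec_sf: "sf p f \<Longrightarrow> chart_vec M U c p w f = frechet_derivative (f \<circ> inv_into U c) (at (c p)) w"
  by (simp add: chart_vec_def)

lemma tangentE:
  assumes "v \<in> T p" obtains U c w where "(U, c) \<in> atlas M" "p \<in> U" "v = chart_vec M U c p w"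
  using assms unfolding tangent_space_def by blast

text \<open>Vectors are operators on all real functions, so an equality of vectors must also be
  checked on functions that are not smooth near the point; there both sides vanish.\<close>

lemma tangent_nonsmooth: "v \<in> T p \<Longrightarrow> \<not> sf p f \<Longrightarrow> v f = 0"
  unfolding tangent_space_def chart_vec_def by auto

lemma sf_cong_iff: "\<forall>\<^sub>F q in nhds p. f q = g q \<Longrightarrow> sf p f \<longleftrightarrow> sf p g"
  using sf_cong[of p f g] sf_cong[of p g f] by (auto simp: eq_commute)

lemma frechet_derivative_cong:
  assumes "\<forall>\<^sub>F y in nhds x. f y = g y"
  shows "frechet_derivative f (at x) = frechet_derivative g (at x)"
proof -
  have e: "\<forall>\<^sub>F y in at x. f y = g y" using assms by (auto simp: eventually_at_filter elim: eventually_mono)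
  then have "\<forall>\<^sub>F y in at x. g y = f y" by (simp add: eq_commute)
  with e have "(f has_derivative D) (at x) \<longleftrightarrow> (g has_derivative D) (at x)" for D
    using has_derivative_transform_eventually[of f D x UNIV g] has_derivative_transform_eventually[of g D x UNIV f]
      eventually_nhds_x_imp_x[OF assms] e by (auto simp: eq_commute)
  then show ?thesis by (simp add: frechet_derivative_def)
qed

lemma tangent_cong:
  assumes "v \<in> T p" "\<forall>\<^sub>F q in nhds p. f q = g q"
  shows "v f = v g"
proof -
  obtain U c w where v: "(U, c) \<in> atlas M" "p \<in> U" "v = chart_vec M U c p w" using tangentE[OF assms(1)] .
  have "\<forall>\<^sub>F x in nhds (c p). (f \<circ> inv_into U c) x = (g \<circ> inv_into U c) x"
    using chart_eventually[OF v(1,2) assms(2)] by simp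
  from frechet_derivative_cong[OF this] show ?thesis
    using sf_cong_iff[OF assms(2)] v by (simp add: chart_vec_def o_def)
qed

lemma tangent_const:
  assumes "v \<in> T p" shows "v (\<lambda>q. a) = 0"
proof -
  obtain U c w where v: "(U, c) \<in> atlas M" "p \<in> U" "v = chart_vec M U c p w" using tangentE[OF assms(1)] .
  show ?thesis using sf_const[of p a] v by (simp add: chart_vec_def o_def)
qed

lemma tangent_add:
  assumes "v \<in> T p" "sf p f" "sf p g"
  shows "v (\<lambda>q. f q + g q) = v f + v g"
proof -
  obtain U c w where v: "(U, c) \<in> atlas M" "p \<in> U" "v = chart_vec M U c p w" using tangentE[OF assms(1)] .
  note d = has_derivative_add[OF sf_comp_chart_differentiable[OF assms(2) v(1,2)] sf_comp_chart_differentiable[OF assms(3) v(1,2)]]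
  show ?thesis using frechet_derivative_at[OF d] v(3) sf_add[OF assms(2,3)] assms
    by (simp add: chart_vec_sf o_def fun_eq_iff)
qed

lemma tangent_mult:
  assumes "v \<in> T p" "sf p f" "sf p g"
  shows "v (\<lambda>q. f q * g q) = v f * g p + f p * v g"
proof -
  obtain U c w where v: "(U, c) \<in> atlas M" "p \<in> U" "v = chart_vec M U c p w" using tangentE[OF assms(1)] .
  note d = has_derivative_mult[OF sf_comp_chart_differentiable[OF assms(2) v(1,2)] sf_comp_chart_differentiable[OF assms(3) v(1,2)]]
  have "frechet_derivative (\<lambda>x. f (inv_into U c x) * g (inv_into U c x)) (at (c p)) w =
     (f \<circ> inv_into U c) (c p) * frechet_derivative (g \<circ> inv_into U c) (at (c p)) w +
     frechet_derivative (f \<circ> inv_into U c) (at (c p)) w * (g \<circ> inv_into U c) (c p)"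
    using frechet_derivative_at[OF d] by (simp add: o_def fun_eq_iff)
  then show ?thesis using v sf_mult[OF assms(2,3)] assms
    by (simp add: chart_vec_sf o_def)
qed

lemma tangent_uminus:
  assumes "v \<in> T p" "sf p f" shows "v (\<lambda>q. - f q) = - v f"
  using tangent_mult[OF assms(1) sf_const[of p "-1"] assms(2)] tangent_const[OF assms(1), of "-1"] by simp

lemma tangent_diff:
  assumes "v \<in> T p" "sf p f" "sf p g"
  shows "v (\<lambda>q. f q - g q) = v f - v g"
  using tangent_add[OF assms(1,2) sf_uminus[OF assms(3)]] tangent_uminus[OF assms(1,3)] by simp

lemma tangent_sum:
  assumes "v \<in> T p" "\<And>i. i \<in> I \<Longrightarrow> sf p (f i)"
  shows "v (\<lambda>q. \<Sum>i\<in>I. f i q) = (\<Sum>i\<in>I. v (f i))"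
  using assms(2)
proof (induction I rule: infinite_finite_induct)
  case (insert i I)
  have "v (\<lambda>q. \<Sum>i\<in>insert i I. f i q) = v (\<lambda>q. f i q + (\<Sum>i\<in>I. f i q))"
    using insert by simp
  also have "\<dots> = v (f i) + v (\<lambda>q. \<Sum>i\<in>I. f i q)"
    by (rule tangent_add[OF assms(1)]) (use insert in auto)
  finally show ?case using insert by simp
qed (use tangent_const[OF assms(1), of 0] in simp_all)

text \<open>The chain rule for the transition map. Consequently one chart around a point produces
  its whole tangent space.\<close>

lemma chart_vec_change:
  assumes c: "(U, c) \<in> atlas M" "p \<in> U" and d: "(V, d) \<in> atlas M" "p \<in> V"
  shows "chart_vec M V d p w = chart_vec M U c p (frechet_derivative (c \<circ> inv_into V d) (at (d p)) w)"
proof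
  fix f
  show "chart_vec M V d p w f = chart_vec M U c p (frechet_derivative (c \<circ> inv_into V d) (at (d p)) w) f"
  proof (cases "sf p f")
    case True
    have UV: "open (d ` (V \<inter> U))" using chart_open_image[OF d(1)] chart_open[OF c(1)] chart_open[OF d(1)] by blast
    have "((c \<circ> inv_into V d) has_derivative frechet_derivative (c \<circ> inv_into V d) (at (d p))) (at (d p))"
      by (rule smooth_on_derivative[OF transition_smooth[OF d(1) c(1)]]) (use assms in blast)
    moreover have "((f \<circ> inv_into U c) has_derivative frechet_derivative (f \<circ> inv_into U c) (at (c p))) (at ((c \<circ> inv_into V d) (d p)))"
      using sf_comp_chart_differentiable[OF True c] d by simp
    ultimately have "((\<lambda>x. (f \<circ> inv_into U c) ((c \<circ> inv_into V d) x)) has_derivative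
      (\<lambda>w. frechet_derivative (f \<circ> inv_into U c) (at (c p)) (frechet_derivative (c \<circ> inv_into V d) (at (d p)) w))) (at (d p))"
      by (rule has_derivative_compose)
    from frechet_derivative_at[OF this]
    have "frechet_derivative (f \<circ> inv_into U c) (at (c p)) (frechet_derivative (c \<circ> inv_into V d) (at (d p)) w)
      = frechet_derivative (\<lambda>x. (f \<circ> inv_into U c) ((c \<circ> inv_into V d) x)) (at (d p)) w"
      by metis
    also have "frechet_derivative (\<lambda>x. (f \<circ> inv_into U c) ((c \<circ> inv_into V d) x)) (at (d p))
      = frechet_derivative (f \<circ> inv_into V d) (at (d p))"
    proof (rule frechet_derivative_cong)
      show "\<forall>\<^sub>F y in nhds (d p). (f \<circ> inv_into U c) ((c \<circ> inv_into V d) y) = (f \<circ> inv_into V d) y"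
        unfolding eventually_nhds using UV assms by (intro exI[of _ "d ` (V \<inter> U)"]) auto
    qed
    finally show ?thesis using True by (simp add: chart_vec_sf o_def)
  qed (simp add: chart_vec_def)
qed

lemma tangent_space_chart:
  assumes "(U, c) \<in> atlas M" "p \<in> U"
  shows "T p = range (chart_vec M U c p)"
  using assms chart_vec_change[OF assms] unfolding tangent_space_def by blast

lemma linear_chart_vec:
  assumes "(U, c) \<in> atlas M" "p \<in> U"
  shows "linear (chart_vec M U c p)"
proof -
  have l: "linear (frechet_derivative (f \<circ> inv_into U c) (at (c p)))" if "sf p f" for f
    using has_derivative_linear[OF sf_comp_chart_differentiable[OF that assms]] .
  show ?thesis
    by (rule linearI) (auto simp: chart_vec_def fun_eq_iff scaleR_fun_def linear_add[OF l] linear_scale[OF l])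
qed

lemma sf_coordinate:
  assumes "(U, c) \<in> atlas M" "p \<in> U" "bounded_linear (g :: 'e \<Rightarrow> real)"
  shows "sf p (\<lambda>q. g (c q))"
  unfolding smooth_fun_near_def
proof (intro exI conjI)
  have o: "open (c ` U)" using chart_image_open assms by blast
  have "Ck_on k (c ` U) (\<lambda>x. x)" for k
  proof (cases k)
    case (Suc j)
    then show ?thesis using Ck_on_deriv[OF o, of "\<lambda>x. x" "\<lambda>x v. v" j, OF has_derivative_ident Ck_on_const[OF o]] by simp
  qed simp
  then have "smooth_on (c ` U) g"
    unfolding smooth_on_def using Ck_on_linear[OF o assms(3)] by blast
  then have "smooth_on (c ` U) ((\<lambda>q. g (c q)) \<circ> inv_into U c)"
    by (rule smooth_on_cong[OF o, rotated]) (use assms in auto)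
  then show "smooth_fun M U (\<lambda>q. g (c q))"
    by (rule smooth_fun_chartI[OF assms(1) chart_open[OF assms(1)] order_refl])
qed (use assms in auto)

text \<open>Read in the chart, a linear functional of the chart map is its own derivative. Applying
  a tangent vector to coordinates thus recovers its components, which gives injectivity of
  \<open>chart_vec\<close> and the dimension of the tangent space.\<close>

lemma chart_vec_coordinate:
  assumes "(U, c) \<in> atlas M" "p \<in> U" "bounded_linear (g :: 'e \<Rightarrow> real)"
  shows "chart_vec M U c p w (\<lambda>q. g (c q)) = g w"
proof -
  have "frechet_derivative ((\<lambda>q. g (c q)) \<circ> inv_into U c) (at (c p)) = frechet_derivative g (at (c p))"
    by (rule frechet_derivative_cong) (use assms chart_image_open[OF assms(1)] in
      \<open>auto simp: eventually_nhds intro!: exI[of _ "c ` U"]\<close>)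
  also have "\<dots> = g"
    using frechet_derivative_at[OF bounded_linear.has_derivative[OF assms(3) has_derivative_ident]] by simp
  finally show ?thesis using sf_coordinate[OF assms] by (simp add: chart_vec_sf)
qed

lemma inj_chart_vec:
  assumes "(U, c) \<in> atlas M" "p \<in> U"
  shows "inj (chart_vec M U c p)"
proof (rule injI)
  fix v w assume "chart_vec M U c p v = chart_vec M U c p w"
  then have "v \<bullet> b = w \<bullet> b" for b
    using chart_vec_coordinate[OF assms, of "\<lambda>x. x \<bullet> b"] bounded_linear_inner_left by metis
  then show "v = w" by (rule euclidean_eqI)
qed

lemma subspace_T: "subspace (T p)"
proof -
  obtain U c where c: "(U, c) \<in> atlas M" "p \<in> U" using chart_at by blast
  show ?thesis using tangent_space_chart[OF c] linear_chart_vec[OF c] by (simp add: linear_subspace_image)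
qed

lemma T_add [intro]: "v \<in> T p \<Longrightarrow> w \<in> T p \<Longrightarrow> v + w \<in> T p"
  and T_scale [intro]: "v \<in> T p \<Longrightarrow> a *\<^sub>R v \<in> T p"
  and T_0 [intro]: "0 \<in> T p"
  and T_diff [intro]: "v \<in> T p \<Longrightarrow> w \<in> T p \<Longrightarrow> v - w \<in> T p"
  and T_uminus [intro]: "v \<in> T p \<Longrightarrow> - v \<in> T p"
  and T_sum [intro]: "(\<And>i. i \<in> I \<Longrightarrow> f i \<in> T p) \<Longrightarrow> (\<Sum>i\<in>I. f i) \<in> T p"
  using subspace_T[of p] by (auto intro: subspace_add subspace_scale subspace_0 subspace_diff subspace_neg subspace_sum)

lemma dim_T: 
  shows "dim (T p) = DIM('e)" and "\<exists>B. finite B \<and> card B = DIM('e) \<and> independent B \<and> span B = T p"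
proof -
  obtain U c where c: "(U, c) \<in> atlas M" "p \<in> U" using chart_at by blast
  let ?B = "chart_vec M U c p ` Basis"
  have i: "independent ?B"
    using linear_independent_injective_image[OF linear_chart_vec[OF c] independent_Basis]
      inj_on_subset[OF inj_chart_vec[OF c]] by blast
  have s: "span ?B = T p"
    using linear_span_image[OF linear_chart_vec[OF c], of Basis] tangent_space_chart[OF c] by simp
  have k: "card ?B = DIM('e)"
    using inj_chart_vec[OF c] by (meson card_image inj_on_subset subset_UNIV)
  show "dim (T p) = DIM('e)" using dim_span[of ?B] dim_eq_card_independent[OF i] s k by simp
  show "\<exists>B. finite B \<and> card B = DIM('e) \<and> independent B \<and> span B = T p"
    by (intro exI[of _ ?B] conjI i s k) simp
qed

section \<open>Smooth vector fields and extensions of tangent vectors\<close>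

lemma smooth_vfield_open: "smooth_vfield M W X \<Longrightarrow> open W"
  by (simp add: smooth_vfield_def)

lemma smooth_vfield_subset: "smooth_vfield M W X \<Longrightarrow> open V \<Longrightarrow> V \<subseteq> W \<Longrightarrow> smooth_vfield M V X"
  unfolding smooth_vfield_def by blast

lemma smooth_vfield_cong:
  assumes "smooth_vfield M W X" "\<And>q. q \<in> W \<Longrightarrow> X q = Y q"
  shows "smooth_vfield M W Y"
  unfolding smooth_vfield_def
proof (intro conjI allI ballI impI)
  show "open W" "\<And>q. q \<in> W \<Longrightarrow> Y q \<in> T q" using assms unfolding smooth_vfield_def by auto
  fix V f assume V: "V \<subseteq> W \<and> smooth_fun M V f"
  show "smooth_fun M V (\<lambda>q. Y q f)"
    by (rule smooth_fun_cong[of V "\<lambda>q. X q f"]) (use assms V in \<open>auto simp: smooth_vfield_def\<close>)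
qed

text \<open>Directional derivatives of smooth functions are smooth. These fields with constant
  coefficients in a chart supply the extensions of tangent vectors.\<close>

lemma smooth_vfield_chart:
  assumes c: "(U, c) \<in> atlas M"
  shows "smooth_vfield M U (\<lambda>q. chart_vec M U c q w)"
  unfolding smooth_vfield_def
proof (intro conjI allI ballI impI)
  show "open U" using chart_open[OF c] .
  show "\<And>q. q \<in> U \<Longrightarrow> chart_vec M U c q w \<in> T q" using c unfolding tangent_space_def by blast
  fix V f assume V: "V \<subseteq> U \<and> smooth_fun M V f"
  then have o: "open V" using smooth_fun_open by blast
  have s: "smooth_on (c ` V) (f \<circ> inv_into U c)" using smooth_fun_chartD[of V f U c V] V c by blast
  show "smooth_fun M V (\<lambda>q. chart_vec M U c q w f)"
  proof (rule smooth_fun_chartI[OF c o _ smooth_on_cong[OF _ _ smooth_on_frechet_derivative[OF s, of w]]])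
    show "open (c ` V)" using chart_open_image[OF c o] V by blast
    show "frechet_derivative (f \<circ> inv_into U c) (at x) w = ((\<lambda>q. chart_vec M U c q w f) \<circ> inv_into U c) x"
      if "x \<in> c ` V" for x
    proof -
      obtain q where q: "q \<in> V" "x = c q" using \<open>x \<in> c ` V\<close> by blast
      have "sf q f" unfolding smooth_fun_near_def using V q by blast
      moreover have "inv_into U c x = q" using q V c by auto
      ultimately show ?thesis using q by (simp add: chart_vec_sf)
    qed
  qed (use V in blast)
qed

lemma sv_obtain:
  assumes "sv p X" "eventually P (nhds p)"
  obtains W where "open W" "p \<in> W" "smooth_vfield M W X" "\<And>q. q \<in> W \<Longrightarrow> P q"
proof -
  obtain W where W: "p \<in> W" "smooth_vfield M W X" using assms(1) unfolding smooth_vfield_near_def by blast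
  obtain V where V: "open V" "p \<in> V" "\<forall>q\<in>V. P q" using assms(2) unfolding eventually_nhds by blast
  have o: "open W" using W smooth_vfield_open by blast
  show ?thesis
    by (rule that[of "W \<inter> V"]) (use W V o smooth_vfield_subset[OF W(2), of "W \<inter> V"] in auto)
qed

lemma sv_eventually: "sv p X \<Longrightarrow> \<forall>\<^sub>F q in nhds p. sv q X"
  unfolding smooth_vfield_near_def eventually_nhds using smooth_vfield_open by blast

lemma sv_pair:
  assumes "sv p X" "sv p Y"
  obtains W where "open W" "p \<in> W" "smooth_vfield M W X" "smooth_vfield M W Y"
proof -
  obtain V where V: "p \<in> V" "open V" "smooth_vfield M V Y"
    using assms(2) unfolding smooth_vfield_near_def using smooth_vfield_open by blast
  obtain W where W: "open W" "p \<in> W" "smooth_vfield M W X" "\<And>q. q \<in> W \<Longrightarrow> q \<in> V"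
    using sv_obtain[OF assms(1), of "\<lambda>q. q \<in> V"] V eventually_nhds by blast
  show ?thesis by (rule that[OF W(1-3)]) (use V W smooth_vfield_subset in blast)
qed

lemma sv_tangent [intro]: "sv p X \<Longrightarrow> X p \<in> T p"
  unfolding smooth_vfield_near_def smooth_vfield_def by blast

lemma sv_cong:
  assumes "sv p X" "\<forall>\<^sub>F q in nhds p. X q = Y q" shows "sv p Y"
  by (rule sv_obtain[OF assms]) (auto simp: smooth_vfield_near_def intro: smooth_vfield_cong)

lemma sv_app [intro]: 
  assumes "sv p X" "sf p f" shows "sf p (\<lambda>q. X q f)"
proof -
  obtain V where V: "p \<in> V" "open V" "smooth_fun M V f"
    using assms(2) sf_eventually_smooth by blast
  obtain W where W: "open W" "p \<in> W" "smooth_vfield M W X" "\<And>q. q \<in> W \<Longrightarrow> q \<in> V"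
    using sv_obtain[OF assms(1), of "\<lambda>q. q \<in> V"] V eventually_nhds by blast
  have "smooth_fun M W f" using smooth_fun_subset[OF V(3) W(1)] W(4) by blast
  then show ?thesis using W unfolding smooth_vfield_def smooth_fun_near_def by blast
qed

lemma sv_add [intro]: 
  assumes "sv p X" "sv p Y" shows "sv p (\<lambda>q. X q + Y q)"
proof -
  obtain W where W: "open W" "p \<in> W" "smooth_vfield M W X" "smooth_vfield M W Y" using sv_pair[OF assms] .
  have "smooth_vfield M W (\<lambda>q. X q + Y q)"
    unfolding smooth_vfield_def
    by (use W in \<open>auto simp: smooth_vfield_def intro!: smooth_fun_add\<close>)
  then show ?thesis using W unfolding smooth_vfield_near_def by blast
qed

lemma sv_scale [intro]: 
  assumes "sf p f" "sv p X" shows "sv p (\<lambda>q. f q *\<^sub>R X q)"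
proof -
  obtain V where V: "p \<in> V" "open V" "smooth_fun M V f"
    using assms(1) sf_eventually_smooth by blast
  obtain W where W: "open W" "p \<in> W" "smooth_vfield M W X" "\<And>q. q \<in> W \<Longrightarrow> q \<in> V"
    using sv_obtain[OF assms(2), of "\<lambda>q. q \<in> V"] V eventually_nhds by blast
  have "smooth_vfield M W (\<lambda>q. f q *\<^sub>R X q)"
    unfolding smooth_vfield_def
  proof (intro conjI allI ballI impI W)
    show "f q *\<^sub>R X q \<in> T q" if "q \<in> W" for q using W(3) that unfolding smooth_vfield_def by blast
    fix V' g assume V': "V' \<subseteq> W \<and> smooth_fun M V' g"
    have "smooth_fun M V' f" using smooth_fun_subset[OF V(3)] V' W(4) smooth_fun_open by blast
    then show "smooth_fun M V' (\<lambda>q. (f q *\<^sub>R X q) g)"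
      using V' W(3) by (auto simp: scaleR_fun_def smooth_vfield_def intro: smooth_fun_mult)
  qed
  then show ?thesis using W unfolding smooth_vfield_near_def by blast
qed

lemma sv_uminus [intro]: "sv p X \<Longrightarrow> sv p (\<lambda>q. - X q)"
  using sv_scale[OF sf_const[of p "-1"], of X] by simp

lemma sv_diff [intro]: "sv p X \<Longrightarrow> sv p Y \<Longrightarrow> sv p (\<lambda>q. X q - Y q)"
  using sv_add[OF _ sv_uminus, of p X Y] by simp

lemma sv_const_scale [intro]: "sv p X \<Longrightarrow> sv p (\<lambda>q. a *\<^sub>R X q)"
  using sv_scale[OF sf_const[of p a], of X] by simp

lemma sv_ext:
  assumes "v \<in> T p" shows "\<exists>X. sv p X \<and> X p = v"
proof -
  obtain U c w where v: "(U, c) \<in> atlas M" "p \<in> U" "v = chart_vec M U c p w" using tangentE[OF assms(1)] .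
  show ?thesis
    by (rule exI[of _ "\<lambda>q. chart_vec M U c q w"])
      (use v smooth_vfield_chart[OF v(1)] in \<open>auto simp: smooth_vfield_near_def\<close>)
qed

lemma sv_0 [intro]: "sv p (\<lambda>q. 0)"
proof -
  obtain X where "sv p X" using sv_ext[OF T_0[of p]] by blast
  from sv_const_scale[OF this, of 0] show ?thesis by simp
qed

lemma sv_sum [intro]: "(\<And>i. i \<in> I \<Longrightarrow> sv p (X i)) \<Longrightarrow> sv p (\<lambda>q. \<Sum>i\<in>I. X i q)"
  by (induction I rule: infinite_finite_induct) auto

lemma local_ext:
  assumes "v \<in> T p" shows sv_local_ext: "sv p (local_ext M p v)" and local_ext_at: "local_ext M p v p = v"
  unfolding local_ext_def using someI_ex[OF sv_ext[OF assms]] by auto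

end

section \<open>Linear algebra of a tangent space\<close>

text \<open>Only values on \<open>V\<close> are constrained, because tensors at a point are
  arbitrary off the tangent space.\<close>

definition bil :: "'v::real_vector set \<Rightarrow> ('v \<Rightarrow> 'v \<Rightarrow> real) \<Rightarrow> bool" where
  "bil V P \<longleftrightarrow> (\<forall>x\<in>V. \<forall>y\<in>V. \<forall>w\<in>V. \<forall>a b.
     P (a *\<^sub>R x + b *\<^sub>R y) w = a * P x w + b * P y w \<and>
     P w (a *\<^sub>R x + b *\<^sub>R y) = a * P w x + b * P w y)"

text \<open>In the application the ambient type is a space of operators on functions, so the
  dimension of \<open>V\<close> is recorded by a finite basis and all axioms are relativized to
  \<open>V\<close>.\<close>

locale ac_space =
  fixes V :: "'v::real_vector set" and g :: "'v \<Rightarrow> 'v \<Rightarrow> real" and \<phi> :: "'v \<Rightarrow> 'v"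
    and \<eta> :: "'v \<Rightarrow> real" and z :: 'v and n :: nat
  assumes sub: "subspace V" and n_pos: "n \<ge> 1"
    and dim_V: "\<exists>B. finite B \<and> card B = Suc (2 * n) \<and> independent B \<and> span B = V"
    and bil_g: "bil V g" and g_sym: "\<And>x y. x \<in> V \<Longrightarrow> y \<in> V \<Longrightarrow> g x y = g y x"
    and g_pos: "\<And>x. x \<in> V \<Longrightarrow> x \<noteq> 0 \<Longrightarrow> g x x > 0"
    and phi_V [simp, intro]: "\<And>x. x \<in> V \<Longrightarrow> \<phi> x \<in> V"
    and phi_lin: "\<And>x y a b. x \<in> V \<Longrightarrow> y \<in> V \<Longrightarrow> \<phi> (a *\<^sub>R x + b *\<^sub>R y) = a *\<^sub>R \<phi> x + b *\<^sub>R \<phi> y"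
    and eta_lin: "\<And>x y a b. x \<in> V \<Longrightarrow> y \<in> V \<Longrightarrow> \<eta> (a *\<^sub>R x + b *\<^sub>R y) = a * \<eta> x + b * \<eta> y"
    and z_V [simp, intro]: "z \<in> V" and eta_z [simp]: "\<eta> z = 1"
    and phi_phi: "\<And>x. x \<in> V \<Longrightarrow> \<phi> (\<phi> x) = - x + \<eta> x *\<^sub>R z"
    and g_phi_phi: "\<And>x y. x \<in> V \<Longrightarrow> y \<in> V \<Longrightarrow> g (\<phi> x) (\<phi> y) = g x y - \<eta> x * \<eta> y"
begin

abbreviation "N \<equiv> Suc (2*n)"

lemma V_closed [simp, intro]:
  "x \<in> V \<Longrightarrow> y \<in> V \<Longrightarrow> x + y \<in> V" "x \<in> V \<Longrightarrow> a *\<^sub>R x \<in> V" "0 \<in> V"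
  "x \<in> V \<Longrightarrow> y \<in> V \<Longrightarrow> x - y \<in> V" "x \<in> V \<Longrightarrow> - x \<in> V"
  "(\<And>i. i \<in> I \<Longrightarrow> f i \<in> V) \<Longrightarrow> (\<Sum>i\<in>I. f i) \<in> V"
  using sub by (auto intro: subspace_add subspace_scale subspace_0 subspace_diff subspace_neg subspace_sum)

lemma bil_lin2:
  assumes "bil V P" "x \<in> V" "y \<in> V" "w \<in> V"
  shows "P (a *\<^sub>R x + b *\<^sub>R y) w = a * P x w + b * P y w" "P w (a *\<^sub>R x + b *\<^sub>R y) = a * P w x + b * P w y"
  using assms unfolding bil_def by blast+

lemma bil_lin:
  assumes P: "bil V P" and "x \<in> V" "w \<in> V"
  shows "y \<in> V \<Longrightarrow> P (x + y) w = P x w + P y w" "y \<in> V \<Longrightarrow> P w (x + y) = P w x + P w y"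
    "P (a *\<^sub>R x) w = a * P x w" "P w (a *\<^sub>R x) = a * P w x"
    "P (- x) w = - P x w" "P w (- x) = - P w x"
    "y \<in> V \<Longrightarrow> P (x - y) w = P x w - P y w" "y \<in> V \<Longrightarrow> P w (x - y) = P w x - P w y"
    "P 0 w = 0" "P w 0 = 0"
  using bil_lin2[OF P, of x y w 1 1] bil_lin2[OF P, of x y w 1 "-1"] bil_lin2[OF P, of x x w a 0]
    bil_lin2[OF P, of x x w "-1" 0] bil_lin2[OF P, of x x w 0 0] assms by auto

lemma bil_sum:
  assumes P: "bil V P" and "w \<in> V" and f: "\<And>i. i \<in> I \<Longrightarrow> f i \<in> V"
  shows "P (\<Sum>i\<in>I. f i) w = (\<Sum>i\<in>I. P (f i) w)" "P w (\<Sum>i\<in>I. f i) = (\<Sum>i\<in>I. P w (f i))"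
  using f by (induction I rule: infinite_finite_induct) (auto simp: bil_lin[OF P] bil_lin(9,10)[OF P z_V] assms(2))

lemmas g_lin [simp] = bil_lin[OF bil_g]

lemma eta_simps [simp]:
  assumes "x \<in> V"
  shows "y \<in> V \<Longrightarrow> \<eta> (x + y) = \<eta> x + \<eta> y" "\<eta> (a *\<^sub>R x) = a * \<eta> x" "\<eta> (- x) = - \<eta> x"
    "y \<in> V \<Longrightarrow> \<eta> (x - y) = \<eta> x - \<eta> y"
  using eta_lin[of x y 1 1] eta_lin[of x x a 0] eta_lin[of x x "-1" 0] eta_lin[of x y 1 "-1"] assms by auto

lemma eta_0 [simp]: "\<eta> 0 = 0"
  using eta_simps(2)[OF z_V, of 0] by simp

lemma phi_simps [simp]:
  assumes "x \<in> V"
  shows "y \<in> V \<Longrightarrow> \<phi> (x + y) = \<phi> x + \<phi> y" "\<phi> (a *\<^sub>R x) = a *\<^sub>R \<phi> x" "\<phi> (- x) = - \<phi> x"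
    "y \<in> V \<Longrightarrow> \<phi> (x - y) = \<phi> x - \<phi> y"
  using phi_lin[of x y 1 1] phi_lin[of x x a 0] phi_lin[of x x "-1" 0] phi_lin[of x y 1 "-1"] assms by auto

lemma phi_0 [simp]: "\<phi> 0 = 0"
  using phi_simps(2)[OF z_V, of 0] by simp

lemma z_nonzero: "z \<noteq> 0"
  using eta_z eta_0 by force

text \<open>Since \<open>\<phi> (\<phi> z) = 0\<close>, the axiom at \<open>\<phi> z\<close> makes
  \<open>\<phi> z\<close> the multiple \<open>\<eta> (\<phi> z)\<close> of \<open>z\<close>.
  Applying \<phi> once more shows that this multiple or \<open>\<phi> z\<close> is zero.\<close>

lemma phi_z [simp]: "\<phi> z = 0"
proof -
  have 0: "\<phi> (\<phi> z) = 0" using phi_phi[of z] by simp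
  have "\<phi> (\<phi> (\<phi> z)) = - \<phi> z + \<eta> (\<phi> z) *\<^sub>R z" using phi_phi[of "\<phi> z"] by simp
  then have 1: "\<phi> z = \<eta> (\<phi> z) *\<^sub>R z" using 0 by simp
  then have "\<phi> (\<phi> z) = \<eta> (\<phi> z) *\<^sub>R \<phi> z" by (metis phi_simps(2) z_V)
  then have "\<eta> (\<phi> z) *\<^sub>R \<phi> z = 0" using 0 by simp
  then show ?thesis using 1 by (metis scaleR_eq_0_iff scaleR_zero_left)
qed

text \<open>Computing the third power of \<phi> in two ways leaves the surplus
  \<open>\<eta> (\<phi> x) *\<^sub>R z\<close>, which must vanish because \<phi> kills
  \<open>z\<close>.\<close>

lemma eta_phi [simp]: "x \<in> V \<Longrightarrow> \<eta> (\<phi> x) = 0"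
  using phi_phi[of "\<phi> x"] phi_phi[of x] z_nonzero by (auto simp: phi_simps)

lemma g_z [simp]: "x \<in> V \<Longrightarrow> g x z = \<eta> x" "x \<in> V \<Longrightarrow> g z x = \<eta> x"
  using g_phi_phi[of x z] g_sym[of x z] by auto

lemma g_phi: "x \<in> V \<Longrightarrow> y \<in> V \<Longrightarrow> g (\<phi> x) y = - g x (\<phi> y)"
  using g_phi_phi[of "\<phi> x" y] phi_phi[of x] by simp

lemma g_eqI: 
  assumes "x \<in> V" "y \<in> V" "\<And>w. w \<in> V \<Longrightarrow> g x w = g y w" shows "x = y"
proof (rule ccontr)
  assume "x \<noteq> y"
  then have "g (x - y) (x - y) > 0" using g_pos[of "x - y"] assms by simp
  moreover have "g (x - y) (x - y) = 0" using assms by simp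
  ultimately show False by simp
qed

definition hr :: "'v \<Rightarrow> 'v" where "hr x = x - \<eta> x *\<^sub>R z"

lemma hr_V [simp, intro]: "x \<in> V \<Longrightarrow> hr x \<in> V" by (simp add: hr_def)
lemma eta_hr [simp]: "x \<in> V \<Longrightarrow> \<eta> (hr x) = 0" by (simp add: hr_def)
lemma phi_hr [simp]: "x \<in> V \<Longrightarrow> \<phi> (hr x) = \<phi> x" by (simp add: hr_def)
lemma hr_phi [simp]: "x \<in> V \<Longrightarrow> hr (\<phi> x) = \<phi> x" by (simp add: hr_def)
lemma hr_z [simp]: "hr z = 0" by (simp add: hr_def)
lemma hr_hor: "\<eta> x = 0 \<Longrightarrow> hr x = x" by (simp add: hr_def)
lemma hr_lin: "x \<in> V \<Longrightarrow> y \<in> V \<Longrightarrow> hr (a *\<^sub>R x + b *\<^sub>R y) = a *\<^sub>R hr x + b *\<^sub>R hr y"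
  by (simp add: hr_def algebra_simps)

section \<open>Orthonormal frames and traces\<close>

definition adapted :: "(nat \<Rightarrow> 'v) \<Rightarrow> bool" where
  "adapted e \<longleftrightarrow> (\<forall>i<N. e i \<in> V) \<and>
     (\<forall>i<N. \<forall>j<N. g (e i) (e j) = (if i = j then 1 else 0)) \<and> e (2*n) = z"

lemma adaptedD:
  assumes "adapted e"
  shows "i < N \<Longrightarrow> e i \<in> V"
    and "i < N \<Longrightarrow> j < N \<Longrightarrow> g (e i) (e j) = (if i = j then 1 else 0)"
    and "e (2*n) = z"
    and "i < N \<Longrightarrow> \<eta> (e i) = (if i = 2*n then 1 else 0)"
proof -
  have *: "\<forall>i<N. e i \<in> V" "e (2*n) = z"
    "\<forall>i<N. \<forall>j<N. g (e i) (e j) = (if i = j then 1 else 0)"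
    using assms unfolding adapted_def by blast+
  show "i < N \<Longrightarrow> \<eta> (e i) = (if i = 2*n then 1 else 0)"
    using * g_z(1)[of "e i"] by (metis lessI)
qed (use assms in \<open>auto simp: adapted_def\<close>)

lemma adapted_V: "adapted e \<Longrightarrow> i \<in> {..<N} \<Longrightarrow> e i \<in> V"
  using adaptedD(1) by blast

lemma orthogonal_independent:
  assumes E: "E \<subseteq> V" "0 \<notin> E" and o: "\<And>x y. x \<in> E \<Longrightarrow> y \<in> E \<Longrightarrow> x \<noteq> y \<Longrightarrow> g x y = 0"
  shows "independent E"
proof
  assume "dependent E"
  then obtain S u v where S: "finite S" "S \<subseteq> E" "(\<Sum>v\<in>S. u v *\<^sub>R v) = 0" "v \<in> S" "u v \<noteq> 0"
    unfolding dependent_explicit by blast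
  have "0 = g (\<Sum>v\<in>S. u v *\<^sub>R v) v" using S E by auto
  also have "\<dots> = (\<Sum>w\<in>S. g (u w *\<^sub>R w) v)"
    by (rule bil_sum(1)[OF bil_g]) (use S E in auto)
  also have "\<dots> = (\<Sum>w\<in>S. if w = v then u v * g v v else 0)"
    by (rule sum.cong) (use S E o in \<open>auto simp: subset_iff\<close>)
  also have "\<dots> = u v * g v v" using S by simp
  finally have "g v v = 0" using S by simp
  moreover have "v \<in> V" "v \<noteq> 0" using S E by auto
  ultimately show False using g_pos[of v] by simp
qed

lemma card_orthonormal:
  assumes e: "\<And>i. i < k \<Longrightarrow> e i \<in> V" "\<And>i j. i < k \<Longrightarrow> j < k \<Longrightarrow> g (e i) (e j) = (if i = j then 1 else 0)"
  shows "card (e ` {..<k}) = k" "independent (e ` {..<k})"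
proof -
  have ne: "e i \<noteq> e j" if "i < k" "j < k" "i \<noteq> j" for i j :: nat
    using e(2)[of i j] e(2)[of i i] that by auto
  then show "card (e ` {..<k}) = k" by (subst card_image) (auto simp: inj_on_def)
  show "independent (e ` {..<k})"
    by (rule orthogonal_independent) (use e(1) e(2) in \<open>fastforce simp: image_iff\<close>)+
qed

text \<open>Fewer than \<open>N\<close> vectors cannot span \<open>V\<close>, so some vector differs
  from its orthogonal projection. This starts each Gram-Schmidt step.\<close>

lemma orthonormal_extend:
  assumes e: "\<And>i. i < k \<Longrightarrow> e i \<in> V" "\<And>i j. i < k \<Longrightarrow> j < k \<Longrightarrow> g (e i) (e j) = (if i = j then 1 else 0)"
    and k: "k < N"
  shows "\<exists>v\<in>V. v - (\<Sum>i<k. g v (e i) *\<^sub>R e i) \<noteq> 0"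
proof (rule ccontr)
  assume "\<not> ?thesis"
  then have *: "v = (\<Sum>i<k. g v (e i) *\<^sub>R e i)" if "v \<in> V" for v using that by auto
  obtain B where B: "finite B" "card B = N" "independent B" "span B = V" using dim_V by blast
  have "V \<subseteq> span (e ` {..<k})"
  proof
    fix v assume "v \<in> V"
    have "(\<Sum>i<k. g v (e i) *\<^sub>R e i) \<in> span (e ` {..<k})"
      by (intro span_sum span_scale span_base) auto
    then show "v \<in> span (e ` {..<k})" using *[OF \<open>v \<in> V\<close>] by simp
  qed
  then have "B \<subseteq> span (e ` {..<k})" using B(4) span_superset[of B] by blast
  then have "N \<le> card (e ` {..<k})"
    using independent_span_bound[of "e ` {..<k}" B] B by auto
  then show False using k card_image_le[of "{..<k}" e] by simp
qed

lemma orthonormal_residual: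
  fixes k :: nat
  assumes e: "\<And>i. i < k \<Longrightarrow> e i \<in> V" "\<And>i j. i < k \<Longrightarrow> j < k \<Longrightarrow> g (e i) (e j) = (if i = j then 1 else 0)"
    and v: "v \<in> V" and j: "j < k"
  shows "g (v - (\<Sum>i<k. g v (e i) *\<^sub>R e i)) (e j) = 0"
proof -
  have sV: "(\<Sum>i<k. g v (e i) *\<^sub>R e i) \<in> V" by (rule V_closed(6)) (use e in auto)
  have "g (\<Sum>i<k. g v (e i) *\<^sub>R e i) (e j) = (\<Sum>i<k. g (g v (e i) *\<^sub>R e i) (e j))"
    by (rule bil_sum(1)[OF bil_g]) (use e j in auto)
  also have "\<dots> = (\<Sum>i<k. if i = j then g v (e j) else 0)"
    by (rule sum.cong) (use e j in auto)
  also have "\<dots> = g v (e j)" using j by simp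
  finally show ?thesis using v sV e(1)[OF j] by simp
qed

text \<open>A nonzero residual would be orthogonal to the frame and give \<open>N + 1\<close>
  independent vectors.\<close>

lemma frame_expand:
  assumes e: "adapted e" and v: "v \<in> V"
  shows "(\<Sum>i<N. g v (e i) *\<^sub>R e i) = v"
proof (rule ccontr)
  let ?k = "N"
  let ?w = "v - (\<Sum>i<?k. g v (e i) *\<^sub>R e i)"
  note eD = adaptedD[OF e]
  have eV: "e i \<in> V" if "i \<in> {..<?k}" for i using eD that by blast
  assume "(\<Sum>i<?k. g v (e i) *\<^sub>R e i) \<noteq> v"
  then have w0: "?w \<noteq> 0" by simp
  have sV: "(\<Sum>i<?k. g v (e i) *\<^sub>R e i) \<in> V" by (rule V_closed(6)) (use eV in blast)
  have wV: "?w \<in> V" using v sV by blast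
  have we: "g ?w (e j) = 0" if "j < ?k" for j
    by (rule orthonormal_residual[OF eD(1,2) v that])
  have E: "independent (insert ?w (e ` {..<?k}))"
  proof (rule orthogonal_independent)
    show "insert ?w (e ` {..<?k}) \<subseteq> V" using wV eV by blast
    have "e i \<noteq> 0" if "i < ?k" for i using eD(2)[OF that that] g_lin(9)[of "e i" "e i"] eV that by auto
    then show "0 \<notin> insert ?w (e ` {..<?k})" using w0 by auto
    fix x y assume xy: "x \<in> insert ?w (e ` {..<?k})" "y \<in> insert ?w (e ` {..<?k})" "x \<noteq> y"
    show "g x y = 0"
      using xy we g_sym[OF wV] eV eD(2) by (auto simp del: g_lin sum.lessThan_Suc)
  qed
  have "?w \<notin> e ` {..<?k}" using we eD(2) by (auto simp del: g_lin sum.lessThan_Suc) (metis one_neq_zero)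
  then have c: "card (insert ?w (e ` {..<?k})) = Suc ?k"
    using card_orthonormal(1)[OF eD(1,2)] by simp
  obtain B where B: "finite B" "card B = ?k" "independent B" "span B = V" using dim_V by blast
  have "insert ?w (e ` {..<?k}) \<subseteq> span B" unfolding B using wV eV by blast
  then have "Suc ?k \<le> ?k" using independent_span_bound[OF B(1) E] c B(2) by simp
  then show False by simp
qed

lemma parseval:
  assumes e: "adapted e" and "u \<in> V" "v \<in> V"
  shows "(\<Sum>i<N. g u (e i) * g v (e i)) = g u v"
proof -
  have "g u v = g (\<Sum>i<N. g u (e i) *\<^sub>R e i) v" using frame_expand[OF e assms(2)] by simp
  also have "\<dots> = (\<Sum>i<N. g (g u (e i) *\<^sub>R e i) v)"
    by (rule bil_sum(1)[OF bil_g assms(3)]) (use adaptedD[OF e] in blast)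
  also have "\<dots> = (\<Sum>i<N. g u (e i) * g v (e i))"
    by (rule sum.cong) (use adaptedD(1)[OF e] assms g_sym in auto)
  finally show ?thesis by simp
qed

lemma expand_bil:
  assumes e: "adapted e" and P: "bil V P" and "u \<in> V" "v \<in> V"
  shows "P u v = (\<Sum>i<N. g u (e i) * P (e i) v)" "P v u = (\<Sum>i<N. g u (e i) * P v (e i))"
proof -
  note eV = adapted_V[OF e]
  have "P u v = P (\<Sum>i<N. g u (e i) *\<^sub>R e i) v" using frame_expand[OF e assms(3)] by simp
  also have "\<dots> = (\<Sum>i<N. P (g u (e i) *\<^sub>R e i) v)"
    by (rule bil_sum(1)[OF P assms(4)]) (use eV in blast)
  finally show "P u v = (\<Sum>i<N. g u (e i) * P (e i) v)"
    using eV assms by (simp add: bil_lin[OF P] del: sum.lessThan_Suc)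
  have "P v u = P v (\<Sum>i<N. g u (e i) *\<^sub>R e i)" using frame_expand[OF e assms(3)] by simp
  also have "\<dots> = (\<Sum>i<N. P v (g u (e i) *\<^sub>R e i))"
    by (rule bil_sum(2)[OF P assms(4)]) (use eV in blast)
  finally show "P v u = (\<Sum>i<N. g u (e i) * P v (e i))"
    using eV assms by (simp add: bil_lin[OF P] del: sum.lessThan_Suc)
qed

definition tr :: "(nat \<Rightarrow> 'v) \<Rightarrow> ('v \<Rightarrow> 'v \<Rightarrow> real) \<Rightarrow> real" where
  "tr e P = (\<Sum>i<N. P (e i) (e i))"

text \<open>The sum depends on the vectors \<open>f i\<close> only through the matrix of sums over
  \<open>i\<close> of \<open>g (f i) (e j) * g (f i) (e k)\<close>. This is the identity for another
  frame, and the identity without its last diagonal entry for \<open>f i = \<phi> (e i)\<close>; the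
  next two lemmas are these cases.\<close>

lemma tr_image:
  assumes e: "adapted e" and P: "bil V P"
    and f: "\<And>i. i < N \<Longrightarrow> f i \<in> V"
  shows "(\<Sum>i<N. P (f i) (f i)) =
    (\<Sum>j<N. \<Sum>k<N. (\<Sum>i<N. g (f i) (e j) * g (f i) (e k)) * P (e j) (e k))"
proof -
  have eV: "e i \<in> V" if "i < N" for i using adaptedD[OF e] that by blast
  have "P (f i) (f i) = (\<Sum>j<N. \<Sum>k<N. g (f i) (e j) * g (f i) (e k) * P (e j) (e k))"
    if "i < N" for i
  proof -
    have "P (f i) (f i) = (\<Sum>j<N. g (f i) (e j) * P (e j) (f i))"
      using expand_bil(1)[OF e P f[OF that] f[OF that]] .
    also have "\<dots> = (\<Sum>j<N. g (f i) (e j) * (\<Sum>k<N. g (f i) (e k) * P (e j) (e k)))"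
      by (rule sum.cong) (use expand_bil(2)[OF e P f[OF that]] eV in auto)
    finally show ?thesis by (simp add: sum_distrib_left mult.assoc del: sum.lessThan_Suc)
  qed
  then have "(\<Sum>i<N. P (f i) (f i)) =
     (\<Sum>i<N. \<Sum>j<N. \<Sum>k<N. g (f i) (e j) * g (f i) (e k) * P (e j) (e k))"
    by (simp del: sum.lessThan_Suc)
  also have "\<dots> = (\<Sum>j<N. \<Sum>k<N. \<Sum>i<N. g (f i) (e j) * g (f i) (e k) * P (e j) (e k))"
    by (subst sum.swap, rule sum.cong[OF refl], subst sum.swap, rule refl)
  finally show ?thesis by (simp add: sum_distrib_right del: sum.lessThan_Suc)
qed

lemma tr_frame:
  assumes e: "adapted e" and f: "adapted f" and P: "bil V P"
  shows "tr f P = tr e P"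
proof -
  have eV: "e i \<in> V" "f i \<in> V" if "i < N" for i using adaptedD(1) e f that by blast+
  have "tr f P = (\<Sum>j<N. \<Sum>k<N. (\<Sum>i<N. g (f i) (e j) * g (f i) (e k)) * P (e j) (e k))"
    unfolding tr_def by (rule tr_image[OF e P]) (rule eV)
  also have "\<dots> = (\<Sum>j<N. \<Sum>k<N. (if j = k then P (e j) (e j) else 0))"
  proof (intro sum.cong refl)
    fix j k assume jk: "j \<in> {..<N}" "k \<in> {..<N}"
    have "(\<Sum>i<N. g (f i) (e j) * g (f i) (e k)) = (\<Sum>i<N. g (e j) (f i) * g (e k) (f i))"
      by (intro sum.cong refl) (use jk eV g_sym in auto)
    also have "\<dots> = (if j = k then 1 else 0)"
      using parseval[OF f, of "e j" "e k"] jk eV adaptedD(2)[OF e, of j k] by auto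
    finally show "(\<Sum>i<N. g (f i) (e j) * g (f i) (e k)) * P (e j) (e k) = (if j = k then P (e j) (e j) else 0)"
      by simp
  qed
  finally show ?thesis by (simp add: tr_def del: sum.lessThan_Suc)
qed

lemma tr_phi:
  assumes e: "adapted e" and P: "bil V P" 
  shows "tr e (\<lambda>x y. P (\<phi> x) (\<phi> y)) = tr e P - P z z"
proof -
  have eV: "e i \<in> V" if "i < N" for i using adaptedD(1) e that by blast+
  have "tr e (\<lambda>x y. P (\<phi> x) (\<phi> y)) = (\<Sum>j<N. \<Sum>k<N. (\<Sum>i<N. g (\<phi> (e i)) (e j) * g (\<phi> (e i)) (e k)) * P (e j) (e k))"
    unfolding tr_def by (rule tr_image[OF e P]) (use eV in blast)
  also have "\<dots> = (\<Sum>j<N. \<Sum>k<N. (if j = k then (if j = 2*n then 0 else P (e j) (e j)) else 0))"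
  proof (intro sum.cong refl)
    fix j k assume jk: "j \<in> {..<N}" "k \<in> {..<N}"
    have "(\<Sum>i<N. g (\<phi> (e i)) (e j) * g (\<phi> (e i)) (e k)) = (\<Sum>i<N. g (\<phi> (e j)) (e i) * g (\<phi> (e k)) (e i))"
    proof (intro sum.cong refl)
      fix i assume i: "i \<in> {..<N}"
      have "g (\<phi> (e i)) (e l) = - g (\<phi> (e l)) (e i)" if "l < N" for l
        using g_phi[of "e i" "e l"] g_sym[of "e i" "\<phi> (e l)"] eV that i by simp
      then show "g (\<phi> (e i)) (e j) * g (\<phi> (e i)) (e k) = g (\<phi> (e j)) (e i) * g (\<phi> (e k)) (e i)"
        using jk by simp
    qed
    also have "\<dots> = g (e j) (e k) - \<eta> (e j) * \<eta> (e k)"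
      using parseval[OF e, of "\<phi> (e j)" "\<phi> (e k)"] jk eV g_phi_phi by auto
    finally show "(\<Sum>i<N. g (\<phi> (e i)) (e j) * g (\<phi> (e i)) (e k)) * P (e j) (e k) = (if j = k then (if j = 2*n then 0 else P (e j) (e j)) else 0)"
      using jk adaptedD(2,4)[OF e] by auto
  qed
  also have "\<dots> = (\<Sum>j<N. if j = 2*n then 0 else P (e j) (e j))"
    by (simp del: sum.lessThan_Suc)
  finally show ?thesis using adaptedD(3)[OF e] by (simp add: tr_def)
qed

lemma sum_sym_skew:
  assumes "\<And>i j. i < k \<Longrightarrow> j < k \<Longrightarrow> P j i = (P i j :: real)" "\<And>i j. i < k \<Longrightarrow> j < k \<Longrightarrow> R j i = - R i j"
  shows "(\<Sum>i<k. \<Sum>j<k. P i j * R i j) = 0"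
proof -
  have "(\<Sum>i<k. \<Sum>j<k. P i j * R i j) = (\<Sum>i<k. \<Sum>j<k. P j i * R j i)" by (rule sum.swap)
  also have "\<dots> = (\<Sum>i<k. \<Sum>j<k. - (P i j * R i j))"
  proof (intro sum.cong refl)
    fix i j assume "i \<in> {..<k}" "j \<in> {..<k}"
    then show "P j i * R j i = - (P i j * R i j)" using assms(1)[of i j] assms(2)[of i j] by simp
  qed
  also have "\<dots> = - (\<Sum>i<k. \<Sum>j<k. P i j * R i j)" by (simp add: sum_negf)
  finally show ?thesis by simp
qed

end

text \<open>Adapted frames at a point come from the local smooth frames, whose construction relies
  on \<open>ac_space\<close> alone; hence a second layer.\<close>

locale ac_frame = ac_space +
  assumes ex_frame: "\<exists>e. adapted e"
begin

section \<open>Endomorphisms of forms, horizontal forms and their symmetry types\<close>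

definition sharp :: "('a \<Rightarrow> 'a \<Rightarrow> real) \<Rightarrow> 'a \<Rightarrow> 'a" where
  "sharp P x = (THE v. v \<in> V \<and> (\<forall>w\<in>V. g v w = P x w))"

lemma sharp_unique: "v \<in> V \<Longrightarrow> (\<And>w. w \<in> V \<Longrightarrow> g v w = P x w) \<Longrightarrow> sharp P x = v"
  unfolding sharp_def by (rule the_equality) (auto intro: g_eqI)

lemma g_frame_sum:
  assumes e: "adapted e" and P: "bil V P" and x: "x \<in> V" and w: "w \<in> V"
  shows "g (\<Sum>i<N. P x (e i) *\<^sub>R e i) w = P x w"
proof -
  note eV = adapted_V[OF e]
  have "g (\<Sum>i<N. P x (e i) *\<^sub>R e i) w = (\<Sum>i<N. g (P x (e i) *\<^sub>R e i) w)"
    by (rule bil_sum(1)[OF bil_g w]) (use eV in blast)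
  also have "\<dots> = (\<Sum>i<N. g w (e i) * P x (e i))"
    by (intro sum.cong refl) (use eV g_sym[OF w] w in simp)
  finally show ?thesis using expand_bil(2)[OF e P w x] by simp
qed

lemma frame_sum_V: "adapted e \<Longrightarrow> (\<Sum>i<N. c i *\<^sub>R e i) \<in> V"
  by (rule V_closed(6)) (use adaptedD in blast)

lemma sharp_frame:
  assumes "adapted e" "bil V P" "x \<in> V"
  shows "sharp P x = (\<Sum>i<N. P x (e i) *\<^sub>R e i)"
  by (rule sharp_unique) (rule frame_sum_V[OF assms(1)], rule g_frame_sum[OF assms])

lemma sharp:
  assumes P: "bil V P" and x: "x \<in> V"
  shows sharp_V: "sharp P x \<in> V" and g_sharp: "w \<in> V \<Longrightarrow> g (sharp P x) w = P x w"
proof -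
  obtain e where e: "adapted e" using ex_frame by blast
  show "sharp P x \<in> V" "w \<in> V \<Longrightarrow> g (sharp P x) w = P x w"
    unfolding sharp_frame[OF e P x] by (rule frame_sum_V[OF e], rule g_frame_sum[OF e P x])
qed

text \<open>Forms on the complement of \<open>z\<close>, extended by zero, so that identities can be
  stated on all of \<open>V\<close>.\<close>

definition hor_form :: "('a \<Rightarrow> 'a \<Rightarrow> real) \<Rightarrow> bool" where
  "hor_form P \<longleftrightarrow> bil V P \<and> (\<forall>x\<in>V. P z x = 0 \<and> P x z = 0)"

lemma hor_formD: "hor_form P \<Longrightarrow> bil V P" "hor_form P \<Longrightarrow> x \<in> V \<Longrightarrow> P z x = 0" "hor_form P \<Longrightarrow> x \<in> V \<Longrightarrow> P x z = 0"
  unfolding hor_form_def by auto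

lemma hor_form_phi_phi:
  assumes "hor_form P" "x \<in> V" "y \<in> V"
  shows "P (\<phi> (\<phi> x)) y = - P x y" "P x (\<phi> (\<phi> y)) = - P x y"
  using assms by (simp_all add: phi_phi bil_lin[OF hor_formD(1)] hor_formD)

lemma hor_form_hr:
  assumes "hor_form P" "x \<in> V" "y \<in> V"
  shows "P (hr x) y = P x y" "P x (hr y) = P x y"
  using assms by (simp_all add: hr_def bil_lin[OF hor_formD(1)] hor_formD)

lemma bil_phi: "bil V P \<Longrightarrow> bil V (\<lambda>x y. P (\<phi> x) (\<phi> y))"
  unfolding bil_def by (simp add: phi_lin)

lemma hor_form_phi: "bil V P \<Longrightarrow> hor_form (\<lambda>x y. P (\<phi> x) (\<phi> y))"
  unfolding hor_form_def using bil_phi[of P] by (simp add: bil_lin)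

text \<open>On horizontal forms \<phi> squares to -1 in each slot, hence the transformation by
  \<phi> in both slots is an involution and these halves project onto its eigenspaces.\<close>

definition inv_part where "inv_part P x y = (P x y + P (\<phi> x) (\<phi> y)) / (2::real)"
definition antiinv_part where "antiinv_part P x y = (P x y - P (\<phi> x) (\<phi> y)) / (2::real)"
definition sym_part where "sym_part P x y = (P x y + P y x) / (2::real)" for P :: "'a \<Rightarrow> 'a \<Rightarrow> real"
definition skew_part where "skew_part P x y = (P x y - P y x) / (2::real)" for P :: "'a \<Rightarrow> 'a \<Rightarrow> real"

lemma bil_comb: "bil V P \<Longrightarrow> bil V Q \<Longrightarrow> bil V (\<lambda>x y. a * P x y + b * Q x y)"
  unfolding bil_def by (auto simp: algebra_simps)

lemma bil_swap: "bil V P \<Longrightarrow> bil V (\<lambda>x y. P y x)"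
  unfolding bil_def by blast

lemma hor_form_comb: "hor_form P \<Longrightarrow> hor_form Q \<Longrightarrow> hor_form (\<lambda>x y. a * P x y + b * Q x y)"
  unfolding hor_form_def using bil_comb by simp

lemma hor_form_swap: "hor_form P \<Longrightarrow> hor_form (\<lambda>x y. P y x)"
  unfolding hor_form_def using bil_swap by simp

lemma hor_form_parts:
  assumes "hor_form P" shows "hor_form (inv_part P)" "hor_form (antiinv_part P)" "hor_form (sym_part P)" "hor_form (skew_part P)"
  using hor_form_comb[OF assms hor_form_phi[OF hor_formD(1)[OF assms]], of "1/2" "1/2"]
    hor_form_comb[OF assms hor_form_phi[OF hor_formD(1)[OF assms]], of "1/2" "-1/2"]
    hor_form_comb[OF assms hor_form_swap[OF assms], of "1/2" "1/2"]
    hor_form_comb[OF assms hor_form_swap[OF assms], of "1/2" "-1/2"]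
  by (simp_all add: inv_part_def[abs_def] antiinv_part_def[abs_def] sym_part_def[abs_def] skew_part_def[abs_def] field_simps)

definition fund :: "'a \<Rightarrow> 'a \<Rightarrow> real" where "fund x y = g x (\<phi> y)"

lemma bil_fund: "bil V fund" unfolding bil_def fund_def by (simp add: phi_lin)
lemma hor_form_fund: "hor_form fund" unfolding hor_form_def using bil_fund by (simp add: fund_def)
lemma fund_swap: "x \<in> V \<Longrightarrow> y \<in> V \<Longrightarrow> fund y x = - fund x y"
  unfolding fund_def using g_phi[of x y] g_sym[of "\<phi> x" y] by simp
lemma fund_phi: "x \<in> V \<Longrightarrow> y \<in> V \<Longrightarrow> fund (\<phi> x) (\<phi> y) = fund x y"
  unfolding fund_def using g_phi_phi[of x "\<phi> y"] by simp

definition met_hor :: "'a \<Rightarrow> 'a \<Rightarrow> real" where "met_hor x y = g (\<phi> x) (\<phi> y)"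

lemma hor_form_met_hor: "hor_form met_hor" using hor_form_phi[OF bil_g] by (simp add: met_hor_def[abs_def])
lemma met_hor_phi: "x \<in> V \<Longrightarrow> y \<in> V \<Longrightarrow> met_hor (\<phi> x) (\<phi> y) = met_hor x y"
  unfolding met_hor_def using g_phi_phi[of "\<phi> x" "\<phi> y"] by simp
lemma met_hor_swap: "x \<in> V \<Longrightarrow> y \<in> V \<Longrightarrow> met_hor y x = met_hor x y"
  unfolding met_hor_def using g_sym by simp

text \<open>The coefficients \<open>a\<close> and \<open>c\<close> are left free: uniqueness of the
  decomposition establishes this shape for unknown coefficients and determines them afterwards by
  traces.\<close>

definition component :: "('a \<Rightarrow> 'a \<Rightarrow> real) \<Rightarrow> real \<Rightarrow> real \<Rightarrow> nat \<Rightarrow> 'a \<Rightarrow> 'a \<Rightarrow> real" where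
  "component \<beta> a c i x y = (if i = 5 then a * met_hor x y else if i = 6 then c * fund x y
     else if i = 7 then inv_part (skew_part \<beta>) x y - c * fund x y else if i = 8 then inv_part (sym_part \<beta>) x y - a * met_hor x y
     else if i = 9 then antiinv_part (sym_part \<beta>) x y else antiinv_part (skew_part \<beta>) x y)"

text \<open>Signs of the components under \<open>\<phi>\<close> and under transposition; the index \<open>11\<close> stands for the
  skew form \<open>\<langle>\<xi>\<^sub>(\<^sub>1\<^sub>1\<^sub>)\<^sub>\<zeta>x, y\<rangle>\<close>, which anticommutes with \<open>\<phi>\<close>.\<close>

definition eps :: "nat \<Rightarrow> real" where "eps i = (if i \<in> {9,10,11} then -1 else 1)"
definition sg :: "nat \<Rightarrow> real" where "sg i = (if i \<in> {5,8,9} then 1 else -1)"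

lemma five_ten: "i \<in> {5..10} \<longleftrightarrow> i = 5 \<or> i = 6 \<or> i = 7 \<or> i = 8 \<or> i = 9 \<or> i = (10::nat)"
  by auto

lemma component_hor:
  assumes "hor_form \<beta>" shows "hor_form (component \<beta> a c i)"
proof -
  note p = hor_form_parts[OF assms]
  have "hor_form (\<lambda>x y. a * met_hor x y)" "hor_form (\<lambda>x y. c * fund x y)" "hor_form (\<lambda>x y. inv_part (skew_part \<beta>) x y - c * fund x y)"
    "hor_form (\<lambda>x y. inv_part (sym_part \<beta>) x y - a * met_hor x y)"
    using hor_form_comb[OF hor_form_met_hor hor_form_met_hor, of a 0] hor_form_comb[OF hor_form_fund hor_form_fund, of c 0]
      hor_form_comb[OF hor_form_parts(1)[OF p(4)] hor_form_fund, of 1 "-c"] hor_form_comb[OF hor_form_parts(1)[OF p(3)] hor_form_met_hor, of 1 "-a"] by simp_all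
  then show ?thesis
    using hor_form_parts(2)[OF p(3)] hor_form_parts(2)[OF p(4)]
    unfolding component_def[abs_def] by (cases "i = 5"; cases "i = 6"; cases "i = 7"; cases "i = 8"; cases "i = 9") simp_all
qed

lemma component_swap:
  assumes "i \<in> {5..10}" "x \<in> V" "y \<in> V"
  shows "component \<beta> a c i y x = sg i * component \<beta> a c i x y"
  using assms(1) assms(2,3) fund_swap[of x y] met_hor_swap[of x y] unfolding five_ten component_def sg_def inv_part_def antiinv_part_def sym_part_def skew_part_def
  by (elim disjE) (simp_all add: field_simps)

lemma component_phi:
  assumes b: "hor_form \<beta>" and "i \<in> {5..10}" "x \<in> V" "y \<in> V"
  shows "component \<beta> a c i (\<phi> x) (\<phi> y) = eps i * component \<beta> a c i x y"
  using assms(2) assms(3,4) fund_phi[of x y] met_hor_phi[of x y] unfolding five_ten component_def eps_def inv_part_def antiinv_part_def sym_part_def skew_part_def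
  by (elim disjE) (simp_all add: field_simps hor_form_phi_phi[OF b])

lemma component_sum:
  "component \<beta> a c 5 x y + component \<beta> a c 8 x y + component \<beta> a c 9 x y = sym_part \<beta> x y"
  "component \<beta> a c 6 x y + component \<beta> a c 7 x y + component \<beta> a c 10 x y = skew_part \<beta> x y"
  unfolding component_def inv_part_def antiinv_part_def by (simp_all add: field_simps)

lemma tr_comb: "tr e (\<lambda>x y. a * P x y + b * Q x y) = a * tr e P + b * tr e Q"
  unfolding tr_def by (simp add: sum.distrib sum_distrib_left del: sum.lessThan_Suc)

section \<open>Traces and the pairing with the fundamental form\<close>

lemma tr_met_hor:
  assumes e: "adapted e" shows "tr e met_hor = 2 * n"
proof -
  have "tr e g = (\<Sum>i<N. 1)"
    unfolding tr_def by (rule sum.cong) (use adaptedD(2)[OF e] in auto)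
  then show ?thesis using tr_phi[OF e bil_g] by (simp add: met_hor_def[abs_def])
qed

text \<open>\<open>fund (e i) (e j)\<close> is the coordinate of \<open>\<phi> (e j)\<close> along
  \<open>e i\<close>, so the inner sum collapses by linearity of \<open>P\<close>.\<close>

lemma pairing_F:
  assumes e: "adapted e" and P: "bil V P"
  shows "(\<Sum>i<N. \<Sum>j<N. P (e i) (e j) * fund (e i) (e j)) = tr e (\<lambda>x y. P (\<phi> x) y)"
proof -
  have eV: "e i \<in> V" if "i < N" for i using adaptedD(1) e that by blast+
  have "(\<Sum>i<N. \<Sum>j<N. P (e i) (e j) * fund (e i) (e j)) =
    (\<Sum>j<N. \<Sum>i<N. P (e i) (e j) * fund (e i) (e j))" by (rule sum.swap)
  also have "\<dots> = (\<Sum>j<N. P (\<phi> (e j)) (e j))"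
  proof (intro sum.cong refl)
    fix j assume j: "j \<in> {..<N}"
    have "P (\<phi> (e j)) (e j) = (\<Sum>i<N. g (\<phi> (e j)) (e i) * P (e i) (e j))"
      by (rule expand_bil(1)[OF e P]) (use j eV in auto)
    also have "\<dots> = (\<Sum>i<N. P (e i) (e j) * fund (e i) (e j))"
      by (intro sum.cong refl) (use j eV g_sym in \<open>simp add: fund_def\<close>)
    finally show "(\<Sum>i<N. P (e i) (e j) * fund (e i) (e j)) = P (\<phi> (e j)) (e j)" by simp
  qed
  finally show ?thesis by (simp add: tr_def)
qed

lemma hor_form_phi_left:
  assumes "hor_form P" shows "hor_form (\<lambda>x y. P (\<phi> x) y)"
proof -
  have "bil V (\<lambda>x y. P (\<phi> x) y)" using hor_formD(1)[OF assms] unfolding bil_def by (simp add: phi_lin)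
  then show ?thesis using hor_formD[OF assms] bil_lin(9)[OF hor_formD(1)[OF assms] z_V] unfolding hor_form_def by simp
qed

lemma tr_fund_phi:
  assumes e: "adapted e" shows "tr e (\<lambda>x y. fund (\<phi> x) y) = 2 * n"
proof -
  have "tr e (\<lambda>x y. fund (\<phi> x) y) = tr e met_hor"
    unfolding tr_def by (simp add: fund_def met_hor_def)
  then show ?thesis using tr_met_hor[OF e] by simp
qed

lemma tr_phi_hor_form:
  assumes e: "adapted e" and P: "hor_form P"
  shows "tr e (\<lambda>x y. P (\<phi> x) (\<phi> y)) = tr e P"
  using tr_phi[OF e hor_formD(1)[OF P]] hor_formD(2)[OF P z_V] by simp

lemma tr_cong: "adapted e \<Longrightarrow> (\<And>x. x \<in> V \<Longrightarrow> P x x = Q x x) \<Longrightarrow> tr e P = tr e Q"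
  unfolding tr_def by (rule sum.cong) (use adaptedD(1) in auto)

text \<open>Inserting \<phi> in both slots keeps the trace, and \<phi> squared in the left slot is a
  sign.\<close>

lemma tr_phi_right:
  assumes e: "adapted e" and P: "hor_form P"
  shows "tr e (\<lambda>x y. P x (\<phi> y)) = - tr e (\<lambda>x y. P (\<phi> x) y)"
proof -
  have "tr e (\<lambda>x y. P (\<phi> x) y) = tr e (\<lambda>x y. P (\<phi> (\<phi> x)) (\<phi> y))"
    using tr_phi_hor_form[OF e hor_form_phi_left[OF P]] by simp
  also have "\<dots> = tr e (\<lambda>x y. - 1 * P x (\<phi> y) + 0 * P x (\<phi> y))"
    by (rule tr_cong[OF e]) (simp add: hor_form_phi_phi[OF P])
  finally show ?thesis unfolding tr_comb by simp
qed

lemma tr_skew_part: "tr e (\<lambda>x y. skew_part P (\<phi> x) y) = (tr e (\<lambda>x y. P (\<phi> x) y) - tr e (\<lambda>x y. P x (\<phi> y))) / 2"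
  unfolding tr_def skew_part_def by (simp add: sum_subtractf[symmetric] sum_divide_distrib[symmetric] del: sum.lessThan_Suc)

lemma tr_hor: "adapted e \<Longrightarrow> hor_form P \<Longrightarrow> tr e P = (\<Sum>i<2*n. P (e i) (e i))"
  using adaptedD(3)[of e] hor_formD(2)[of P z] by (simp add: tr_def)

text \<open>The denominators are the traces of \<open>met_hor\<close> and of
  \<open>fund (\<phi> x) y\<close>, which both equal 2n.\<close>

abbreviation "c5 e \<beta> \<equiv> tr e \<beta> / (2 * n)"
abbreviation "c6 e \<beta> \<equiv> tr e (\<lambda>x y. \<beta> (\<phi> x) y) / (2 * n)"

lemma component_tr8:
  fixes a c :: real
  assumes e: "adapted e" and b: "hor_form \<beta>"
  shows "tr e (component \<beta> a c 8) = tr e \<beta> - 2 * n * a"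
proof -
  have "tr e (component \<beta> a c 8) = tr e (\<lambda>x y. 1 * (1/2 * \<beta> x y + 1/2 * \<beta> (\<phi> x) (\<phi> y)) + (-a) * met_hor x y)"
    by (rule tr_cong[OF e]) (simp add: component_def inv_part_def sym_part_def field_simps)
  then show ?thesis
    unfolding tr_comb tr_met_hor[OF e] tr_phi_hor_form[OF e b] by simp
qed

lemma component_tr7:
  fixes a c :: real
  assumes e: "adapted e" and b: "hor_form \<beta>"
  shows "tr e (\<lambda>x y. component \<beta> a c 7 (\<phi> x) y) = tr e (\<lambda>x y. \<beta> (\<phi> x) y) - 2 * n * c"
proof -
  have k: "hor_form (\<lambda>x y. skew_part \<beta> (\<phi> x) y)" using hor_form_phi_left[OF hor_form_parts(4)[OF b]] .
  have "tr e (\<lambda>x y. component \<beta> a c 7 (\<phi> x) y) =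
      tr e (\<lambda>x y. 1 * (1/2 * skew_part \<beta> (\<phi> x) y + 1/2 * skew_part \<beta> (\<phi> (\<phi> x)) (\<phi> y)) + (-c) * fund (\<phi> x) y)"
    by (rule tr_cong[OF e]) (simp add: component_def inv_part_def field_simps)
  then show ?thesis
    unfolding tr_comb tr_fund_phi[OF e] tr_phi_hor_form[OF e k] tr_skew_part tr_phi_right[OF e b] by simp
qed

section \<open>Existence and uniqueness of the decomposition\<close>

definition H :: "'a set" where "H = {x \<in> V. g z x = 0}"

lemma bil_subset: "bil V P \<Longrightarrow> U \<subseteq> V \<Longrightarrow> bil U P"
  unfolding bil_def by (meson subsetD)

lemma H_iff: "x \<in> H \<longleftrightarrow> x \<in> V \<and> \<eta> x = 0" unfolding H_def by auto
lemma H_V: "x \<in> H \<Longrightarrow> x \<in> V" by (simp add: H_iff)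
lemma H_phi: "x \<in> H \<Longrightarrow> \<phi> x \<in> H" by (simp add: H_iff)
definition decomp :: "('a \<Rightarrow> 'a \<Rightarrow> real) \<Rightarrow> (nat \<Rightarrow> 'a) \<Rightarrow> (nat \<Rightarrow> 'a \<Rightarrow> 'a \<Rightarrow> real) \<Rightarrow> bool" where
  "decomp \<beta> e b \<longleftrightarrow> (\<forall>i\<in>{5..10}. bil H (b i)) \<and>
     (\<forall>x\<in>H. \<forall>y\<in>H. \<beta> x y = b 5 x y + b 8 x y + b 9 x y + b 6 x y + b 7 x y + b 10 x y) \<and>
     (\<exists>c. \<forall>x\<in>H. \<forall>y\<in>H. b 5 x y = c * g x y) \<and>
     (\<forall>x\<in>H. \<forall>y\<in>H. b 8 y x = b 8 x y) \<and> (\<forall>x\<in>H. \<forall>y\<in>H. b 8 (\<phi> x) (\<phi> y) = b 8 x y) \<and>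
     (\<Sum>i<2*n. b 8 (e i) (e i)) = 0 \<and>
     (\<forall>x\<in>H. \<forall>y\<in>H. b 9 y x = b 9 x y) \<and> (\<forall>x\<in>H. \<forall>y\<in>H. b 9 (\<phi> x) (\<phi> y) = - b 9 x y) \<and>
     (\<exists>c. \<forall>x\<in>H. \<forall>y\<in>H. b 6 x y = c * fund x y) \<and>
     (\<forall>x\<in>H. \<forall>y\<in>H. b 7 y x = - b 7 x y) \<and> (\<forall>x\<in>H. \<forall>y\<in>H. b 7 (\<phi> x) (\<phi> y) = b 7 x y) \<and>
     (\<Sum>i<2*n. \<Sum>j<2*n. b 7 (e i) (e j) * fund (e i) (e j)) = 0 \<and>
     (\<forall>x\<in>H. \<forall>y\<in>H. b 10 y x = - b 10 x y) \<and> (\<forall>x\<in>H. \<forall>y\<in>H. b 10 (\<phi> x) (\<phi> y) = - b 10 x y)"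

lemma pairing_F_hor:
  assumes e: "adapted e" and P: "hor_form P"
  shows "(\<Sum>i<2*n. \<Sum>j<2*n. P (e i) (e j) * fund (e i) (e j)) = tr e (\<lambda>x y. P (\<phi> x) y)"
proof -
  have [simp]: "e i \<in> V" if "i < 2*n" for i using adaptedD(1)[OF e] that by simp
  show ?thesis unfolding pairing_F[OF e hor_formD(1)[OF P], symmetric]
    using adaptedD(3)[OF e] hor_formD(2,3)[OF hor_form_fund] by (simp add: sum.distrib)
qed

text \<open>Symmetry and \<phi>-type hold for arbitrary coefficients; \<open>c5\<close> and
  \<open>c6\<close> are the values for which the trace of component 8 and the F-pairing of component
  7 vanish.\<close>

lemma decomp_exists:
  assumes e: "adapted e" and b: "hor_form \<beta>"
  shows "decomp \<beta> e (component \<beta> (c5 e \<beta>) (c6 e \<beta>))"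
  unfolding decomp_def
proof (intro conjI ballI exI)
  let ?a = "c5 e \<beta>" and ?c = "c6 e \<beta>"
  let ?b = "component \<beta> ?a ?c"
  note V = H_V
  show "bil H (?b i)" for i
    by (rule bil_subset[OF hor_formD(1)[OF component_hor[OF b]]]) (simp add: H_def)
  show "\<beta> x y = ?b 5 x y + ?b 8 x y + ?b 9 x y + ?b 6 x y + ?b 7 x y + ?b 10 x y" for x y
    using component_sum[of \<beta> ?a ?c x y] by (simp add: sym_part_def skew_part_def field_simps)
  show "?b 5 x y = ?a * g x y" if "x \<in> H" "y \<in> H" for x y
    using that by (simp add: component_def met_hor_def g_phi_phi H_iff)
  show "?b 6 x y = ?c * fund x y" for x y by (simp add: component_def)
  show "?b 8 y x = ?b 8 x y" "?b 9 y x = ?b 9 x y" "?b 7 y x = - ?b 7 x y" "?b 10 y x = - ?b 10 x y"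
    if "x \<in> H" "y \<in> H" for x y
    using component_swap[of _ x y \<beta> ?a ?c] that V by (simp_all add: sg_def)
  show "?b 8 (\<phi> x) (\<phi> y) = ?b 8 x y" "?b 9 (\<phi> x) (\<phi> y) = - ?b 9 x y" "?b 7 (\<phi> x) (\<phi> y) = ?b 7 x y"
    "?b 10 (\<phi> x) (\<phi> y) = - ?b 10 x y"
    if "x \<in> H" "y \<in> H" for x y
    using component_phi[OF b, of _ x y ?a ?c] that V by (simp_all add: eps_def)
  show "(\<Sum>i<2*n. ?b 8 (e i) (e i)) = 0"
  proof -
    have "tr e (?b 8) = (\<Sum>i<2*n. ?b 8 (e i) (e i))" by (rule tr_hor[OF e component_hor[OF b]])
    moreover have "tr e (?b 8) = 0" using n_pos unfolding component_tr8[OF e b] by simp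
    ultimately show ?thesis by simp
  qed
  show "(\<Sum>i<2*n. \<Sum>j<2*n. ?b 7 (e i) (e j) * fund (e i) (e j)) = 0"
    using n_pos by (simp add: pairing_F_hor[OF e component_hor[OF b]] component_tr7[OF e b])
qed

lemma frame_H: "adapted e \<Longrightarrow> i < 2*n \<Longrightarrow> e i \<in> H"
  using adaptedD(1,4)[of e i] by (simp add: H_iff)

text \<open>Symmetry and \<phi>-type alone force every summand to be the corresponding projection,
  up to the multiples \<open>a\<close> of the metric and \<open>c\<close> of F; the two trace
  conditions then fix \<open>a\<close> and \<open>c\<close>.\<close>

lemma decomp_unique:
  assumes e: "adapted e" and b: "hor_form \<beta>" and d: "decomp \<beta> e b"
    and i: "i \<in> {5..10}" and x: "x \<in> H" and y: "y \<in> H"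
  shows "b i x y = component \<beta> (c5 e \<beta>) (c6 e \<beta>) i x y"
proof -
  have "\<exists>c. \<forall>x\<in>H. \<forall>y\<in>H. b 5 x y = c * g x y"
    using d unfolding decomp_def by (elim conjE)
  moreover have "\<exists>c. \<forall>x\<in>H. \<forall>y\<in>H. b 6 x y = c * fund x y"
    using d unfolding decomp_def by (elim conjE)
  ultimately obtain a c where a: "\<And>x y. x \<in> H \<Longrightarrow> y \<in> H \<Longrightarrow> b 5 x y = a * g x y"
    and c: "\<And>x y. x \<in> H \<Longrightarrow> y \<in> H \<Longrightarrow> b 6 x y = c * fund x y"
    by blast
  have hmg: "g x y = met_hor x y" if "x \<in> H" "y \<in> H" for x y
    using that by (simp add: met_hor_def g_phi_phi H_iff)
  have *: "b j x y = component \<beta> a c j x y" if j: "j \<in> {5..10}" and x: "x \<in> H" and y: "y \<in> H" for j x y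
  proof -
    have S: "\<forall>x\<in>H. \<forall>y\<in>H. \<beta> x y = b 5 x y + b 8 x y + b 9 x y + b 6 x y + b 7 x y + b 10 x y"
      using d unfolding decomp_def by (elim conjE)
    have sw8: "\<forall>x\<in>H. \<forall>y\<in>H. b 8 y x = b 8 x y"
      using d unfolding decomp_def by (elim conjE)
    have sw9: "\<forall>x\<in>H. \<forall>y\<in>H. b 9 y x = b 9 x y"
      using d unfolding decomp_def by (elim conjE)
    have sw7: "\<forall>x\<in>H. \<forall>y\<in>H. b 7 y x = - b 7 x y"
      using d unfolding decomp_def by (elim conjE)
    have sw10: "\<forall>x\<in>H. \<forall>y\<in>H. b 10 y x = - b 10 x y"
      using d unfolding decomp_def by (elim conjE)
    have ph8: "\<forall>x\<in>H. \<forall>y\<in>H. b 8 (\<phi> x) (\<phi> y) = b 8 x y"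
      using d unfolding decomp_def by (elim conjE)
    have ph9: "\<forall>x\<in>H. \<forall>y\<in>H. b 9 (\<phi> x) (\<phi> y) = - b 9 x y"
      using d unfolding decomp_def by (elim conjE)
    have ph7: "\<forall>x\<in>H. \<forall>y\<in>H. b 7 (\<phi> x) (\<phi> y) = b 7 x y"
      using d unfolding decomp_def by (elim conjE)
    have ph10: "\<forall>x\<in>H. \<forall>y\<in>H. b 10 (\<phi> x) (\<phi> y) = - b 10 x y"
      using d unfolding decomp_def by (elim conjE)
    note S = S[rule_format] and sw = sw8[rule_format] sw9[rule_format] sw7[rule_format] sw10[rule_format]
      and ph = ph8[rule_format] ph9[rule_format] ph7[rule_format] ph10[rule_format]
    have r: "b 5 (\<phi> x) (\<phi> y) = a * met_hor x y" "b 5 x y = a * met_hor x y" "b 6 (\<phi> x) (\<phi> y) = c * fund x y" "b 6 x y = c * fund x y"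
       "b 5 (\<phi> y) (\<phi> x) = a * met_hor x y" "b 5 y x = a * met_hor x y" "b 6 (\<phi> y) (\<phi> x) = - c * fund x y" "b 6 y x = - c * fund x y"
      using x y H_phi a c H_V hmg met_hor_phi[of x y] met_hor_swap[of x y] met_hor_phi[of y x] fund_phi[of x y] fund_swap[of x y] fund_phi[of y x] by simp_all
    \<comment> \<open>Four evaluations, under transposition and under \<phi>, form a linear system
      whose solution is the formula for each component.\<close>
    note S4 = S[OF x y] S[OF y x] S[OF H_phi[OF x] H_phi[OF y]] S[OF H_phi[OF y] H_phi[OF x]]
    note q = S4[unfolded r sw[OF x y] sw[OF H_phi[OF x] H_phi[OF y]] ph[OF x y] ph[OF y x]]
    show ?thesis
      using j q r unfolding five_ten component_def inv_part_def antiinv_part_def sym_part_def skew_part_def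
      by (elim disjE) (simp_all add: field_simps)
  qed
  have V2: "e i \<in> H" if "i < 2*n" for i using frame_H[OF e that] .
  \<comment> \<open>The trace condition on component 8 is a linear equation for \<open>a\<close>;
    below, the one on component 7 is a linear equation for \<open>c\<close>.\<close>
  have "(\<Sum>i<2*n. b 8 (e i) (e i)) = 0" using d unfolding decomp_def by (elim conjE)
  then have "0 = (\<Sum>i<2*n. b 8 (e i) (e i))" by simp
  also have "\<dots> = (\<Sum>i<2*n. component \<beta> a c 8 (e i) (e i))"
    by (intro sum.cong refl) (use * V2 in simp)
  also have "\<dots> = tr e \<beta> - 2 * n * a" using tr_hor[OF e component_hor[OF b]] component_tr8[OF e b] by metis
  finally have ae: "a = c5 e \<beta>" using n_pos by (simp add: field_simps)
  have "(\<Sum>i<2*n. \<Sum>j<2*n. b 7 (e i) (e j) * fund (e i) (e j)) = 0"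
    using d unfolding decomp_def by (elim conjE)
  then have "0 = (\<Sum>i<2*n. \<Sum>j<2*n. b 7 (e i) (e j) * fund (e i) (e j))" by simp
  also have "\<dots> = (\<Sum>i<2*n. \<Sum>j<2*n. component \<beta> a c 7 (e i) (e j) * fund (e i) (e j))"
    by (intro sum.cong refl) (use * V2 in simp)
  also have "\<dots> = tr e (\<lambda>x y. \<beta> (\<phi> x) y) - 2 * n * c" using pairing_F_hor[OF e component_hor[OF b]] component_tr7[OF e b] by metis
  finally have "c = c6 e \<beta>" using n_pos by (simp add: field_simps)
  with ae show ?thesis using *[OF i x y] by simp
qed

end

section \<open>Quadratic expressions in the components\<close>

locale ac_components = ac_frame +
  fixes B :: "nat \<Rightarrow> 'a \<Rightarrow> 'a \<Rightarrow> real"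
  assumes B_hor: "i \<in> {5..11} \<Longrightarrow> hor_form (B i)"
    and B_swap: "i \<in> {5..11} \<Longrightarrow> x \<in> V \<Longrightarrow> y \<in> V \<Longrightarrow> B i y x = sg i * B i x y"
    and B_phi: "i \<in> {5..11} \<Longrightarrow> x \<in> V \<Longrightarrow> y \<in> V \<Longrightarrow> B i (\<phi> x) (\<phi> y) = eps i * B i x y"
begin

text \<open>In the application these are \<xi>_(i)x \<zeta> for i at most 10, and \<xi>_(11)\<zeta>
  x for i = 11.\<close>

definition "b i x = sharp (B i) x"

lemma b_V [simp, intro]: "i \<in> {5..11} \<Longrightarrow> x \<in> V \<Longrightarrow> b i x \<in> V"
  unfolding b_def using sharp_V[OF hor_formD(1)[OF B_hor]] by blast

lemma g_b: "i \<in> {5..11} \<Longrightarrow> x \<in> V \<Longrightarrow> y \<in> V \<Longrightarrow> g (b i x) y = B i x y"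
  unfolding b_def using g_sharp[OF hor_formD(1)[OF B_hor]] by blast

lemma eta_b [simp]: "i \<in> {5..11} \<Longrightarrow> x \<in> V \<Longrightarrow> \<eta> (b i x) = 0"
  using g_b[of i x z] hor_formD(3)[OF B_hor] by simp

text \<open>Replacing \<open>w\<close> by minus \<phi> squared of \<open>w\<close> allows both slots
  of \<open>B i\<close> to be rotated at once.\<close>

lemma b_phi: assumes "i \<in> {5..11}" "x \<in> V" shows "b i (\<phi> x) = eps i *\<^sub>R \<phi> (b i x)"
proof (rule g_eqI)
  fix w assume w: "w \<in> V"
  have "g (b i (\<phi> x)) w = - B i (\<phi> x) (\<phi> (\<phi> w))" using assms w by (simp add: g_b hor_form_phi_phi[OF B_hor])
  also have "\<dots> = g (eps i *\<^sub>R \<phi> (b i x)) w"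
    using assms w B_phi[of i x "\<phi> w"] by (simp add: g_phi g_b)
  finally show "g (b i (\<phi> x)) w = g (eps i *\<^sub>R \<phi> (b i x)) w" .
qed (use assms in auto)

text \<open>A normal form for products of two components: transposition exchanges \<open>i\<close>
  and \<open>j\<close>, and \<phi> in both slots multiplies by \<open>eps i * eps j\<close>.\<close>

definition "G i j x y = g (b i x) (b j y)"

lemma B_b: "i \<in> {5..11} \<Longrightarrow> j \<in> {5..11} \<Longrightarrow> x \<in> V \<Longrightarrow> y \<in> V \<Longrightarrow> B i x (b j y) = G i j x y"
  by (simp add: G_def g_b)

lemma B_b': "i \<in> {5..11} \<Longrightarrow> j \<in> {5..11} \<Longrightarrow> x \<in> V \<Longrightarrow> y \<in> V \<Longrightarrow> B i (b j x) y = sg i * G j i x y"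
  using B_swap[of i y "b j x"] g_sym[of "b i y" "b j x"] by (simp add: G_def g_b)

lemma G_swap: "i \<in> {5..11} \<Longrightarrow> j \<in> {5..11} \<Longrightarrow> x \<in> V \<Longrightarrow> y \<in> V \<Longrightarrow> G i j y x = G j i x y"
  unfolding G_def using g_sym by simp

lemma G_phi: "i \<in> {5..11} \<Longrightarrow> j \<in> {5..11} \<Longrightarrow> x \<in> V \<Longrightarrow> y \<in> V \<Longrightarrow> G i j (\<phi> x) (\<phi> y) = eps i * eps j * G i j x y"
  unfolding G_def by (simp add: b_phi g_phi_phi)

definition "K x y = B 6 x y + B 7 x y + B 10 x y"
definition "b_sum x = b 5 x + b 6 x + b 7 x + b 8 x + b 9 x + b 10 x"
text \<open>Half of the quadratic part of d\<theta> on horizontal vectors;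
  \<open>b 11 x - b_sum x\<close> is the horizontal part of the torsion of the minimal connection
  paired with \<zeta>.\<close>

definition "R x y = K (b 11 x - b_sum x) y + K x (b 11 y - b_sum y)"

lemma B_phi_left: "i \<in> {5..11} \<Longrightarrow> x \<in> V \<Longrightarrow> y \<in> V \<Longrightarrow> B i (\<phi> x) y = - (eps i * B i x (\<phi> y))"
  using B_phi[of i x "\<phi> y"] by (simp add: hor_form_phi_phi[OF B_hor])

text \<open>For \<open>i\<close> and \<open>j\<close> both in 6, 7, 10 the summand
  \<open>G i j - G j i\<close> is antisymmetric in the indices, so these pairs cancel and
  \<open>j\<close> runs only over the symmetric components.\<close>

lemma R_eq:
  assumes "x \<in> V" "y \<in> V"
  shows "R x y = (\<Sum>i\<leftarrow>[6,7,10]. (G i 11 x y - G 11 i x y) - (\<Sum>j\<leftarrow>[5,8,9]. G i j x y - G j i x y))"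
proof -
  have L: "B i (b 11 x - b_sum x) y = sg i * (G 11 i x y - (G 5 i x y + G 6 i x y + G 7 i x y + G 8 i x y + G 9 i x y + G 10 i x y)) "
    "B i x (b 11 y - b_sum y) = G i 11 x y - (G i 5 x y + G i 6 x y + G i 7 x y + G i 8 x y + G i 9 x y + G i 10 x y)"
    if i: "i \<in> {6,7,10}" for i
    using assms i unfolding b_sum_def
    by (auto simp: bil_lin[OF hor_formD(1)[OF B_hor]] B_b B_b' G_swap algebra_simps sg_def)
  show ?thesis unfolding R_def K_def using L[of 6] L[of 7] L[of 10] by (simp add: sg_def)
qed

text \<open>The pairs with \<open>eps i * eps j = 1\<close>. As \<open>b 5\<close> is
  \<open>a\<close> times the horizontal projection and \<open>b 6\<close> is \<open>-c\<close> times
  \<phi>, the first three terms are the pairs (6,5), (7,5) and (6,8).\<close>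

definition R_inv :: "real \<Rightarrow> real \<Rightarrow> 'a \<Rightarrow> 'a \<Rightarrow> real" where
  "R_inv a c x y = - 2 * a * c * fund x y - 2 * a * B 7 x y - 2 * c * B 8 x (\<phi> y) - B 7 x (b 8 y) + B 7 y (b 8 x)
      + B 9 x (b 10 y) - B 9 y (b 10 x) + B 10 x (b 11 y) - B 10 y (b 11 x)"

text \<open>The pairs with \<open>eps i * eps j = -1\<close>. The pair (6,9) is absent: \<phi>
  anticommutes with \<open>b 9\<close>, so \<open>G 6 9\<close> and \<open>G 9 6\<close> agree. For
  the skew \<open>b 11\<close> the same anticommutation doubles the term.\<close>

definition R_antiinv :: "real \<Rightarrow> real \<Rightarrow> 'a \<Rightarrow> 'a \<Rightarrow> real" where
  "R_antiinv a c x y = 2 * c * g (b 11 x) (\<phi> y) - B 7 x (b 9 y) + B 7 y (b 9 x) + B 7 x (b 11 y) - B 7 y (b 11 x)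
      - 2 * a * B 10 x y + B 8 x (b 10 y) - B 8 y (b 10 x)"

lemma R_parts:
  fixes a c :: real
  assumes x: "x \<in> V" and y: "y \<in> V"
    and B5: "\<And>x y. x \<in> V \<Longrightarrow> y \<in> V \<Longrightarrow> B 5 x y = a * met_hor x y"
    and B6: "\<And>x y. x \<in> V \<Longrightarrow> y \<in> V \<Longrightarrow> B 6 x y = c * fund x y"
  shows R_11: "(R (\<phi> (\<phi> x)) (\<phi> (\<phi> y)) + R (\<phi> x) (\<phi> y)) / 2 = R_inv a c x y"
    and R_20: "(R (\<phi> (\<phi> x)) (\<phi> (\<phi> y)) - R (\<phi> x) (\<phi> y)) / 2 =
      R_antiinv a c x y"
proof -
  have b5: "b 5 u = a *\<^sub>R hr u" if "u \<in> V" for u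
  proof (rule g_eqI)
    show "g (b 5 u) w = g (a *\<^sub>R hr u) w" if "w \<in> V" for w
      using that \<open>u \<in> V\<close> B5[of u w] by (simp add: g_b met_hor_def g_phi_phi hr_def algebra_simps)
  qed (use that in simp_all)
  have b6: "b 6 u = (-c) *\<^sub>R \<phi> u" if "u \<in> V" for u
    by (rule g_eqI) (use that B6 in \<open>simp_all add: g_b fund_def g_phi\<close>)
  have G5: "G i 5 x y = a * B i x y" "G 5 i x y = a * B i y x" if "i \<in> {5..11}" for i
    using B_b[of i 5 x y] B_b[of i 5 y x] G_swap[of i 5 x y] that x y b5
    by (simp_all add: bil_lin[OF hor_formD(1)[OF B_hor]] hor_form_hr[OF B_hor])
  have G6: "G i 6 x y = - c * B i x (\<phi> y)" "G 6 i x y = - c * B i y (\<phi> x)" if "i \<in> {5..11}" for i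
    using B_b[of i 6 x y] B_b[of i 6 y x] G_swap[of i 6 x y] that x y b6
    by (simp_all add: bil_lin[OF hor_formD(1)[OF B_hor]])
  \<comment> \<open>Moves \<phi> to the other argument; the sign combines transposition with the
    \<phi>-type and decides whether products with component 6 double or cancel.\<close>
  have s: "B i y (\<phi> x) = - (sg i * eps i * B i x (\<phi> y))" if "i \<in> {5..11}" for i
    using that x y B_swap[of i y "\<phi> x"] B_swap[of i "\<phi> x" y] B_phi_left[of i x y] by (auto simp: sg_def)
  have ph: "G i j (\<phi> (\<phi> x)) (\<phi> (\<phi> y)) = G i j x y" if "i \<in> {5..11}" "j \<in> {5..11}" for i j
    using that x y by (simp add: G_phi) (simp add: eps_def)
  note R = R_eq[of "\<phi> (\<phi> x)" "\<phi> (\<phi> y)"] R_eq[of "\<phi> x" "\<phi> y"]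
  have r: "B i x (b j y) = G i j x y" "B i y (b j x) = G j i x y" if "i \<in> {5..11}" "j \<in> {5..11}" for i j
    using that x y by (simp_all add: B_b G_swap)
  have r2: "g (b 11 x) (\<phi> y) = B 11 x (\<phi> y)" using x y by (simp add: g_b)
  note v = B_swap[of 7 x y] B_swap[of 6 x y] B_swap[of 10 x y] B6[of x y]
  have v5: "B 5 x (\<phi> y) = a * fund x y"
    using x y B5[of x "\<phi> y"] g_phi_phi[of x "\<phi> y"] by (simp add: met_hor_def fund_def)
  show "(R (\<phi> (\<phi> x)) (\<phi> (\<phi> y)) + R (\<phi> x) (\<phi> y)) / 2 =
      R_inv a c x y"
    using x y v v5 by (simp add: R_inv_def R ph G_phi r eps_def G5 G6 s) (simp add: sg_def algebra_simps)
  show "(R (\<phi> (\<phi> x)) (\<phi> (\<phi> y)) - R (\<phi> x) (\<phi> y)) / 2 =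
      R_antiinv a c x y"
    using x y v v5 by (simp add: R_antiinv_def R ph G_phi r r2 eps_def G5 G6 s) (simp add: sg_def algebra_simps)
qed

text \<open>On the diagonal the two terms of each of the pairs (7,8), (9,10), (10,11) coincide,
  hence the factors 2. The linear terms in components 7 and 8 have zero trace, and the F-term
  contributes 2n times its coefficient.\<close>

lemma tr_R_11:
  fixes a c :: real
  assumes e: "adapted e" and t7: "tr e (\<lambda>x y. B 7 (\<phi> x) y) = 0" and t8: "tr e (B 8) = 0"
  shows "tr e (\<lambda>x y. R_inv a c (\<phi> x) y) =
    - 4 * n * a * c + 2 * tr e (\<lambda>x y. B 7 x (\<phi> (b 8 y))) + 2 * tr e (\<lambda>x y. B 10 x (\<phi> (b 11 y)))"
    (is "tr e ?f = _")
proof -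
  have V: "e i \<in> V" if "i < N" for i using adaptedD(1)[OF e that] .
  have "tr e ?f = tr e (\<lambda>x y. 1 * (1 * (-2*a*c * fund (\<phi> x) y + -2*a * B 7 (\<phi> x) y) + 1 * (-2*c * B 8 (\<phi> x) (\<phi> y) + 2 * B 9 (\<phi> x) (b 10 y)))
      + 1 * (2 * B 7 x (\<phi> (b 8 y)) + 2 * B 10 x (\<phi> (b 11 y))))"
    by (rule tr_cong[OF e])
      (simp add: R_inv_def b_phi B_phi_left bil_lin[OF hor_formD(1)[OF B_hor]], simp add: eps_def algebra_simps B_phi_left)
  also have "\<dots> = - 2*a*c * (2*n) + 2 * tr e (\<lambda>x y. B 9 (\<phi> x) (b 10 y))
      + (2 * tr e (\<lambda>x y. B 7 x (\<phi> (b 8 y))) + 2 * tr e (\<lambda>x y. B 10 x (\<phi> (b 11 y))))"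
    unfolding tr_comb tr_fund_phi[OF e] t7 using tr_phi_hor_form[OF e, of "B 8"] B_hor t8 by simp
  \<comment> \<open>Component 9 with \<phi> in one slot is still symmetric, while component 10 is
    skew, so their full contraction vanishes.\<close>
  also have "tr e (\<lambda>x y. B 9 (\<phi> x) (b 10 y)) = 0"
  proof -
    have "tr e (\<lambda>x y. B 9 (\<phi> x) (b 10 y)) = (\<Sum>i<N. \<Sum>j<N. B 9 (\<phi> (e i)) (e j) * B 10 (e i) (e j))"
      unfolding tr_def
    proof (intro sum.cong refl)
      fix i assume i: "i \<in> {..<N}"
      have "B 9 (\<phi> (e i)) (b 10 (e i)) = (\<Sum>j<N. g (b 10 (e i)) (e j) * B 9 (\<phi> (e i)) (e j))"
        by (rule expand_bil(2)[OF e hor_formD(1)[OF B_hor]]) (use i V in auto)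
      also have "\<dots> = (\<Sum>j<N. B 9 (\<phi> (e i)) (e j) * B 10 (e i) (e j))"
        by (intro sum.cong refl) (use i V in \<open>simp add: g_b\<close>)
      finally show "B 9 (\<phi> (e i)) (b 10 (e i)) = (\<Sum>j<N. B 9 (\<phi> (e i)) (e j) * B 10 (e i) (e j))" .
    qed
    also have "\<dots> = 0"
    proof (rule sum_sym_skew)
      fix i j assume ij: "i < N" "j < N"
      show "B 9 (\<phi> (e j)) (e i) = B 9 (\<phi> (e i)) (e j)"
        using V[OF ij(1)] V[OF ij(2)] B_phi_left[of 9 "e j" "e i"] B_swap[of 9 "e j" "\<phi> (e i)"]
        by (simp add: eps_def sg_def)
      show "B 10 (e j) (e i) = - B 10 (e i) (e j)"
        using V[OF ij(1)] V[OF ij(2)] B_swap[of 10 "e i" "e j"] by (simp add: sg_def)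
    qed
    finally show ?thesis .
  qed
  finally show ?thesis by simp
qed

end

section \<open>The minimal connection\<close>

locale acm_lc =
  fixes M :: "('a::{t2_space,second_countable_topology}, 'e::euclidean_space, 'm) acm_scheme"
    and n :: nat
  assumes acm: "almost_contact_metric_manifold n M" and lc: "levi_civita M"
begin

lemma acm_D:
  shows acm_n: "n \<ge> 1" and acm_dim: "DIM('e) = Suc (2 * n)" and acm_atlas: "smooth_atlas (atlas M)"
    and acm_metric: "riemannian_metric M"
    and acm_phi_V: "v \<in> tangent_space M p \<Longrightarrow> phi M p v \<in> tangent_space M p"
    and acm_phi_lin: "linear_at M p (phi M p)"
    and acm_phi_smooth: "smooth_vfield M W X \<Longrightarrow> smooth_vfield M W (\<lambda>q. phi M q (X q))"
    and acm_zeta: "smooth_vfield M UNIV (zeta M)"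
    and acm_eta_lin: "linear_at M p (eta M p)"
    and acm_eta_smooth: "smooth_vfield M W X \<Longrightarrow> smooth_fun M W (\<lambda>q. eta M q (X q))"
    and acm_phi_phi: "v \<in> tangent_space M p \<Longrightarrow> phi M p (phi M p v) = - v + eta M p v *\<^sub>R zeta M p"
    and acm_eta_zeta: "eta M p (zeta M p) = 1"
    and acm_met_phi: "v \<in> tangent_space M p \<Longrightarrow> w \<in> tangent_space M p \<Longrightarrow>
      met M p (phi M p v) (phi M p w) = met M p v w - eta M p v * eta M p w"
  using acm unfolding almost_contact_metric_manifold_def by simp_all

lemma met_D:
  shows met_lin: "v \<in> tangent_space M p \<Longrightarrow> linear_at M p (met M p v)"
    and met_sym: "v \<in> tangent_space M p \<Longrightarrow> w \<in> tangent_space M p \<Longrightarrow> met M p v w = met M p w v"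
    and met_pos: "v \<in> tangent_space M p \<Longrightarrow> v \<noteq> 0 \<Longrightarrow> met M p v v > 0"
    and met_smooth: "smooth_vfield M W X \<Longrightarrow> smooth_vfield M W Y \<Longrightarrow> smooth_fun M W (\<lambda>q. met M q (X q) (Y q))"
  using acm_metric unfolding riemannian_metric_def by simp_all

end

sublocale acm_lc \<subseteq> smooth_manifold M
  by standard (rule acm_atlas)

context acm_lc begin

lemma bil_met: "bil (T p) (met M p)"
  unfolding bil_def
proof (intro ballI allI conjI)
  fix x y w a b assume x: "x \<in> T p" and y: "y \<in> T p" and w: "w \<in> T p"
  show *: "met M p w (a *\<^sub>R x + b *\<^sub>R y) = a * met M p w x + b * met M p w y"
    using met_lin[OF w] x y unfolding linear_at_def by simp
  have "a *\<^sub>R x + b *\<^sub>R y \<in> T p" using x y by blast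
  then show "met M p (a *\<^sub>R x + b *\<^sub>R y) w = a * met M p x w + b * met M p y w"
    using * met_sym x y w by metis
qed

lemma ac_space_at: "ac_space (T p) (met M p) (phi M p) (eta M p) (zeta M p) n"
proof
  show "subspace (T p)" by (rule subspace_T)
  show "1 \<le> n" by (rule acm_n)
  show "\<exists>B. finite B \<and> card B = Suc (2*n) \<and> independent B \<and> span B = T p"
    using dim_T(2)[of p] acm_dim by simp
  show "bil (T p) (met M p)" by (rule bil_met)
  show "zeta M p \<in> T p" using acm_zeta unfolding smooth_vfield_def by simp
  show "eta M p (zeta M p) = 1" by (rule acm_eta_zeta)
qed (use met_sym met_pos acm_phi_V acm_phi_lin acm_eta_lin acm_phi_phi acm_met_phi in \<open>auto simp: linear_at_def\<close>)

end

sublocale acm_lc \<subseteq> P: ac_space "tangent_space M p" "met M p" "phi M p" "eta M p" "zeta M p" n for p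
  by (rule ac_space_at)

context acm_lc begin

section \<open>Smoothness of the structure tensors and rules for the Levi-Civita connection\<close>

lemma sv_zeta [intro]: "sv p (zeta M)"
  unfolding smooth_vfield_near_def using acm_zeta by blast

lemma sv_phi [intro]: "sv p X \<Longrightarrow> sv p (\<lambda>q. phi M q (X q))"
  unfolding smooth_vfield_near_def using acm_phi_smooth by blast

lemma sf_eta [intro]: "sv p X \<Longrightarrow> sf p (\<lambda>q. eta M q (X q))"
  unfolding smooth_vfield_near_def smooth_fun_near_def using acm_eta_smooth by blast

lemma sf_met [intro]: 
  assumes "sv p X" "sv p Y" shows "sf p (\<lambda>q. met M q (X q) (Y q))"
proof -
  obtain W where "open W" "p \<in> W" "smooth_vfield M W X" "smooth_vfield M W Y" using sv_pair[OF assms] .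
  then show ?thesis unfolding smooth_fun_near_def using met_smooth by blast
qed

lemmas lc_1 = lc[unfolded levi_civita_def]
lemmas lc_2 = conjunct2[OF lc_1]
lemmas lc_3 = conjunct2[OF lc_2]
lemmas lc_4 = conjunct2[OF lc_3]
lemmas lc_5 = conjunct2[OF lc_4]
lemmas lc_6 = conjunct2[OF lc_5]
lemmas lc_7 = conjunct2[OF lc_6]
lemmas lc_8 = conjunct2[OF lc_7]

lemma lc_D:
  shows nab_T [intro, simp]: "v \<in> T p \<Longrightarrow> sv p Y \<Longrightarrow> nabla M p v Y \<in> T p"
    and nab_lin: "sv p Y \<Longrightarrow> linear_at M p (\<lambda>v. nabla M p v Y)"
    and nab_smooth: "smooth_vfield M W X \<Longrightarrow> smooth_vfield M W Y \<Longrightarrow> smooth_vfield M W (\<lambda>q. nabla M q (X q) Y)"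
    and nab_loc: "v \<in> T p \<Longrightarrow> p \<in> W \<Longrightarrow> smooth_vfield M W Y \<Longrightarrow> (\<forall>q\<in>W. Y q = Z q) \<Longrightarrow> nabla M p v Y = nabla M p v Z"
    and nab_add: "v \<in> T p \<Longrightarrow> sv p Y \<Longrightarrow> sv p Z \<Longrightarrow> nabla M p v (\<lambda>q. Y q + Z q) = nabla M p v Y + nabla M p v Z"
    and nab_scale: "v \<in> T p \<Longrightarrow> sf p f \<Longrightarrow> sv p Y \<Longrightarrow>
      nabla M p v (\<lambda>q. f q *\<^sub>R Y q) = v f *\<^sub>R Y p + f p *\<^sub>R nabla M p v Y"
    and nab_torsion: "sv p X \<Longrightarrow> sv p Y \<Longrightarrow> sf p f \<Longrightarrow>
      nabla M p (X p) Y f - nabla M p (Y p) X f = X p (\<lambda>q. Y q f) - Y p (\<lambda>q. X q f)"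
    and nab_met: "v \<in> T p \<Longrightarrow> sv p Y \<Longrightarrow> sv p Z \<Longrightarrow>
      v (\<lambda>q. met M q (Y q) (Z q)) = met M p (nabla M p v Y) (Z p) + met M p (Y p) (nabla M p v Z)"
  subgoal using conjunct1[OF lc_1] by blast
  subgoal using conjunct1[OF lc_2] by blast
  subgoal using conjunct1[OF lc_3] by blast
  subgoal using conjunct1[OF lc_4] by blast
  subgoal using conjunct1[OF lc_5] by blast
  subgoal using conjunct1[OF lc_6] by blast
  subgoal using conjunct1[OF lc_7] by blast
  subgoal using lc_8 by blast
  done

lemma nab_sv [intro]: 
  assumes "sv p X" "sv p Y" shows "sv p (\<lambda>q. nabla M q (X q) Y)"
proof -
  obtain W where "open W" "p \<in> W" "smooth_vfield M W X" "smooth_vfield M W Y" using sv_pair[OF assms] .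
  then show ?thesis unfolding smooth_vfield_near_def using nab_smooth by blast
qed

lemma nab_cong: 
  assumes "v \<in> T p" "sv p Y" "\<forall>\<^sub>F q in nhds p. Y q = Z q"
  shows "nabla M p v Y = nabla M p v Z"
proof -
  obtain W where "open W" "p \<in> W" "smooth_vfield M W Y" "\<And>q. q \<in> W \<Longrightarrow> Y q = Z q"
    by (rule sv_obtain[OF assms(2,3)]) (rule that)
  then show ?thesis by (intro nab_loc[OF assms(1)]) auto
qed

lemma nab_simps_v:
  assumes "sv p Y" "v \<in> T p" "w \<in> T p"
  shows "nabla M p (v + w) Y = nabla M p v Y + nabla M p w Y" "nabla M p (a *\<^sub>R v) Y = a *\<^sub>R nabla M p v Y"
    "nabla M p (v - w) Y = nabla M p v Y - nabla M p w Y"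
proof -
  have *: "nabla M p (a *\<^sub>R v + b *\<^sub>R w) Y = a *\<^sub>R nabla M p v Y + b *\<^sub>R nabla M p w Y" for a b
    using nab_lin[OF assms(1)] assms(2,3) unfolding linear_at_def by blast
  show "nabla M p (v + w) Y = nabla M p v Y + nabla M p w Y" "nabla M p (a *\<^sub>R v) Y = a *\<^sub>R nabla M p v Y"
    "nabla M p (v - w) Y = nabla M p v Y - nabla M p w Y"
    using *[of 1 1] *[of a 0] *[of 1 "-1"] by simp_all
qed

lemma nab_uminus: "v \<in> T p \<Longrightarrow> sv p Y \<Longrightarrow> nabla M p v (\<lambda>q. - Y q) = - nabla M p v Y"
  using nab_scale[OF _ sf_const[of p "-1"], of v Y] tangent_const[of v p "-1"] by simp

lemma sv_T_near: "sv p X \<Longrightarrow> \<forall>\<^sub>F q in nhds p. X q \<in> T q"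
  using sv_eventually by (rule eventually_mono) auto

text \<open>Algebraic identities hold on tangent vectors only. A field smooth near \<open>p\<close>
  is tangent near \<open>p\<close>, so such identities may still be differentiated there.\<close>

lemma tangent_cong_1:
  assumes "v \<in> T p" "sv p X" "\<And>q. X q \<in> T q \<Longrightarrow> f q = h q"
  shows "v f = v h"
  by (rule tangent_cong[OF assms(1)]) (rule eventually_mono[OF sv_T_near[OF assms(2)] assms(3)])

lemma tangent_cong_2:
  assumes "v \<in> T p" "sv p X" "sv p Y" "\<And>q. X q \<in> T q \<Longrightarrow> Y q \<in> T q \<Longrightarrow> f q = h q"
  shows "v f = v h"
  by (rule tangent_cong[OF assms(1)], rule eventually_mono[OF eventually_conj[OF sv_T_near[OF assms(2)] sv_T_near[OF assms(3)]]])
    (use assms(4) in blast)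

definition nabla_zeta :: "'a \<Rightarrow> 'a tvec \<Rightarrow> 'a tvec" where "nabla_zeta p v = nabla M p v (zeta M)"
text \<open>This is (\<nabla>_v \<eta>)(x), written through \<nabla>\<zeta>: no extension of
  \<open>x\<close> occurs, so bilinearity and smoothness are immediate.\<close>

definition nabla_eta :: "'a form2" where "nabla_eta p v x = met M p (nabla_zeta p v) x"

lemma nabla_zeta_T [intro, simp]: "v \<in> T p \<Longrightarrow> nabla_zeta p v \<in> T p"
  unfolding nabla_zeta_def by (rule nab_T) auto

lemma nabla_zeta_lin: "v \<in> T p \<Longrightarrow> w \<in> T p \<Longrightarrow> nabla_zeta p (v + w) = nabla_zeta p v + nabla_zeta p w" "v \<in> T p \<Longrightarrow> nabla_zeta p (a *\<^sub>R v) = a *\<^sub>R nabla_zeta p v"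
  "v \<in> T p \<Longrightarrow> w \<in> T p \<Longrightarrow> nabla_zeta p (v - w) = nabla_zeta p v - nabla_zeta p w"
  unfolding nabla_zeta_def by (auto intro: nab_simps_v)

lemma bil_nabla_eta: "bil (T p) (nabla_eta p)"
  unfolding bil_def nabla_eta_def by (simp add: nabla_zeta_lin)

lemma eta_nabla_zeta [simp]: 
  assumes "v \<in> T p" shows "eta M p (nabla_zeta p v) = 0"
proof -
  have "met M q (zeta M q) (zeta M q) = 1" for q by simp
  then have "v (\<lambda>q. met M q (zeta M q) (zeta M q)) = 0" using tangent_const[OF assms, of 1] by simp
  then show ?thesis
    using nab_met[OF assms sv_zeta sv_zeta] assms nabla_zeta_T[OF assms] by (simp add: nabla_zeta_def[symmetric])
qed

lemma nabla_eta_zeta [simp]: "v \<in> T p \<Longrightarrow> nabla_eta p v (zeta M p) = 0"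
  unfolding nabla_eta_def by simp

lemma deriv_eta:
  assumes "v \<in> T p" "sv p X"
  shows "v (\<lambda>q. eta M q (X q)) = nabla_eta p v (X p) + eta M p (nabla M p v X)"
proof -
  have "v (\<lambda>q. eta M q (X q)) = v (\<lambda>q. met M q (zeta M q) (X q))"
    by (rule tangent_cong_1[OF assms(1) assms(2)]) (simp)
  then show ?thesis using nab_met[OF assms(1) sv_zeta assms(2)] assms by (simp add: nabla_eta_def nabla_zeta_def)
qed

lemma nabla_form1_eta:
  assumes "v \<in> T p" "x \<in> T p" shows "nabla_form1 M (eta M) p v x = nabla_eta p v x"
  unfolding nabla_form1_def Let_def
  using deriv_eta[OF assms(1) sv_local_ext[OF assms(2)]] local_ext_at[OF assms(2)] by simp

text \<open>Differentiating \<open>\<langle>\<phi>X, W\<rangle> = - \<langle>X, \<phi>W\<rangle>\<close> shows that \<open>\<nabla>\<^sub>v\<phi>\<close> is skew; this also makes it tensorial.\<close>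

lemma nabla_phi_field_skew:
  assumes v: "v \<in> T p" and X: "sv p X" and W: "sv p W"
  shows "met M p (nabla M p v (\<lambda>q. phi M q (X q)) - phi M p (nabla M p v X)) (W p) =
    - met M p (X p) (nabla M p v (\<lambda>q. phi M q (W q)) - phi M p (nabla M p v W))"
proof -
  have XW: "X p \<in> T p" "W p \<in> T p" using X W by auto
  have "v (\<lambda>q. met M q (phi M q (X q)) (W q)) = v (\<lambda>q. - met M q (X q) (phi M q (W q)))"
    by (rule tangent_cong_2[OF v X W]) (simp add: P.g_phi)
  also have "\<dots> = - v (\<lambda>q. met M q (X q) (phi M q (W q)))"
    by (rule tangent_uminus[OF v sf_met[OF X sv_phi[OF W]]])
  finally have "met M p (nabla M p v (\<lambda>q. phi M q (X q))) (W p) + met M p (phi M p (X p)) (nabla M p v W)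
    = - (met M p (nabla M p v X) (phi M p (W p)) + met M p (X p) (nabla M p v (\<lambda>q. phi M q (W q))))"
    unfolding nab_met[OF v sv_phi[OF X] W] nab_met[OF v X sv_phi[OF W]] .
  then show ?thesis using v X W XW nab_T[OF v X] nab_T[OF v W] nab_T[OF v sv_phi[OF X]] nab_T[OF v sv_phi[OF W]]
    by (simp add: P.g_phi)
qed

abbreviation "nabla_phi p \<equiv> nabla_endo M (phi M) p"

text \<open>By skewness, the pairing of the right-hand side with any \<open>W p\<close> depends on
  the field \<open>X\<close> through \<open>X p\<close> alone, so the chosen extension can be
  replaced by \<open>X\<close>.\<close>

lemma nabla_phi_eq:
  assumes v: "v \<in> T p" and X: "sv p X"
  shows "nabla_phi p v (X p) = nabla M p v (\<lambda>q. phi M q (X q)) - phi M p (nabla M p v X)"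
proof -
  have x: "X p \<in> T p" using X by auto
  let ?Y = "local_ext M p (X p)"
  have Y: "sv p ?Y" "?Y p = X p" using sv_local_ext[OF x] local_ext_at[OF x] by auto
  show ?thesis unfolding nabla_endo_def Let_def
  proof (rule P.g_eqI)
    fix w assume w: "w \<in> T p"
    obtain W where W: "sv p W" "W p = w" using sv_ext[OF w] by blast
    show "met M p (nabla M p v (\<lambda>q. phi M q (?Y q)) - phi M p (nabla M p v ?Y)) w =
      met M p (nabla M p v (\<lambda>q. phi M q (X q)) - phi M p (nabla M p v X)) w"
      using nabla_phi_field_skew[OF v Y(1) W(1)] nabla_phi_field_skew[OF v X W(1)] Y(2) W(2) by simp
  qed (use v X Y in \<open>auto intro!: T_diff\<close>)
qed

lemma nabla_phi_T [intro, simp]: "v \<in> T p \<Longrightarrow> x \<in> T p \<Longrightarrow> nabla_phi p v x \<in> T p"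
  using nabla_phi_eq[of v p "local_ext M p x"] sv_local_ext[of x p] local_ext_at[of x p]
  by (auto intro!: T_diff)

lemma nabla_phi_skew: "v \<in> T p \<Longrightarrow> x \<in> T p \<Longrightarrow> y \<in> T p \<Longrightarrow> met M p (nabla_phi p v x) y = - met M p x (nabla_phi p v y)"
  using nabla_phi_field_skew[of v p "local_ext M p x" "local_ext M p y"] nabla_phi_eq[of v p "local_ext M p x"] nabla_phi_eq[of v p "local_ext M p y"]
    sv_local_ext[of x p] local_ext_at[of x p] sv_local_ext[of y p] local_ext_at[of y p] by simp

text \<open>Skewness moves the derivative of \<phi> to the other argument, leaving linearity of the
  metric.\<close>

lemma nabla_phi_lin:
  assumes v: "v \<in> T p" and x: "x \<in> T p" and y: "y \<in> T p"
  shows "nabla_phi p v (a *\<^sub>R x + b *\<^sub>R y) = a *\<^sub>R nabla_phi p v x + b *\<^sub>R nabla_phi p v y"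
proof (rule P.g_eqI)
  fix w assume w: "w \<in> T p"
  have xy: "a *\<^sub>R x + b *\<^sub>R y \<in> T p" using x y by blast
  have nabla_phi: "nabla_phi p v w \<in> T p" "nabla_phi p v x \<in> T p" "nabla_phi p v y \<in> T p" using v w x y by auto
  show "met M p (nabla_phi p v (a *\<^sub>R x + b *\<^sub>R y)) w = met M p (a *\<^sub>R nabla_phi p v x + b *\<^sub>R nabla_phi p v y) w"
    using v x y w xy nabla_phi by (simp add: nabla_phi_skew)
qed (use assms in auto)

text \<open>Obtained by differentiating \<open>\<phi>\<^sup>2 = -I + \<eta> \<otimes> \<zeta>\<close>.\<close>

lemma nabla_phi_phi:
  assumes v: "v \<in> T p" and x: "x \<in> T p"
  shows "nabla_phi p v (phi M p x) + phi M p (nabla_phi p v x) = nabla_eta p v x *\<^sub>R zeta M p + eta M p x *\<^sub>R nabla_zeta p v"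
proof -
  obtain X where X: "sv p X" "X p = x" using sv_ext[OF x] by blast
  note n = nab_T[OF v X(1)] nab_T[OF v sv_phi[OF X(1)]]
  have ph: "nabla M p v (\<lambda>q. phi M q (phi M q (X q))) = nabla M p v (\<lambda>q. - X q + eta M q (X q) *\<^sub>R zeta M q)"
    by (rule nab_cong[OF v sv_phi[OF sv_phi[OF X(1)]]]) (rule eventually_mono[OF sv_T_near[OF X(1)]], simp add: P.phi_phi)
  also have "\<dots> = - nabla M p v X + (v (\<lambda>q. eta M q (X q)) *\<^sub>R zeta M p + eta M p x *\<^sub>R nabla_zeta p v)"
    using nab_add[OF v sv_uminus[OF X(1)] sv_scale[OF sf_eta[OF X(1)] sv_zeta]] nab_uminus[OF v X(1)]
      nab_scale[OF v sf_eta[OF X(1)] sv_zeta] X(2) by (simp add: nabla_zeta_def)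
  finally have 1: "nabla M p v (\<lambda>q. phi M q (phi M q (X q))) =
     - nabla M p v X + ((nabla_eta p v x + eta M p (nabla M p v X)) *\<^sub>R zeta M p + eta M p x *\<^sub>R nabla_zeta p v)"
    using deriv_eta[OF v X(1)] X(2) by simp
  have 2: "nabla_phi p v (phi M p x) = nabla M p v (\<lambda>q. phi M q (phi M q (X q))) - phi M p (nabla M p v (\<lambda>q. phi M q (X q)))"
    using nabla_phi_eq[OF v sv_phi[OF X(1)]] X(2) by simp
  have 3: "phi M p (nabla_phi p v x) = phi M p (nabla M p v (\<lambda>q. phi M q (X q))) + nabla M p v X - eta M p (nabla M p v X) *\<^sub>R zeta M p"
    using nabla_phi_eq[OF v X(1)] X(2) n by (simp add: P.phi_phi)
  show ?thesis unfolding 2 3 1 by (rule ext) (simp add: scaleR_fun_def field_simps)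
qed

text \<open>Differentiate \<eta>(\<phi> X) = 0.\<close>

lemma eta_nabla_phi:
  assumes v: "v \<in> T p" and x: "x \<in> T p"
  shows "eta M p (nabla_phi p v x) = - nabla_eta p v (phi M p x)"
proof -
  obtain X where X: "sv p X" "X p = x" using sv_ext[OF x] by blast
  have "v (\<lambda>q. eta M q (phi M q (X q))) = v (\<lambda>q. 0)"
    by (rule tangent_cong_1[OF v X(1)]) (simp)
  then have "nabla_eta p v (phi M p x) + eta M p (nabla M p v (\<lambda>q. phi M q (X q))) = 0"
    using deriv_eta[OF v sv_phi[OF X(1)]] tangent_const[OF v, of 0] X by simp
  then show ?thesis using nabla_phi_eq[OF v X(1)] X nab_T[OF v X(1)] nab_T[OF v sv_phi[OF X(1)]] by simp
qed

section \<open>The tensor \<xi> and the tensors parallel for the minimal connection\<close>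

lemma xi_eq:
  assumes "v \<in> T p" "x \<in> T p"
  shows "xi M p v x = (-1/2) *\<^sub>R phi M p (nabla_phi p v x) + nabla_eta p v x *\<^sub>R zeta M p - (eta M p x / 2) *\<^sub>R nabla_zeta p v"
  unfolding xi_def using assms by (simp add: nabla_form1_eta nabla_zeta_def)

lemma xi_T [intro, simp]: "v \<in> T p \<Longrightarrow> x \<in> T p \<Longrightarrow> xi M p v x \<in> T p"
  by (simp add: xi_eq)

lemma xi_lin:
  assumes v: "v \<in> T p" and x: "x \<in> T p" and y: "y \<in> T p"
  shows "xi M p v (a *\<^sub>R x + b *\<^sub>R y) = a *\<^sub>R xi M p v x + b *\<^sub>R xi M p v y"
proof -
  have "a *\<^sub>R x + b *\<^sub>R y \<in> T p" "nabla_phi p v x \<in> T p" "nabla_phi p v y \<in> T p" using assms by auto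
  then show ?thesis using assms
    by (simp add: xi_eq nabla_phi_lin P.bil_lin[OF bil_nabla_eta] algebra_simps add_divide_distrib)
qed

lemma eta_xi: "v \<in> T p \<Longrightarrow> x \<in> T p \<Longrightarrow> eta M p (xi M p v x) = nabla_eta p v x"
  by (simp add: xi_eq)

lemma nabla_phi_zeta: "v \<in> T p \<Longrightarrow> nabla_phi p v (zeta M p) = - phi M p (nabla_zeta p v)"
proof -
  assume v: "v \<in> T p"
  have "nabla M p v (\<lambda>q. phi M q (zeta M q)) = nabla M p v (\<lambda>q. 0 *\<^sub>R zeta M q)" by simp
  also have "\<dots> = 0" using nab_scale[OF v sf_const[of p 0] sv_zeta] tangent_const[OF v, of 0] by simp
  finally show ?thesis using nabla_phi_eq[OF v sv_zeta] by (simp add: nabla_zeta_def)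
qed

text \<open>The derivative of \<phi> at \<zeta> is -\<phi>(\<nabla>\<zeta>), and \<phi> squared is
  -1 on the horizontal vector \<nabla>\<zeta>; this half adds to the half from the last summand of
  \<xi>.\<close>

lemma xi_zeta: "v \<in> T p \<Longrightarrow> xi M p v (zeta M p) = - nabla_zeta p v"
proof -
  assume v: "v \<in> T p"
  have "xi M p v (zeta M p) = (1/2) *\<^sub>R (phi M p (phi M p (nabla_zeta p v))) - (1/2) *\<^sub>R nabla_zeta p v"
    using v by (simp add: xi_eq nabla_phi_zeta)
  also have "\<dots> = - ((1/2) *\<^sub>R nabla_zeta p v + (1/2) *\<^sub>R nabla_zeta p v)" using v by (simp add: P.phi_phi)
  also have "\<dots> = - nabla_zeta p v" by (simp only: scaleR_add_left[symmetric]) simp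
  finally show ?thesis .
qed

text \<open>By \<open>nabla_phi_phi\<close> the endomorphism \<phi> composed with \<nabla>\<phi> is
  skew up to terms in \<eta>, and the other two summands of \<xi> are exactly what compensates
  them.\<close>

lemma xi_skew:
  assumes v: "v \<in> T p" and x: "x \<in> T p" and y: "y \<in> T p"
  shows "met M p (xi M p v x) y = - met M p x (xi M p v y)"
proof -
  have 1: "met M p (nabla_phi p v x) (phi M p y) + met M p (nabla_phi p v y) (phi M p x) = - nabla_eta p v y * eta M p x - eta M p y * nabla_eta p v x"
  proof -
    have "met M p (nabla_phi p v x) (phi M p y) = - met M p x (nabla_phi p v (phi M p y))" using assms by (simp add: nabla_phi_skew)
    also have "nabla_phi p v (phi M p y) = nabla_eta p v y *\<^sub>R zeta M p + eta M p y *\<^sub>R nabla_zeta p v - phi M p (nabla_phi p v y)"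
      using nabla_phi_phi[OF v y] by (simp add: algebra_simps)
    also have "met M p x \<dots> = nabla_eta p v y * eta M p x + eta M p y * nabla_eta p v x - met M p x (phi M p (nabla_phi p v y))"
      using assms met_sym[of x p "nabla_zeta p v"] by (simp add: nabla_eta_def)
    also have "met M p x (phi M p (nabla_phi p v y)) = - met M p (nabla_phi p v y) (phi M p x)"
      using assms P.g_phi[of x p "nabla_phi p v y"] met_sym[of "phi M p x" p "nabla_phi p v y"] by simp
    finally show ?thesis by simp
  qed
  have "met M p x (xi M p v y) = met M p (xi M p v y) x" using assms met_sym by simp
  moreover have "met M p (xi M p v x) y = 1/2 * met M p (nabla_phi p v x) (phi M p y) + nabla_eta p v x * eta M p y - eta M p x / 2 * nabla_eta p v y"
    "met M p (xi M p v y) x = 1/2 * met M p (nabla_phi p v y) (phi M p x) + nabla_eta p v y * eta M p x - eta M p y / 2 * nabla_eta p v x"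
    using assms by (simp_all add: xi_eq P.g_phi nabla_eta_def)
  ultimately show ?thesis using 1 by (simp add: field_simps)
qed

text \<open>The commutator of \<xi>_v with \<phi> cancels \<nabla>_v \<phi>; this is the reason for
  the factor -1/2 in \<xi> and makes \<phi> parallel in \<open>nU_phi\<close>.\<close>

lemma xi_phi:
  assumes v: "v \<in> T p" and x: "x \<in> T p"
  shows "xi M p v (phi M p x) = phi M p (xi M p v x) - nabla_phi p v x"
proof -
  have e: "nabla_phi p v x \<in> T p" "nabla_zeta p v \<in> T p" using assms by auto
  have nabla_phi: "nabla_phi p v (phi M p x) = nabla_eta p v x *\<^sub>R zeta M p + eta M p x *\<^sub>R nabla_zeta p v - phi M p (nabla_phi p v x)"
      using nabla_phi_phi[OF v x] by (simp add: algebra_simps)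
  have 1: "phi M p (phi M p (nabla_phi p v x)) = - nabla_phi p v x - nabla_eta p v (phi M p x) *\<^sub>R zeta M p"
    using assms e by (simp add: P.phi_phi eta_nabla_phi)
  have 2: "xi M p v (phi M p x) = (-1/2) *\<^sub>R (eta M p x *\<^sub>R phi M p (nabla_zeta p v) - phi M p (phi M p (nabla_phi p v x))) + nabla_eta p v (phi M p x) *\<^sub>R zeta M p"
    using assms e by (simp add: xi_eq nabla_phi)
  have 3: "phi M p (xi M p v x) = (-1/2) *\<^sub>R phi M p (phi M p (nabla_phi p v x)) - (eta M p x / 2) *\<^sub>R phi M p (nabla_zeta p v)"
    using assms e by (simp add: xi_eq)
  show ?thesis unfolding 2 3 1 by (rule ext) (simp add: scaleR_fun_def field_simps)
qed

lemma nU_T [intro, simp]: "v \<in> T p \<Longrightarrow> sv p X \<Longrightarrow> nablaU M p v X \<in> T p"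
  unfolding nablaU_def by (auto intro!: T_add)

lemma nU_met:
  assumes v: "v \<in> T p" and X: "sv p X" and Y: "sv p Y"
  shows "v (\<lambda>q. met M q (X q) (Y q)) = met M p (nablaU M p v X) (Y p) + met M p (X p) (nablaU M p v Y)"
proof -
  have "X p \<in> T p" "Y p \<in> T p" "nabla M p v X \<in> T p" "nabla M p v Y \<in> T p" using assms by auto
  then show ?thesis unfolding nablaU_def nab_met[OF assms] using v by (simp add: xi_skew)
qed

lemma nU_phi:
  assumes v: "v \<in> T p" and X: "sv p X"
  shows "nablaU M p v (\<lambda>q. phi M q (X q)) = phi M p (nablaU M p v X)"
proof -
  have "X p \<in> T p" "nabla M p v X \<in> T p" using assms by auto
  then show ?thesis unfolding nablaU_def using nabla_phi_eq[OF assms] v by (simp add: xi_phi algebra_simps)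
qed

lemma nU_eta:
  assumes v: "v \<in> T p" and X: "sv p X"
  shows "v (\<lambda>q. eta M q (X q)) = eta M p (nablaU M p v X)"
proof -
  have "X p \<in> T p" "nabla M p v X \<in> T p" using assms by auto
  then show ?thesis unfolding nablaU_def deriv_eta[OF assms] using v by (simp add: eta_xi)
qed

lemma nU_zeta: "v \<in> T p \<Longrightarrow> nablaU M p v (zeta M) = 0"
  unfolding nablaU_def using xi_zeta by (simp add: nabla_zeta_def)

subsection \<open>Smooth frames and forms\<close>

text \<open>Gram-Schmidt for vector fields, started at \<zeta>. The new direction is chosen at
  \<open>p\<close> only; the squared length of its residual is continuous and positive at
  \<open>p\<close>, hence positive nearby.\<close>

lemma smooth_frame_step:
  assumes "k < Suc (2*n)"
  shows "\<exists>X. X 0 = zeta M \<and> (\<forall>i<Suc k. sv p (X i)) \<and>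
    (\<forall>\<^sub>F q in nhds p. \<forall>i<Suc k. \<forall>j<Suc k. met M q (X i q) (X j q) = (if i = j then 1 else 0))"
  using assms
proof (induction k)
  case 0
  show ?case by (rule exI[of _ "\<lambda>_. zeta M"]) auto
next
  case (Suc k)
  then obtain X where X0: "X 0 = zeta M" and Xs: "\<And>i. i < Suc k \<Longrightarrow> sv p (X i)"
    and Xo: "\<forall>\<^sub>F q in nhds p. \<forall>i<Suc k. \<forall>j<Suc k. met M q (X i q) (X j q) = (if i = j then 1 else 0)"
    by auto
  have Xp: "met M p (X i p) (X j p) = (if i = j then 1 else 0)" if "i < Suc k" "j < Suc k" for i j
    using eventually_nhds_x_imp_x[OF Xo] that by blast
  obtain v where v: "v \<in> T p" "v - (\<Sum>i<Suc k. met M p v (X i p) *\<^sub>R X i p) \<noteq> 0"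
    using P.orthonormal_extend[of "Suc k" "\<lambda>i. X i p" p] Xs Xp Suc.prems by blast
  obtain Z where Z: "sv p Z" "Z p = v" using sv_ext[OF v(1)] by blast
  define Y where "Y q = Z q - (\<Sum>i<Suc k. met M q (Z q) (X i q) *\<^sub>R X i q)" for q
  have Y: "sv p Y" unfolding Y_def by (intro sv_diff sv_sum sv_scale sf_met Z Xs) auto
  define N where "N q = met M q (Y q) (Y q)" for q
  have N: "sf p N" unfolding N_def by (intro sf_met Y)
  have Np: "N p > 0" unfolding N_def using met_pos[of "Y p" p] v Z sv_tangent[OF Y] by (simp add: Y_def del: sum.lessThan_Suc)
  define X' where "X' i = (if i = Suc k then (\<lambda>q. (1 / sqrt (N q)) *\<^sub>R Y q) else X i)" for i
  have Npos: "\<forall>\<^sub>F q in nhds p. N q > 0"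
    using order_tendstoD(1)[OF sf_isCont[OF N, unfolded continuous_within tendsto_at_iff_tendsto_nhds] Np] .
  have XT: "\<forall>\<^sub>F q in nhds p. \<forall>i\<in>{..<Suc k}. X i q \<in> T q"
    by (rule eventually_ball_finite) (use Xs sv_T_near in auto)
  show ?case
  proof (intro exI[of _ X'] conjI allI impI)
    show "X' 0 = zeta M" using X0 by (simp add: X'_def)
    show "sv p (X' i)" if "i < Suc (Suc k)" for i
      using that Xs[of i] sv_scale[OF sf_inverse_sqrt[OF N Np] Y] by (auto simp: X'_def)
    show "\<forall>\<^sub>F q in nhds p. \<forall>i<Suc (Suc k). \<forall>j<Suc (Suc k). met M q (X' i q) (X' j q) = (if i = j then 1 else 0)"
      using Xo Npos XT sv_T_near[OF Z(1)] sv_T_near[OF Y]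
    proof eventually_elim
      case (elim q)
      have XqT: "X i q \<in> T q" if "i < Suc k" for i using elim(3) that by auto
      have Xq: "met M q (X i q) (X j q) = (if i = j then 1 else 0)" if "i < Suc k" "j < Suc k" for i j
        using elim(1) that by blast
      have r: "met M q (Y q) (X j q) = 0" if "j < Suc k" for j
        unfolding Y_def by (rule P.orthonormal_residual[OF XqT Xq elim(4) that])
      have r': "met M q (X j q) (Y q) = 0" if "j < Suc k" for j
        using r[OF that] met_sym[OF XqT[OF that] elim(5)] by simp
      have NN: "met M q (Y q) (Y q) = N q" by (simp add: N_def)
      have "sqrt (N q) * sqrt (N q) = N q" "sqrt (N q) \<noteq> 0" using elim(2) by simp_all
      then have YY: "met M q ((1 / sqrt (N q)) *\<^sub>R Y q) ((1 / sqrt (N q)) *\<^sub>R Y q) = 1"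
        using elim(5,2) NN by (simp add: P.g_lin field_simps)
      show ?case
        using r r' YY elim(5) XqT Xq by (auto simp: X'_def less_Suc_eq_le le_Suc_eq)
    qed
  qed
qed

lemma smooth_frame:
  "\<exists>X. (\<forall>i<Suc (2*n). sv p (X i)) \<and> (\<forall>\<^sub>F q in nhds p. P.adapted q (\<lambda>i. X i q))"
proof -
  obtain X where X0: "X 0 = zeta M" and Xs: "\<And>i. i < Suc (2*n) \<Longrightarrow> sv p (X i)"
    and Xo: "\<forall>\<^sub>F q in nhds p. \<forall>i<Suc (2*n). \<forall>j<Suc (2*n). met M q (X i q) (X j q) = (if i = j then 1 else 0)"
    using smooth_frame_step[of "2*n" p] by auto
  \<comment> \<open>The construction begins with \<zeta>, whereas adapted frames end with
    it.\<close>
  define Y where "Y i = (if i = 2*n then X 0 else X (Suc i))" for i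
  have XT: "\<forall>\<^sub>F q in nhds p. \<forall>i\<in>{..<Suc (2*n)}. X i q \<in> T q"
    by (rule eventually_ball_finite) (use Xs sv_T_near in auto)
  show ?thesis
  proof (intro exI[of _ Y] conjI allI impI)
    show "sv p (Y i)" if "i < Suc (2*n)" for i using that Xs by (auto simp: Y_def)
    show "\<forall>\<^sub>F q in nhds p. P.adapted q (\<lambda>i. Y i q)"
      using Xo XT
    proof eventually_elim
      case (elim q)
      then have XqT: "\<And>i. i < Suc (2*n) \<Longrightarrow> X i q \<in> T q" by auto
      show ?case unfolding P.adapted_def
        using elim(1) XqT X0 by (auto simp: Y_def)
    qed
  qed
qed

lemma ac_frame_at: "ac_frame (T p) (met M p) (phi M p) (eta M p) (zeta M p) n"
proof (intro ac_frame.intro ac_space_at ac_frame_axioms.intro)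
  obtain X where "\<forall>\<^sub>F q in nhds p. P.adapted q (\<lambda>i. X i q)" using smooth_frame by blast
  from eventually_nhds_x_imp_x[OF this] show "\<exists>e. P.adapted p e" by blast
qed

end

sublocale acm_lc \<subseteq> P: ac_frame "tangent_space M p" "met M p" "phi M p" "eta M p" "zeta M p" n for p
  by (rule ac_frame_at)

context acm_lc begin

definition sform :: "'a form2 \<Rightarrow> bool" where
  "sform B \<longleftrightarrow> (\<forall>p. bil (T p) (B p)) \<and> (\<forall>p X Y. sv p X \<longrightarrow> sv p Y \<longrightarrow> sf p (\<lambda>q. B q (X q) (Y q)))"

lemma sformD: 
  assumes "sform B"
  shows sform_bil: "bil (T p) (B p)" and sform_sf: "sv p X \<Longrightarrow> sv p Y \<Longrightarrow> sf p (\<lambda>q. B q (X q) (Y q))"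
  using assms unfolding sform_def by blast+

lemma sform_cong:
  assumes "sform B" "\<And>q x y. x \<in> T q \<Longrightarrow> y \<in> T q \<Longrightarrow> B q x y = B' q x y"
  shows "sform B'"
  unfolding sform_def
proof (intro conjI allI impI)
  have *: "a *\<^sub>R x + b *\<^sub>R y \<in> T q" if "x \<in> T q" "y \<in> T q" for a b x y q using that by auto
  show "bil (T q) (B' q)" for q using sform_bil[OF assms(1)] assms(2) * unfolding bil_def by metis
  fix p X Y assume X: "sv p X" and Y: "sv p Y"
  show "sf p (\<lambda>q. B' q (X q) (Y q))"
    by (rule sf_cong[OF sform_sf[OF assms(1) X Y]], rule eventually_mono[OF eventually_conj[OF sv_T_near[OF X] sv_T_near[OF Y]]])
      (simp add: assms(2))
qed

lemma sform_comb: "sform B \<Longrightarrow> sform C \<Longrightarrow> (\<And>p. sf p a) \<Longrightarrow> (\<And>p. sf p c) \<Longrightarrow> sform (\<lambda>p x y. a p * B p x y + c p * C p x y)"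
  unfolding sform_def by (simp add: P.bil_comb sf_add sf_mult)

lemma sform_lin: "sform B \<Longrightarrow> sform C \<Longrightarrow> sform (\<lambda>p x y. a * B p x y + c * C p x y)"
  by (rule sform_comb) (simp_all add: sf_const)

lemma sform_swap: "sform B \<Longrightarrow> sform (\<lambda>p x y. B p y x)"
  unfolding sform_def by (simp add: P.bil_swap)

lemma sform_phi: "sform B \<Longrightarrow> sform (\<lambda>p x y. B p (phi M p x) (phi M p y))"
  unfolding sform_def by (simp add: P.bil_phi sv_phi)

lemma sform_phi_left: "sform B \<Longrightarrow> sform (\<lambda>p x y. B p (phi M p x) y)"
  unfolding sform_def bil_def by (simp add: P.phi_lin sv_phi)

lemma sform_met: "sform (met M)"
  unfolding sform_def using bil_met by auto

lemma sform_nabla_eta: "sform nabla_eta"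
  unfolding sform_def using bil_nabla_eta by (auto simp: nabla_eta_def[abs_def] nabla_zeta_def intro!: sf_met nab_sv sv_zeta)

lemma sform_fund: "sform (fund_form M)"
  unfolding sform_def bil_def fund_form_def by (auto simp: P.phi_lin)

lemma sform_tensor: "sform (\<lambda>p x y. eta M p x * nabla_eta p (zeta M p) y)"
  unfolding sform_def bil_def 
  by (auto simp: P.bil_lin[OF bil_nabla_eta] algebra_simps intro!: sf_mult sform_sf[OF sform_nabla_eta])

text \<open>The frames \<open>e q\<close> may vary wildly with \<open>q\<close>; frame independence
  of the trace replaces them by a smooth local frame.\<close>

lemma sform_tr:
  assumes B: "sform B" and e: "\<And>q. P.adapted q (e q)"
  shows "sf p (\<lambda>q. P.tr (e q) (B q))"
proof -
  obtain X where X: "\<And>i. i < Suc (2*n) \<Longrightarrow> sv p (X i)" "\<forall>\<^sub>F q in nhds p. P.adapted q (\<lambda>i. X i q)"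
    using smooth_frame[of p] by blast
  have "sf p (\<lambda>q. \<Sum>i<Suc (2*n). B q (X i q) (X i q))"
    by (intro sf_sum sform_sf[OF B] X(1)) auto
  then show ?thesis
  proof (rule sf_cong)
    show "\<forall>\<^sub>F q in nhds p. (\<Sum>i<Suc (2*n). B q (X i q) (X i q)) = P.tr (e q) (B q)"
      using X(2) by (rule eventually_mono)
        (use P.tr_frame[OF e _ sform_bil[OF B]] in \<open>simp add: P.tr_def del: sum.lessThan_Suc\<close>)
  qed
qed

lemma sform_sharp:
  assumes B: "sform B" and Y: "sv p Y"
  shows "sv p (\<lambda>q. P.sharp q (B q) (Y q))"
proof -
  obtain X where X: "\<And>i. i < Suc (2*n) \<Longrightarrow> sv p (X i)" "\<forall>\<^sub>F q in nhds p. P.adapted q (\<lambda>i. X i q)"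
    using smooth_frame[of p] by blast
  have "sv p (\<lambda>q. \<Sum>i<Suc (2*n). B q (Y q) (X i q) *\<^sub>R X i q)"
    by (intro sv_sum sv_scale sform_sf[OF B] Y X(1)) auto
  then show ?thesis
  proof (rule sv_cong)
    show "\<forall>\<^sub>F q in nhds p. (\<Sum>i<Suc (2*n). B q (Y q) (X i q) *\<^sub>R X i q) = P.sharp q (B q) (Y q)"
      using X(2) sv_T_near[OF Y]
      by eventually_elim (use P.sharp_frame[OF _ sform_bil[OF B]] in \<open>simp del: sum.lessThan_Suc\<close>)
  qed
qed

section \<open>Differentiation of forms along \<zeta>\<close>

abbreviation "nU p X \<equiv> nablaU M p (zeta M p) X"

lemma zeta_T [intro, simp]: "zeta M p \<in> T p" by auto

text \<open>The covariant derivative of a form along \<open>\<zeta>\<close>, for the minimal connection.\<close>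

definition D_field :: "'a form2 \<Rightarrow> 'a \<Rightarrow> 'a vfield \<Rightarrow> 'a vfield \<Rightarrow> real" where
  "D_field B p X Y = zeta M p (\<lambda>q. B q (X q) (Y q)) - B p (nU p X) (Y p) - B p (X p) (nU p Y)"

definition D_form :: "'a form2 \<Rightarrow> 'a form2" where
  "D_form B p x y = D_field B p (local_ext M p x) (local_ext M p y)"

text \<open>Since the connection is metric, the derivative of a form is represented by the
  derivative of its endomorphism. The field \<open>Y\<close> enters through \<open>Y p\<close>
  alone.\<close>

lemma D_field_sharp:
  assumes B: "sform B" and X: "sv p X" and Y: "sv p Y"
  shows "D_field B p X Y = met M p (nU p (\<lambda>q. P.sharp q (B q) (X q)) - P.sharp p (B p) (nU p X)) (Y p)"
proof -
  let ?S = "\<lambda>q. P.sharp q (B q) (X q)"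
  note S = sform_sharp[OF B X]
  have "zeta M p (\<lambda>q. B q (X q) (Y q)) = zeta M p (\<lambda>q. met M q (?S q) (Y q))"
    by (rule tangent_cong_2[OF zeta_T X Y])
      (simp add: P.g_sharp[OF sform_bil[OF B]])
  also have "\<dots> = met M p (nU p ?S) (Y p) + met M p (?S p) (nU p Y)"
    by (rule nU_met[OF zeta_T S Y])
  also have "met M p (?S p) (nU p Y) = B p (X p) (nU p Y)"
    by (rule P.g_sharp[OF sform_bil[OF B]]) (use X Y in auto)
  also have "met M p (nU p ?S) (Y p) = met M p (nU p ?S - P.sharp p (B p) (nU p X)) (Y p) + B p (nU p X) (Y p)"
  proof -
    have 1: "nU p X \<in> T p" "Y p \<in> T p" "nU p ?S \<in> T p" using X Y S by auto
    have 2: "P.sharp p (B p) (nU p X) \<in> T p" using P.sharp_V[OF sform_bil[OF B] 1(1)] .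
    show ?thesis using P.g_lin(7)[OF 1(3,2) 2] P.g_sharp[OF sform_bil[OF B] 1(1,2)] by simp
  qed
  finally show ?thesis unfolding D_field_def by simp
qed

lemma D_field_swap: "D_field B p X Y = D_field (\<lambda>p x y. B p y x) p Y X"
  unfolding D_field_def by simp

text \<open>\<open>D_field_sharp\<close> gives tensoriality in the second slot; transposing the form
  gives the first.\<close>

lemma D_field_ext:
  assumes B: "sform B" and "sv p X" "sv p Y" "sv p X'" "sv p Y'" "X p = X' p" "Y p = Y' p"
  shows "D_field B p X Y = D_field B p X' Y'"
proof -
  have *: "D_field C p Z Y = D_field C p Z Y'" if "sform C" "sv p Y" "sv p Y'" "Y p = Y' p" "sv p Z" for C Z Y Y'
    using D_field_sharp[OF that(1,5,2)] D_field_sharp[OF that(1,5,3)] that(4) by simp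
  have "D_field B p X Y = D_field B p X Y'" using * assms by blast
  also have "\<dots> = D_field (\<lambda>p x y. B p y x) p Y' X" by (rule D_field_swap)
  also have "\<dots> = D_field (\<lambda>p x y. B p y x) p Y' X'" using *[OF sform_swap[OF B]] assms by blast
  also have "\<dots> = D_field B p X' Y'" by (rule D_field_swap[symmetric])
  finally show ?thesis .
qed

lemma D_form_field:
  assumes B: "sform B" and X: "sv p X" and Y: "sv p Y"
  shows "D_field B p X Y = D_form B p (X p) (Y p)"
  unfolding D_form_def
  by (rule D_field_ext[OF B X Y]) (simp_all add: sv_local_ext local_ext_at sv_tangent X Y)

lemma D_form_swap: "D_form (\<lambda>p x y. B p y x) p x y = D_form B p y x"
  unfolding D_form_def by (rule D_field_swap[symmetric])

lemma D_form_bil: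
  assumes B: "sform B" shows "bil (T p) (D_form B p)"
proof -
  have r: "D_form C p w (a *\<^sub>R x + b *\<^sub>R y) = a * D_form C p w x + b * D_form C p w y"
    if C: "sform C" and v: "x \<in> T p" "y \<in> T p" "w \<in> T p" for C x y w a b
  proof -
    obtain W where W: "sv p W" "W p = w" using sv_ext[OF v(3)] by blast
    let ?S = "nU p (\<lambda>q. P.sharp q (C q) (W q)) - P.sharp p (C p) (nU p W)"
    have "D_form C p w u = met M p ?S u" if u: "u \<in> T p" for u
    proof -
      obtain U where U: "sv p U" "U p = u" using sv_ext[OF u] by blast
      then show ?thesis using D_form_field[OF C W(1) U(1)] D_field_sharp[OF C W(1) U(1)] W(2) by simp
    qed
    moreover have "?S \<in> T p"
      using P.sharp_V[OF sform_bil[OF C] nU_T[OF zeta_T W(1)]] sform_sharp[OF C W(1)] by (intro T_diff) auto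
    moreover have "a *\<^sub>R x + b *\<^sub>R y \<in> T p" using v by auto
    ultimately show ?thesis using v by simp
  qed
  show ?thesis unfolding bil_def
    by (intro ballI allI conjI; (rule r[OF sform_swap[OF B], unfolded D_form_swap[of B]] | rule r[OF B]); assumption)
qed

lemma D_form_cong:
  assumes BC: "\<And>q x y. x \<in> T q \<Longrightarrow> y \<in> T q \<Longrightarrow> B q x y = C q x y" and x: "x \<in> T p" and y: "y \<in> T p"
  shows "D_form B p x y = D_form C p x y"
proof -
  let ?X = "local_ext M p x" and ?Y = "local_ext M p y"
  note X = local_ext[OF x] and Y = local_ext[OF y]
  have "zeta M p (\<lambda>q. B q (?X q) (?Y q)) = zeta M p (\<lambda>q. C q (?X q) (?Y q))"
    by (rule tangent_cong_2[OF zeta_T X(1) Y(1)])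
      (simp add: BC)
  moreover have "nU p ?X \<in> T p" "nU p ?Y \<in> T p" using X Y by auto
  ultimately show ?thesis unfolding D_form_def D_field_def using X Y x y BC by simp
qed

lemma D_form_comb:
  assumes B: "sform B" and C: "sform C" and a: "\<And>p. sf p a" and c: "\<And>p. sf p c"
    and x: "x \<in> T p" and y: "y \<in> T p"
  shows "D_form (\<lambda>p x y. a p * B p x y + c p * C p x y) p x y =
    zeta M p a * B p x y + a p * D_form B p x y + zeta M p c * C p x y + c p * D_form C p x y"
proof -
  let ?X = "local_ext M p x" and ?Y = "local_ext M p y"
  note X = local_ext[OF x] and Y = local_ext[OF y]
  note b = sform_sf[OF B X(1) Y(1)] and cc = sform_sf[OF C X(1) Y(1)]
  show ?thesis unfolding D_form_def D_field_def
    using X Y tangent_add[OF zeta_T sf_mult[OF a b] sf_mult[OF c cc]] tangent_mult[OF zeta_T a b] tangent_mult[OF zeta_T c cc]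
    by (simp add: algebra_simps)
qed

lemma D_form_lin:
  assumes "sform B" "sform C" "x \<in> T p" "y \<in> T p"
  shows "D_form (\<lambda>p x y. a * B p x y + c * C p x y) p x y = a * D_form B p x y + c * D_form C p x y"
  using D_form_comb[OF assms(1,2) sf_const sf_const assms(3,4), of a c] tangent_const[OF zeta_T, of p] by simp

text \<open>If \<open>X\<close> extends \<open>x\<close> then \<phi>X extends \<phi>x, and \<phi> is
  parallel.\<close>

lemma D_form_phi:
  assumes B: "sform B" and x: "x \<in> T p" and y: "y \<in> T p"
  shows "D_form (\<lambda>p x y. B p (phi M p x) (phi M p y)) p x y = D_form B p (phi M p x) (phi M p y)"
proof -
  let ?X = "local_ext M p x" and ?Y = "local_ext M p y"
  note X = local_ext[OF x] and Y = local_ext[OF y]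
  have "D_form B p (phi M p x) (phi M p y) = D_field B p (\<lambda>q. phi M q (?X q)) (\<lambda>q. phi M q (?Y q))"
    using D_form_field[OF B sv_phi[OF X(1)] sv_phi[OF Y(1)]] X Y by simp
  then show ?thesis unfolding D_form_def D_field_def nU_phi[OF zeta_T X(1)] nU_phi[OF zeta_T Y(1)] by simp
qed

lemma D_form_phi_left:
  assumes B: "sform B" and x: "x \<in> T p" and y: "y \<in> T p"
  shows "D_form (\<lambda>p x y. B p (phi M p x) y) p x y = D_form B p (phi M p x) y"
proof -
  let ?X = "local_ext M p x" and ?Y = "local_ext M p y"
  note X = local_ext[OF x] and Y = local_ext[OF y]
  have "D_form B p (phi M p x) y = D_field B p (\<lambda>q. phi M q (?X q)) ?Y"
    using D_form_field[OF B sv_phi[OF X(1)] Y(1)] X Y by simp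
  then show ?thesis unfolding D_form_def D_field_def nU_phi[OF zeta_T X(1)] by simp
qed

lemma D_form_met: "x \<in> T p \<Longrightarrow> y \<in> T p \<Longrightarrow> D_form (met M) p x y = 0"
  unfolding D_form_def D_field_def using nU_met[OF zeta_T sv_local_ext sv_local_ext] by simp

lemma D_form_fund: 
  assumes "x \<in> T p" "y \<in> T p" shows "D_form (fund_form M) p x y = 0"
proof -
  have "D_form (fund_form M) p x y = D_form (\<lambda>p x y. fund_form M p y x) p y x" by (rule D_form_swap[symmetric])
  also have "\<dots> = D_form (\<lambda>p x y. met M p (phi M p x) y) p y x"
    by (rule D_form_cong) (use assms met_sym in \<open>auto simp: fund_form_def\<close>)
  also have "\<dots> = D_form (met M) p (phi M p y) x" by (rule D_form_phi_left[OF sform_met assms(2,1)])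
  also have "\<dots> = 0" by (rule D_form_met) (use assms in auto)
  finally show ?thesis .
qed

text \<open>Differentiate the constant trace in a smooth orthonormal frame. The matrix of the
  derivative of the frame is skew and meets the symmetrization of \<open>B\<close>, so no correction
  remains.\<close>

lemma tr_D_form:
  assumes B: "sform B" and e: "P.adapted p e" and z: "\<And>q e. P.adapted q e \<Longrightarrow> P.tr e (B q) = c"
  shows "P.tr e (D_form B p) = 0"
proof -
  obtain X where X: "\<And>i. i < Suc (2*n) \<Longrightarrow> sv p (X i)" "\<forall>\<^sub>F q in nhds p. P.adapted q (\<lambda>i. X i q)"
    using smooth_frame[of p] by blast
  have ad: "P.adapted p (\<lambda>i. X i p)" using eventually_nhds_x_imp_x[OF X(2)] .
  let ?\<omega> = "\<lambda>i j. met M p (nU p (X i)) (X j p)"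
  have XT: "X i p \<in> T p" "nU p (X i) \<in> T p" if "i < Suc (2*n)" for i using X(1)[OF that] by auto
  have skew: "?\<omega> j i = - ?\<omega> i j" if ij: "i < Suc (2*n)" "j < Suc (2*n)" for i j
  proof -
    have "zeta M p (\<lambda>q. met M q (X i q) (X j q)) = zeta M p (\<lambda>q. if i = j then 1 else 0)"
      by (rule tangent_cong[OF zeta_T]) (rule eventually_mono[OF X(2)], use P.adaptedD(2) ij in blast)
    then have "?\<omega> i j + met M p (X i p) (nU p (X j)) = 0"
      using nU_met[OF zeta_T X(1)[OF ij(1)] X(1)[OF ij(2)]] tangent_const[OF zeta_T] by simp
    then show ?thesis using met_sym[OF XT(1)[OF ij(1)] XT(2)[OF ij(2)]] by simp
  qed
  have "zeta M p (\<lambda>q. \<Sum>i<Suc (2*n). B q (X i q) (X i q)) = zeta M p (\<lambda>q. c)"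
    by (rule tangent_cong[OF zeta_T]) (rule eventually_mono[OF X(2)], use z in \<open>simp add: P.tr_def del: sum.lessThan_Suc\<close>)
  then have 0: "(\<Sum>i<Suc (2*n). zeta M p (\<lambda>q. B q (X i q) (X i q))) = 0"
    using tangent_sum[OF zeta_T, where I = "{..<Suc (2*n)}" and f = "\<lambda>i q. B q (X i q) (X i q)"] sform_sf[OF B X(1) X(1)] tangent_const[OF zeta_T, of p c]
    by (simp del: sum.lessThan_Suc)
  have "zeta M p (\<lambda>q. B q (X i q) (X i q)) =
      D_form B p (X i p) (X i p) + (\<Sum>j<Suc (2*n). (B p (X i p) (X j p) + B p (X j p) (X i p)) * ?\<omega> i j)" if i: "i < Suc (2*n)" for i
  proof -
    have "zeta M p (\<lambda>q. B q (X i q) (X i q)) = D_form B p (X i p) (X i p) + B p (nU p (X i)) (X i p) + B p (X i p) (nU p (X i))"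
      using D_form_field[OF B X(1)[OF i] X(1)[OF i]] by (simp add: D_field_def)
    then show ?thesis
      using P.expand_bil[OF ad sform_bil[OF B] XT(2)[OF i] XT(1)[OF i]]
      by (simp add: sum.distrib algebra_simps del: sum.lessThan_Suc)
  qed
  then have "(\<Sum>i<Suc (2*n). zeta M p (\<lambda>q. B q (X i q) (X i q))) = 
     P.tr (\<lambda>i. X i p) (D_form B p) + (\<Sum>i<Suc (2*n). \<Sum>j<Suc (2*n). (B p (X i p) (X j p) + B p (X j p) (X i p)) * ?\<omega> i j)"
    by (simp add: sum.distrib P.tr_def del: sum.lessThan_Suc)
  also have "(\<Sum>i<Suc (2*n). \<Sum>j<Suc (2*n). (B p (X i p) (X j p) + B p (X j p) (X i p)) * ?\<omega> i j) = 0"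
    by (rule P.sum_sym_skew) (rule add.commute, rule skew)
  finally have "P.tr (\<lambda>i. X i p) (D_form B p) = 0" using 0 by simp
  then show ?thesis using P.tr_frame[OF ad e D_form_bil[OF B]] by simp
qed

subsection \<open>Components of the intrinsic torsion\<close>

text \<open>The form B on \<open>H\<close>, extended by zero along \<zeta>; the sign is that of the
  derivation action, \<xi>_X \<eta> = -\<nabla>_X \<eta>.\<close>

definition beta :: "'a form2" where "beta p x y = - nabla_eta p (P.hr p x) (P.hr p y)"

lemma nabla_eta_0: "w \<in> T p \<Longrightarrow> nabla_eta p 0 w = 0" "w \<in> T p \<Longrightarrow> nabla_eta p w 0 = 0"
  using P.bil_lin(9,10)[OF bil_nabla_eta zeta_T] by auto

lemma hor_hr: "hor M p x = P.hr p x"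
  unfolding hor_def P.hr_def ..

lemma sv_hr [intro]: "sv p X \<Longrightarrow> sv p (\<lambda>q. P.hr q (X q))"
  unfolding P.hr_def by (intro sv_diff sv_scale sf_eta sv_zeta)

lemma sform_hr: "sform B \<Longrightarrow> sform (\<lambda>p x y. B p (P.hr p x) (P.hr p y))"
  unfolding sform_def bil_def by (simp add: P.hr_lin sv_hr)

lemma sform_beta: "sform beta"
  using sform_lin[OF sform_hr[OF sform_nabla_eta] sform_hr[OF sform_nabla_eta], of "-1" 0] by (simp add: beta_def[abs_def])

lemma hor_form_beta: "P.hor_form p (beta p)"
  unfolding P.hor_form_def using sform_bil[OF sform_beta] P.bil_lin(9,10)[OF bil_nabla_eta] by (simp add: beta_def)

lemma B_form_beta: "x \<in> T p \<Longrightarrow> y \<in> T p \<Longrightarrow> B_form M p x y = beta p x y"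
  unfolding B_form_def act_eta_def hor_hr beta_def by (simp add: eta_xi)

lemma adapted_frame_iff: "adapted_frame M p e \<longleftrightarrow> P.adapted p e"
  unfolding adapted_frame_def P.adapted_def acm_dim by simp

lemma frame_adapted: "P.adapted p (frame M p)"
  unfolding frame_def adapted_frame_iff using P.ex_frame[of p] by (rule someI_ex)

lemma horizontal_H: "horizontal M p = P.H p"
  unfolding horizontal_def P.H_def ..

lemma fund_form_fund: "fund_form M p = P.fund p"
  unfolding fund_form_def P.fund_def by (intro ext) simp

lemma bilinear_hor_bil: "bilinear_hor M p b \<longleftrightarrow> bil (P.H p) b"
  unfolding bilinear_hor_def bil_def horizontal_H ..

lemma B_decomposition_iff: "B_decomposition M p b \<longleftrightarrow> P.decomp p (B_form M p) (frame M p) b"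
  unfolding B_decomposition_def P.decomp_def Let_def bilinear_hor_bil horizontal_H fund_form_fund acm_dim by simp

lemma decomp_beta: "P.decomp p (B_form M p) (frame M p) b \<longleftrightarrow> P.decomp p (beta p) (frame M p) b"
proof -
  have "(\<forall>x\<in>P.H p. \<forall>y\<in>P.H p. B_form M p x y = f x y) \<longleftrightarrow> (\<forall>x\<in>P.H p. \<forall>y\<in>P.H p. beta p x y = f x y)" for f
    using B_form_beta P.H_V by simp
  then show ?thesis unfolding P.decomp_def by simp
qed

definition "a5 p = P.c5 (frame M p) (beta p)"
definition "c6 p = P.c6 p (frame M p) (beta p)"

text \<open>Uniqueness pins down the chosen decomposition, but on horizontal vectors only; elsewhere
  its values are arbitrary.\<close>

lemma B_comp_eq:
  assumes "i \<in> {5..10}" "x \<in> P.H p" "y \<in> P.H p"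
  shows "B_comp M i p x y = P.component p (beta p) (a5 p) (c6 p) i x y"
proof -
  have "\<exists>b. B_decomposition M p b"
    unfolding B_decomposition_iff decomp_beta using P.decomp_exists[OF frame_adapted hor_form_beta] by blast
  then have "P.decomp p (beta p) (frame M p) (SOME b. B_decomposition M p b)"
    unfolding B_decomposition_iff[symmetric] decomp_beta[symmetric] by (rule someI_ex)
  from P.decomp_unique[OF frame_adapted hor_form_beta this assms] show ?thesis
    unfolding B_comp_def a5_def c6_def .
qed

text \<open>Total replacements for \<open>B_comp\<close>, horizontal on the whole tangent space,
  together with the form of C at index 11.\<close>

definition B_ext :: "nat \<Rightarrow> 'a form2" where
  "B_ext i p x y = (if i = 11 then met M p (xi M p (zeta M p) (P.hr p x)) (P.hr p y)
     else P.component p (beta p) (a5 p) (c6 p) i x y)"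

text \<open>On horizontal arguments the summands of \<xi> with \<zeta> or \<eta> drop out; the
  \<nabla>\<phi> summand remains.\<close>

lemma B_ext_11:
  assumes x: "x \<in> T p" and y: "y \<in> T p"
  shows "B_ext 11 p x y = 1/2 * met M p (nabla_phi p (zeta M p) (P.hr p x)) (phi M p y)"
  using assms nabla_phi_T[OF zeta_T P.hr_V[OF x]] by (simp add: B_ext_def xi_eq P.g_phi)

lemma B_ext_components: "ac_components (T p) (met M p) (phi M p) (eta M p) (zeta M p) n (\<lambda>i. B_ext i p)"
proof (intro ac_components.intro ac_frame_at ac_components_axioms.intro)
  fix i :: nat assume i: "i \<in> {5..11}"
  then have i': "i = 11 \<or> i \<in> {5..10} \<and> i \<noteq> 11" by auto
  have hr0: "xi M p (zeta M p) 0 = 0" using xi_lin[of "zeta M p" p 0 0 0 0] by simp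
  have b11: "bil (T p) (B_ext 11 p)"
    unfolding bil_def B_ext_def by (simp add: P.hr_lin xi_lin)
  show "P.hor_form p (B_ext i p)"
    using i'
  proof (elim disjE conjE)
    assume "i = 11"
    moreover have "P.hor_form p (B_ext 11 p)" unfolding P.hor_form_def using b11 hr0 by (simp add: B_ext_def)
    ultimately show ?thesis by simp
  next
    assume "i \<noteq> 11"
    then have "B_ext i p = P.component p (beta p) (a5 p) (c6 p) i" by (simp add: B_ext_def fun_eq_iff)
    then show ?thesis using P.component_hor[OF hor_form_beta] by simp
  qed
  fix x y assume x: "x \<in> T p" and y: "y \<in> T p"
  show "B_ext i p y x = P.sg i * B_ext i p x y"
    using i'
  proof (elim disjE conjE)
    assume "i = 11"
    then show ?thesis
      using xi_skew[OF zeta_T P.hr_V[OF y] P.hr_V[OF x]] met_sym[OF xi_T[OF zeta_T P.hr_V[OF x]] P.hr_V[OF y]]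
      by (simp add: B_ext_def P.sg_def)
  next
    assume "i \<in> {5..10}" "i \<noteq> 11"
    then show ?thesis using P.component_swap[OF \<open>i \<in> {5..10}\<close> x y] by (simp add: B_ext_def)
  qed
  show "B_ext i p (phi M p x) (phi M p y) = P.eps i * B_ext i p x y"
    using i'
  proof (elim disjE conjE)
    assume [simp]: "i = 11"
    have hx: "P.hr p x \<in> T p" "phi M p (nabla_phi p (zeta M p) (P.hr p x)) \<in> T p" "nabla_phi p (zeta M p) (P.hr p x) \<in> T p" using x by auto
    \<comment> \<open>\<nabla>\<phi> anticommutes with \<phi> up to a multiple of \<zeta>, which is
      orthogonal to the image of \<phi>.\<close>
    have "nabla_phi p (zeta M p) (phi M p x) = nabla_eta p (zeta M p) (P.hr p x) *\<^sub>R zeta M p - phi M p (nabla_phi p (zeta M p) (P.hr p x))"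
      using nabla_phi_phi[OF zeta_T hx(1)] x by (simp add: algebra_simps)
    then have "met M p (nabla_phi p (zeta M p) (phi M p x)) (phi M p (phi M p y)) = - met M p (phi M p (nabla_phi p (zeta M p) (P.hr p x))) (phi M p (phi M p y))"
      using x y hx by simp
    also have "\<dots> = - met M p (nabla_phi p (zeta M p) (P.hr p x)) (phi M p y)"
      using x y hx P.g_phi_phi[OF hx(3) P.phi_V[OF y]] by simp
    finally show ?thesis using x y by (simp add: B_ext_11 P.eps_def)
  qed (use P.component_phi[OF hor_form_beta] x y in \<open>simp add: B_ext_def\<close>)
qed

end

sublocale acm_lc \<subseteq> P: ac_components "tangent_space M p" "met M p" "phi M p" "eta M p" "zeta M p" n "\<lambda>i. B_ext i p" for p
  by (rule B_ext_components)

context acm_lc begin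

section \<open>Identification of the components of \<xi> with the algebraic ones\<close>

lemma xi_comp_11: 
  assumes "y \<in> T p" shows "xi_comp M 11 p (zeta M p) y = P.b p 11 y"
proof -
  have "P.b p 11 y = P.hr p (xi M p (zeta M p) (P.hr p y))"
    unfolding P.b_def
  proof (rule P.sharp_unique)
    fix w assume "w \<in> T p"
    then show "met M p (P.hr p (xi M p (zeta M p) (P.hr p y))) w = B_ext 11 p y w"
      using assms by (simp add: B_ext_def P.hr_def)
  qed (use assms in auto)
  then show ?thesis unfolding xi_comp_def hor_hr by (simp add: Let_def)
qed

lemma xi_comp_eq:
  assumes i: "i \<in> {5..10}" and x: "x \<in> T p" and y: "y \<in> T p"
  shows "xi_comp M i p x y = eta M p y *\<^sub>R P.b p i x - B_ext i p x y *\<^sub>R zeta M p"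
proof -
  let ?r = "eta M p y *\<^sub>R P.b p i x - B_ext i p x y *\<^sub>R zeta M p"
  have i': "i \<in> {5..11}" "i \<noteq> 11" "i \<noteq> 12" using i by auto
  have r: "?r \<in> T p" using i' x y by auto
  have H: "P.hr p u \<in> P.H p" if "u \<in> T p" for u using that by (simp add: P.H_iff)
  have B: "B_comp M i p (P.hr p u) (P.hr p w) = B_ext i p u w" if "u \<in> T p" "w \<in> T p" for u w
    using B_comp_eq[OF i H[OF that(1)] H[OF that(2)]] that i' P.hor_form_hr[OF P.B_hor[OF i'(1)], of "u"] 
    by (simp add: B_ext_def)
  have g: "met M p ?r w = eta M p y * B_comp M i p (P.hr p x) (P.hr p w) - eta M p w * B_comp M i p (P.hr p x) (P.hr p y)"
    if w: "w \<in> T p" for w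
    using x y w i' by (simp add: B P.g_b)
  show ?thesis
    unfolding xi_comp_def hor_hr Let_def using i'
    by simp (rule the_equality, use r g in \<open>auto intro!: P.g_eqI\<close>)
qed

lemma act_eta_xi_comp: 
  assumes "i \<in> {5..10}" "x \<in> T p" "y \<in> T p"
  shows "act_eta M p (xi_comp M i p x) y = B_ext i p x y"
  using assms P.b_V[of i x p] P.eta_b[of i x p] by (simp add: act_eta_def xi_comp_eq)

lemma xi_comp_zeta: 
  assumes "i \<in> {5..10}" "x \<in> T p"
  shows "xi_comp M i p x (zeta M p) = P.b p i x"
  using assms P.hor_formD(3)[OF P.B_hor[of i p], of x] by (simp add: xi_comp_eq)

abbreviation "\<theta> \<equiv> xi_zeta_eta M"
abbreviation "xi_zz p \<equiv> xi M p (zeta M p) (zeta M p)"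

lemma theta_nabla_eta: "y \<in> T p \<Longrightarrow> \<theta> p y = - nabla_eta p (zeta M p) y"
  unfolding xi_zeta_eta_def act_eta_def by (simp add: eta_xi)

lemma theta_xi_zz: "y \<in> T p \<Longrightarrow> \<theta> p y = met M p (xi_zz p) y"
  by (simp add: theta_nabla_eta nabla_eta_def xi_zeta)

lemma eta_xi_zz: "eta M p (xi_zz p) = 0"
  by (simp add: eta_xi)

lemma xi_comp_12: 
  "x \<in> T p \<Longrightarrow> y \<in> T p \<Longrightarrow> xi_comp M 12 p x y = eta M p x *\<^sub>R (eta M p y *\<^sub>R xi_zz p - \<theta> p y *\<^sub>R zeta M p)"
  unfolding xi_comp_def by (simp add: theta_xi_zz Let_def)

lemma act_eta_xi_comp_12: "y \<in> T p \<Longrightarrow> act_eta M p (xi_comp M 12 p (zeta M p)) y = \<theta> p y"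
  by (simp add: act_eta_def xi_comp_12 eta_xi_zz)

lemma xi_comp_12_zeta: "xi_comp M 12 p (zeta M p) (zeta M p) = xi_zz p"
  by (simp add: xi_comp_12 theta_nabla_eta)

lemma codiff1_eta: "codiff1 M (eta M) p = P.tr (frame M p) (beta p)"
proof -
  note e = frame_adapted[of p]
  note eD = P.adaptedD[OF e]
  have "codiff1 M (eta M) p = (\<Sum>i<Suc (2*n). - nabla_eta p (frame M p i) (frame M p i))"
    unfolding codiff1_def acm_dim sum_negf[symmetric]
    by (intro sum.cong refl) (use eD(1) nabla_form1_eta in simp)
  also have "\<dots> = P.tr (frame M p) (beta p)"
    unfolding P.tr_def
  proof (intro sum.cong refl)
    fix i assume i: "i \<in> {..<Suc (2*n)}"
    show "- nabla_eta p (frame M p i) (frame M p i) = beta p (frame M p i) (frame M p i)"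
    \<comment> \<open>The last frame vector is \<zeta>, where both sides vanish; all others are
      horizontal.\<close>
    proof (cases "i = 2*n")
      case True
      then show ?thesis using eD(3) by (simp add: beta_def nabla_eta_0)
    next
      case False
      then have "P.hr p (frame M p i) = frame M p i" using eD(4) i by (intro P.hr_hor) simp
      then show ?thesis by (simp add: beta_def)
    qed
  qed
  finally show ?thesis .
qed

text \<open>Differentiate F(X,Z) = -<\<phi>X,Z>. The chosen extension of \<zeta> need not be
  \<zeta>, but the terms with its derivative cancel, and \<eta>(\<phi>X) = 0 yields the
  rest.\<close>

lemma nabla_form2_fund:
  assumes v: "v \<in> T p" and x: "x \<in> T p"
  shows "nabla_form2 M (fund_form M) p v x (zeta M p) = nabla_eta p v (phi M p x)"
proof -
  let ?X = "local_ext M p x" and ?Z = "local_ext M p (zeta M p)"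
  note X = local_ext[OF x] and Z = local_ext[OF zeta_T[of p]]
  have "v (\<lambda>q. fund_form M q (?X q) (?Z q)) = v (\<lambda>q. - met M q (phi M q (?X q)) (?Z q))"
    by (rule tangent_cong_2[OF v X(1) Z(1)])
      (simp add: fund_form_def P.g_phi)
  also have "\<dots> = - v (\<lambda>q. met M q (phi M q (?X q)) (?Z q))"
    by (rule tangent_uminus[OF v sf_met[OF sv_phi[OF X(1)] Z(1)]])
  also have "\<dots> = - (eta M p (nabla M p v (\<lambda>q. phi M q (?X q))) + met M p (phi M p x) (nabla M p v ?Z))"
    unfolding nab_met[OF v sv_phi[OF X(1)] Z(1)] using X Z nab_T[OF v sv_phi[OF X(1)]] by simp
  also have "eta M p (nabla M p v (\<lambda>q. phi M q (?X q))) = - nabla_eta p v (phi M p x)"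
  proof -
    have "v (\<lambda>q. eta M q (phi M q (?X q))) = v (\<lambda>q. 0)"
      by (rule tangent_cong_1[OF v X(1)]) (simp)
    then show ?thesis using deriv_eta[OF v sv_phi[OF X(1)]] tangent_const[OF v, of 0] X by simp
  qed
  finally have 1: "v (\<lambda>q. fund_form M q (?X q) (?Z q)) = nabla_eta p v (phi M p x) - met M p (phi M p x) (nabla M p v ?Z)" by simp
  have "fund_form M p x (nabla M p v ?Z) = - met M p (phi M p x) (nabla M p v ?Z)"
    using x nab_T[OF v Z(1)] by (simp add: fund_form_def P.g_phi)
  moreover have "fund_form M p (nabla M p v ?X) (zeta M p) = 0"
    using nab_T[OF v X(1)] P.bil_lin(10)[OF bil_met] by (simp add: fund_form_def)
  ultimately show ?thesis unfolding nabla_form2_def Let_def using 1 by simp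
qed

abbreviation "\<delta>F \<equiv> \<lambda>q. codiff2 M (fund_form M) q (zeta M q)"

lemma codiff2_fund: "\<delta>F p = - P.tr (frame M p) (\<lambda>x y. nabla_eta p x (phi M p y))"
  unfolding codiff2_def acm_dim P.tr_def
  using nabla_form2_fund P.adaptedD(1)[OF frame_adapted[of p]] by simp

lemma codiff2_beta: "\<delta>F p = - P.tr (frame M p) (\<lambda>x y. beta p (phi M p x) y)"
proof -
  note e = frame_adapted[of p]
  note eD = P.adaptedD[OF e]
  have "P.tr (frame M p) (\<lambda>x y. - 1 * nabla_eta p x (phi M p y) + 0 * nabla_eta p x (phi M p y)) = P.tr (frame M p) (\<lambda>x y. beta p x (phi M p y))"
    unfolding P.tr_def
  proof (intro sum.cong refl)
    fix i assume i: "i \<in> {..<Suc (2*n)}"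
    show "- 1 * nabla_eta p (frame M p i) (phi M p (frame M p i)) + 0 * nabla_eta p (frame M p i) (phi M p (frame M p i)) = beta p (frame M p i) (phi M p (frame M p i))"
    proof (cases "i = 2*n")
      case True
      then show ?thesis using eD(3) by (simp add: beta_def nabla_eta_0)
    next
      case False
      then have "P.hr p (frame M p i) = frame M p i" using eD(4) i by (intro P.hr_hor) simp
      then show ?thesis using eD(1) i by (simp add: beta_def)
    qed
  qed
  then show ?thesis unfolding P.tr_comb codiff2_fund using P.tr_phi_right[OF e hor_form_beta] by simp
qed

lemma a5_eq: "a5 p = codiff1 M (eta M) p / (2 * n)"
  unfolding a5_def codiff1_eta by simp

text \<open>The sign arises because \<open>codiff2_beta\<close> has \<phi> in the first slot, as in
  the definition of the coefficient, with a minus in front.\<close>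

lemma c6_eq: "c6 p = - \<delta>F p / (2 * n)"
  unfolding c6_def codiff2_beta by simp

lemma sf_dF: "sf p \<delta>F"
proof -
  have "sf p (\<lambda>q. P.tr (frame M q) (\<lambda>x y. beta q (phi M q x) y))"
    by (rule sform_tr[OF sform_phi_left[OF sform_beta] frame_adapted])
  then show ?thesis unfolding codiff2_beta by (rule sf_uminus)
qed

lemma sf_c6: "sf p c6"
proof -
  have "sf p (\<lambda>q. (- 1 / (2 * n)) * \<delta>F q)" by (intro sf_mult sf_const sf_dF)
  moreover have "c6 = (\<lambda>q. (- 1 / (2 * n)) * \<delta>F q)" by (intro ext) (simp add: c6_eq)
  ultimately show ?thesis by simp
qed

lemma zeta_c6: "zeta M p c6 = - zeta M p \<delta>F / (2 * n)"
proof -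
  have "c6 = (\<lambda>q. (- 1 / (2 * n)) * \<delta>F q)" by (intro ext) (simp add: c6_eq)
  then show ?thesis using tangent_mult[OF zeta_T sf_const sf_dF, of p "- 1 / (2 * n)"] tangent_const[OF zeta_T, of p] by simp
qed

section \<open>Smoothness and derivatives of the skew components\<close>

definition beta_skew :: "'a form2" where "beta_skew p x y = P.skew_part (beta p) x y"

lemma sform_beta_skew: "sform beta_skew"
  using sform_lin[OF sform_beta sform_swap[OF sform_beta], of "1/2" "-1/2"]
  by (rule sform_cong) (simp add: beta_skew_def P.skew_part_def field_simps)

lemma sform_B_ext_6: "sform (B_ext 6)"
  using sform_comb[OF sform_fund sform_fund sf_c6 sf_const[of _ 0]]
  by (rule sform_cong) (simp add: B_ext_def P.component_def fund_form_fund)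

lemma sform_B_ext_7: "sform (B_ext 7)"
proof -
  have "sform (\<lambda>p x y. 1/2 * beta_skew p x y + 1/2 * beta_skew p (phi M p x) (phi M p y))"
    by (rule sform_lin[OF sform_beta_skew sform_phi[OF sform_beta_skew]])
  from sform_comb[OF this sform_fund sf_const[of _ 1] sf_uminus[OF sf_c6]] show ?thesis
    by (rule sform_cong) (simp add: B_ext_def P.component_def fund_form_fund P.inv_part_def beta_skew_def field_simps)
qed

lemma sform_B_ext_10: "sform (B_ext 10)"
  using sform_lin[OF sform_beta_skew sform_phi[OF sform_beta_skew], of "1/2" "-1/2"]
  by (rule sform_cong) (simp add: B_ext_def P.component_def P.antiinv_part_def beta_skew_def field_simps)

lemma beta_skew_sum: "beta_skew p x y = B_ext 6 p x y + B_ext 7 p x y + B_ext 10 p x y"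
  using P.component_sum(2)[of p "beta p" "a5 p" "c6 p" x y] by (simp add: B_ext_def beta_skew_def)

lemma K_beta_skew: "P.K p x y = beta_skew p x y"
  unfolding P.K_def beta_skew_sum ..

lemma nablaU_cong:
  assumes "v \<in> T p" "sv p Y" "\<forall>\<^sub>F q in nhds p. Y q = Z q"
  shows "nablaU M p v Y = nablaU M p v Z"
  unfolding nablaU_def using nab_cong[OF assms] eventually_nhds_x_imp_x[OF assms(3)] by simp

text \<open>\<eta> is parallel and \<eta>(\<xi>_(i)X Y) = -B_i(X,Y), the other summand being
  horizontal. Hence applying -\<eta> to the derivative of the tensor gives the derivative of the
  form.\<close>

lemma D_xi_comp:
  assumes i: "i \<in> {5..10}" and B: "sform (B_ext i)" and x: "x \<in> T p" and y: "y \<in> T p"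
  shows "act_eta M p (nablaU_tensor12 M (xi_comp M i) p (zeta M p) x) y = D_form (B_ext i) p x y"
proof -
  let ?X = "local_ext M p x" and ?Y = "local_ext M p y"
  note X = local_ext[OF x] and Y = local_ext[OF y]
  let ?S = "\<lambda>q. eta M q (?Y q) *\<^sub>R P.sharp q (B_ext i q) (?X q) - B_ext i q (?X q) (?Y q) *\<^sub>R zeta M q"
  have S: "sv p ?S"
    by (intro sv_diff sv_scale sf_eta Y(1) sform_sharp[OF B X(1)] sform_sf[OF B X(1) Y(1)] sv_zeta)
  have "\<forall>\<^sub>F q in nhds p. ?S q = xi_comp M i q (?X q) (?Y q)"
    by (rule eventually_mono[OF eventually_conj[OF sv_T_near[OF X(1)] sv_T_near[OF Y(1)]]])
      (simp add: xi_comp_eq[OF i] P.b_def)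
  from nablaU_cong[OF zeta_T S this]
  have 1: "nU p (\<lambda>q. xi_comp M i q (?X q) (?Y q)) = nU p ?S" by simp
  have "eta M p (nU p ?S) = zeta M p (\<lambda>q. eta M q (?S q))" by (rule nU_eta[OF zeta_T S, symmetric])
  also have "\<dots> = zeta M p (\<lambda>q. - B_ext i q (?X q) (?Y q))"
  proof (rule tangent_cong_2[OF zeta_T X(1) Y(1)])
    fix q assume q: "?X q \<in> T q" "?Y q \<in> T q"
    then have "P.sharp q (B_ext i q) (?X q) \<in> T q" "eta M q (P.sharp q (B_ext i q) (?X q)) = 0"
      using i P.b_V[of i "?X q" q] P.eta_b[of i "?X q" q] by (auto simp: P.b_def)
    then show "eta M q (?S q) = - B_ext i q (?X q) (?Y q)" using q by simp
  qed
  also have "\<dots> = - zeta M p (\<lambda>q. B_ext i q (?X q) (?Y q))"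
    by (rule tangent_uminus[OF zeta_T sform_sf[OF B X(1) Y(1)]])
  finally have 2: "eta M p (nU p ?S) = - zeta M p (\<lambda>q. B_ext i q (?X q) (?Y q))" .
  have 3: "eta M p (xi_comp M i p u w) = - B_ext i p u w" "xi_comp M i p u w \<in> T p" if "u \<in> T p" "w \<in> T p" for u w
    using act_eta_xi_comp[OF i that] that i P.b_V[of i u p] unfolding act_eta_def by (auto simp: xi_comp_eq)
  have T: "nU p ?X \<in> T p" "nU p ?Y \<in> T p" "nU p ?S \<in> T p" using X Y S by auto
  show ?thesis
    unfolding nablaU_tensor12_def act_eta_def Let_def 1 D_form_def D_field_def
    using 2 3[OF T(1) y] 3[OF x T(2)] T X Y by simp
qed

text \<open>The derivative of \<theta> along \<zeta> by the minimal connection, taken on the same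
  extension of \<open>x\<close> as in \<open>nablaU_tensor12\<close>.\<close>

definition D_theta :: "'a form1" where
  "D_theta p x = zeta M p (\<lambda>q. \<theta> q (local_ext M p x q)) - \<theta> p (nU p (local_ext M p x))"

lemma sf_theta: assumes "sv p X" shows "sf p (\<lambda>q. \<theta> q (X q))"
proof -
  have "sf p (\<lambda>q. - nabla_eta q (zeta M q) (X q))" by (intro sf_uminus sform_sf[OF sform_nabla_eta] sv_zeta assms)
  then show ?thesis
    by (rule sf_cong) (rule eventually_mono[OF sv_T_near[OF assms]], simp add: theta_nabla_eta)
qed

lemma sv_xi_zz: "sv p xi_zz"
proof -
  have "sv p (\<lambda>q. - nabla M q (zeta M q) (zeta M))" by (intro sv_uminus nab_sv sv_zeta)
  then show ?thesis by (rule sv_cong) (simp add: xi_zeta nabla_zeta_def)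
qed

lemma theta_simps [simp]: 
  "x \<in> T p \<Longrightarrow> y \<in> T p \<Longrightarrow> \<theta> p (x + y) = \<theta> p x + \<theta> p y"
  "x \<in> T p \<Longrightarrow> y \<in> T p \<Longrightarrow> \<theta> p (x - y) = \<theta> p x - \<theta> p y"
  "x \<in> T p \<Longrightarrow> \<theta> p (a *\<^sub>R x) = a * \<theta> p x"
  "\<theta> p (zeta M p) = 0"
  by (simp_all add: theta_xi_zz eta_xi_zz)

lemma D_xi_comp_12:
  assumes x: "x \<in> T p"
  shows "act_eta M p (nablaU_tensor12 M (xi_comp M 12) p (zeta M p) (zeta M p)) x = D_theta p x"
proof -
  let ?X = "local_ext M p x" and ?Z = "local_ext M p (zeta M p)"
  note X = local_ext[OF x] and Z = local_ext[OF zeta_T[of p]]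
  let ?S = "\<lambda>q. eta M q (?Z q) *\<^sub>R (eta M q (?X q) *\<^sub>R xi_zz q - \<theta> q (?X q) *\<^sub>R zeta M q)"
  have S: "sv p ?S"
    by (intro sv_diff sv_scale sf_eta X(1) Z(1) sv_xi_zz sf_theta sv_zeta)
  have "\<forall>\<^sub>F q in nhds p. ?S q = xi_comp M 12 q (?Z q) (?X q)"
    by (rule eventually_mono[OF eventually_conj[OF sv_T_near[OF X(1)] sv_T_near[OF Z(1)]]])
      (simp add: xi_comp_12)
  from nablaU_cong[OF zeta_T S this]
  have 1: "nU p (\<lambda>q. xi_comp M 12 q (?Z q) (?X q)) = nU p ?S" by simp
  have "eta M p (nU p ?S) = zeta M p (\<lambda>q. eta M q (?S q))" by (rule nU_eta[OF zeta_T S, symmetric])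
  also have "\<dots> = zeta M p (\<lambda>q. - (eta M q (?Z q) * \<theta> q (?X q)))"
    by (rule tangent_cong[OF zeta_T]) (simp add: eta_xi_zz)
  also have "\<dots> = - (zeta M p (\<lambda>q. eta M q (?Z q)) * \<theta> p x + zeta M p (\<lambda>q. \<theta> q (?X q)))"
    using tangent_uminus[OF zeta_T sf_mult[OF sf_eta[OF Z(1)] sf_theta[OF X(1)]]]
      tangent_mult[OF zeta_T sf_eta[OF Z(1)] sf_theta[OF X(1)]] X Z by simp
  \<comment> \<open>\<eta> may vary along the chosen extension of \<zeta>; its derivative reappears
    in the correction term with \<open>nU p ?Z\<close> and cancels.\<close>
  also have "zeta M p (\<lambda>q. eta M q (?Z q)) = eta M p (nU p ?Z)" by (rule nU_eta[OF zeta_T Z(1)])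
  finally have 2: "eta M p (nU p ?S) = - (eta M p (nU p ?Z) * \<theta> p x + zeta M p (\<lambda>q. \<theta> q (?X q)))" .
  have T: "nU p ?X \<in> T p" "nU p ?Z \<in> T p" "nU p ?S \<in> T p" "xi_zz p \<in> T p" using X Z S by auto
  show ?thesis
    unfolding nablaU_tensor12_def act_eta_def Let_def 1 D_theta_def
    using 2 T X Z x by (simp add: xi_comp_12 eta_xi_zz)
qed

subsection \<open>The exterior derivative of \<open>\<theta>\<close>\<close>

text \<open>Torsion-freeness makes this the commutator of derivations; in this form tangency and
  smoothness are inherited from the connection.\<close>

definition bracket :: "'a vfield \<Rightarrow> 'a vfield \<Rightarrow> 'a vfield" where
  "bracket X Y q = nabla M q (X q) Y - nabla M q (Y q) X"

lemma sv_bracket [intro]: "sv p X \<Longrightarrow> sv p Y \<Longrightarrow> sv p (bracket X Y)"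
  unfolding bracket_def[abs_def] by (intro sv_diff nab_sv)

lemma bracket_app: "sv p X \<Longrightarrow> sv p Y \<Longrightarrow> sf p f \<Longrightarrow> bracket X Y p f = X p (\<lambda>q. Y q f) - Y p (\<lambda>q. X q f)"
  unfolding bracket_def using nab_torsion by simp

lemma deriv_bracket:
  assumes v: "v \<in> T p" and X: "sv p X" and Y: "sv p Y" and f: "sf p f"
  shows "v (\<lambda>q. bracket X Y q f) = v (\<lambda>q. X q (\<lambda>r. Y r f)) - v (\<lambda>q. Y q (\<lambda>r. X r f))"
proof -
  have "v (\<lambda>q. bracket X Y q f) = v (\<lambda>q. X q (\<lambda>r. Y r f) - Y q (\<lambda>r. X r f))"
    using tangent_cong[OF v] eventually_mono[OF eventually_conj[OF sv_eventually[OF X] eventually_conj[OF sv_eventually[OF Y] sf_eventually[OF f]]]]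
      bracket_app by (metis (mono_tags, lifting))
  also have "\<dots> = v (\<lambda>q. X q (\<lambda>r. Y r f)) - v (\<lambda>q. Y q (\<lambda>r. X r f))"
    by (rule tangent_diff[OF v sv_app[OF X sv_app[OF Y f]] sv_app[OF Y sv_app[OF X f]]])
  finally show ?thesis .
qed

text \<open>On smooth functions both sides expand into iterated derivatives; on the remaining
  functions tangent vectors vanish.\<close>

lemma jacobi:
  assumes X: "sv p X" and Y: "sv p Y" and Z: "sv p Z"
  shows "bracket Z (bracket X Y) p = bracket (bracket Z X) Y p + bracket X (bracket Z Y) p"
proof
  fix f
  have T: "X p \<in> T p" "Y p \<in> T p" "Z p \<in> T p" using X Y Z by auto
  show "bracket Z (bracket X Y) p f = (bracket (bracket Z X) Y p + bracket X (bracket Z Y) p) f"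
  proof (cases "sf p f")
    case True
    note f = True
    note app = sv_app[OF X f] sv_app[OF Y f] sv_app[OF Z f]
    show ?thesis
      using bracket_app[OF Z sv_bracket[OF X Y] f] bracket_app[OF sv_bracket[OF Z X] Y f] bracket_app[OF X sv_bracket[OF Z Y] f]
        deriv_bracket[OF T(3) X Y f] deriv_bracket[OF T(2) Z X f] deriv_bracket[OF T(1) Z Y f]
        bracket_app[OF X Y app(3)] bracket_app[OF Z X app(2)] bracket_app[OF Z Y app(1)] by simp
  next
    case False
    show ?thesis
      using tangent_nonsmooth[OF sv_tangent[OF sv_bracket[OF Z sv_bracket[OF X Y]]] False]
        tangent_nonsmooth[OF sv_tangent[OF sv_bracket[OF sv_bracket[OF Z X] Y]] False]
        tangent_nonsmooth[OF sv_tangent[OF sv_bracket[OF X sv_bracket[OF Z Y]]] False] by simp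
  qed
qed

definition d_eta :: "'a form2" where "d_eta p x y = nabla_eta p x y - nabla_eta p y x"

lemma sform_d_eta: "sform d_eta"
  using sform_lin[OF sform_nabla_eta sform_swap[OF sform_nabla_eta], of 1 "-1"] by (simp add: d_eta_def[abs_def])

lemma d_eta_fields:
  assumes "sv p X" "sv p Y"
  shows "d_eta p (X p) (Y p) = X p (\<lambda>q. eta M q (Y q)) - Y p (\<lambda>q. eta M q (X q)) - eta M p (bracket X Y p)"
proof -
  have "X p \<in> T p" "Y p \<in> T p" using assms by auto
  then show ?thesis using assms by (simp add: d_eta_def bracket_def deriv_eta)
qed

text \<open>The invariant formula for \<theta> = -d\<eta>(\<zeta>, .), in which \<eta>(\<zeta>) = 1
  removes one derivative.\<close>

lemma theta_fields:
  assumes "sv p Y"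
  shows "\<theta> p (Y p) = eta M p (bracket (zeta M) Y p) - zeta M p (\<lambda>q. eta M q (Y q))"
proof -
  have "Y p \<in> T p" using assms by auto
  then have "\<theta> p (Y p) = - d_eta p (zeta M p) (Y p)" by (simp add: d_eta_def theta_nabla_eta)
  then show ?thesis using d_eta_fields[OF sv_zeta assms] tangent_const[of "Y p" p 1] \<open>Y p \<in> T p\<close> by simp
qed

text \<open>The identity \<open>d\<theta> = - L\<^sub>\<zeta> d\<eta>\<close>, evaluated on vector fields.\<close>

lemma cartan:
  assumes X: "sv p X" and Y: "sv p Y"
  shows "X p (\<lambda>q. \<theta> q (Y q)) - Y p (\<lambda>q. \<theta> q (X q)) - \<theta> p (bracket X Y p) =
    - zeta M p (\<lambda>q. d_eta q (X q) (Y q)) + d_eta p (bracket (zeta M) X p) (Y p) + d_eta p (X p) (bracket (zeta M) Y p)"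
proof -
  have T: "X p \<in> T p" "Y p \<in> T p" using X Y by auto
  have th: "v (\<lambda>q. \<theta> q (W q)) = v (\<lambda>q. eta M q (bracket (zeta M) W q)) - v (\<lambda>q. zeta M q (\<lambda>r. eta M r (W r)))"
    if v: "v \<in> T p" and W: "sv p W" for v W
  proof -
    have "v (\<lambda>q. \<theta> q (W q)) = v (\<lambda>q. eta M q (bracket (zeta M) W q) - zeta M q (\<lambda>r. eta M r (W r)))"
      by (rule tangent_cong[OF v], rule eventually_mono[OF sv_eventually[OF W]]) (rule theta_fields)
    also have "\<dots> = v (\<lambda>q. eta M q (bracket (zeta M) W q)) - v (\<lambda>q. zeta M q (\<lambda>r. eta M r (W r)))"
      by (rule tangent_diff[OF v sf_eta[OF sv_bracket[OF sv_zeta W]] sv_app[OF sv_zeta sf_eta[OF W]]])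
    finally show ?thesis .
  qed
  have "zeta M p (\<lambda>q. d_eta q (X q) (Y q)) =
     zeta M p (\<lambda>q. X q (\<lambda>r. eta M r (Y r)) - Y q (\<lambda>r. eta M r (X r)) - eta M q (bracket X Y q))"
    by (rule tangent_cong[OF zeta_T], rule eventually_mono[OF eventually_conj[OF sv_eventually[OF X] sv_eventually[OF Y]]])
      (simp add: d_eta_fields)
  also have "\<dots> = zeta M p (\<lambda>q. X q (\<lambda>r. eta M r (Y r))) - zeta M p (\<lambda>q. Y q (\<lambda>r. eta M r (X r)))
      - zeta M p (\<lambda>q. eta M q (bracket X Y q))"
    using tangent_diff[OF zeta_T sf_diff[OF sv_app[OF X sf_eta[OF Y]] sv_app[OF Y sf_eta[OF X]]] sf_eta[OF sv_bracket[OF X Y]]]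
      tangent_diff[OF zeta_T sv_app[OF X sf_eta[OF Y]] sv_app[OF Y sf_eta[OF X]]] by simp
  finally have 1: "zeta M p (\<lambda>q. d_eta q (X q) (Y q)) = zeta M p (\<lambda>q. X q (\<lambda>r. eta M r (Y r))) - zeta M p (\<lambda>q. Y q (\<lambda>r. eta M r (X r)))
      - zeta M p (\<lambda>q. eta M q (bracket X Y q))" .
  note zX = sv_bracket[OF sv_zeta X] and zY = sv_bracket[OF sv_zeta Y]
  \<comment> \<open>The Jacobi identity is the place where d d = 0 enters.\<close>
  have J: "eta M p (bracket (zeta M) (bracket X Y) p) = eta M p (bracket (bracket (zeta M) X) Y p) + eta M p (bracket X (bracket (zeta M) Y) p)"
    unfolding jacobi[OF X Y sv_zeta] using sv_tangent[OF sv_bracket[OF zX Y]] sv_tangent[OF sv_bracket[OF X zY]] by simp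
  show ?thesis
    unfolding th[OF T(1) Y] th[OF T(2) X] theta_fields[OF sv_bracket[OF X Y]] 1 d_eta_fields[OF zX Y] d_eta_fields[OF X zY] J
    using bracket_app[OF sv_zeta X sf_eta[OF Y]] bracket_app[OF sv_zeta Y sf_eta[OF X]] by simp
qed

text \<open>The torsion of the minimal connection at (\<zeta>, x): it equals \<xi>_\<zeta> x -
  \<xi>_x \<zeta>, and \<xi>_x \<zeta> = -\<nabla>_x \<zeta>.\<close>

definition torsion_zeta :: "'a \<Rightarrow> 'a tvec \<Rightarrow> 'a tvec" where "torsion_zeta p x = xi M p (zeta M p) x + nabla_zeta p x"

lemma torsion_zeta_T [intro, simp]: "x \<in> T p \<Longrightarrow> torsion_zeta p x \<in> T p" unfolding torsion_zeta_def by auto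

lemma torsion_zeta_lin: "x \<in> T p \<Longrightarrow> y \<in> T p \<Longrightarrow> torsion_zeta p (a *\<^sub>R x + b *\<^sub>R y) = a *\<^sub>R torsion_zeta p x + b *\<^sub>R torsion_zeta p y"
  unfolding torsion_zeta_def by (simp add: xi_lin nabla_zeta_lin algebra_simps)

text \<open>Writing [\<zeta>,W] as the derivative of W by the minimal connection minus the torsion
  turns the Lie derivative into a covariant one plus two algebraic terms.\<close>

lemma dtheta_d_eta:
  assumes x: "x \<in> T p" and y: "y \<in> T p"
  shows "d1 M \<theta> p x y = - D_form d_eta p x y - d_eta p (torsion_zeta p x) y - d_eta p x (torsion_zeta p y)"
proof -
  let ?X = "local_ext M p x" and ?Y = "local_ext M p y"
  note X = local_ext[OF x] and Y = local_ext[OF y]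
  have br_nU: "bracket (zeta M) W p = nU p W - torsion_zeta p (W p)" if "sv p W" for W
    using that unfolding bracket_def nablaU_def torsion_zeta_def nabla_zeta_def by simp
  have b: "bracket ?X ?Y p = nabla M p x ?Y - nabla M p y ?X" using X Y by (simp add: bracket_def)
  have n: "nabla M p x ?Y \<in> T p" "nabla M p y ?X \<in> T p" using x y X Y by auto
  have "d1 M \<theta> p x y = x (\<lambda>q. \<theta> q (?Y q)) - y (\<lambda>q. \<theta> q (?X q)) - \<theta> p (bracket ?X ?Y p)"
    unfolding d1_def nabla_form1_def Let_def b using n by simp
  also have "\<dots> = - zeta M p (\<lambda>q. d_eta q (?X q) (?Y q)) + d_eta p (nU p ?X - torsion_zeta p x) y + d_eta p x (nU p ?Y - torsion_zeta p y)"
    using cartan[OF X(1) Y(1)] X Y br_nU by simp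
  also have "\<dots> = - D_form d_eta p x y - d_eta p (torsion_zeta p x) y - d_eta p x (torsion_zeta p y)"
  proof -
    have "nU p ?X \<in> T p" "nU p ?Y \<in> T p" "torsion_zeta p x \<in> T p" "torsion_zeta p y \<in> T p" using x y X Y by auto
    then show ?thesis unfolding D_form_def D_field_def using x y X Y by (simp add: P.bil_lin[OF sform_bil[OF sform_d_eta]])
  qed
  finally show ?thesis .
qed

lemma nabla_eta_beta: 
  assumes "x \<in> T p" "y \<in> T p" shows "nabla_eta p x y = - beta p x y - eta M p x * \<theta> p y"
proof -
  have "nabla_eta p x y = nabla_eta p (P.hr p x + eta M p x *\<^sub>R zeta M p) (P.hr p y + eta M p y *\<^sub>R zeta M p)" 
    by (simp add: P.hr_def)
  also have "\<dots> = - beta p x y + eta M p x * nabla_eta p (zeta M p) (P.hr p y)"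
    using assms P.hr_V[of x p] P.hr_V[of y p] by (simp add: P.bil_lin[OF bil_nabla_eta] beta_def)
  also have "nabla_eta p (zeta M p) (P.hr p y) = - \<theta> p y"
    using assms by (simp add: P.hr_def P.bil_lin[OF bil_nabla_eta] theta_nabla_eta)
  finally show ?thesis by simp
qed

lemma d_eta_eq:
  assumes "x \<in> T p" "y \<in> T p" 
  shows "d_eta p x y = - 2 * beta_skew p x y - eta M p x * \<theta> p y + eta M p y * \<theta> p x"
  unfolding d_eta_def using assms by (simp add: nabla_eta_beta beta_skew_def P.skew_part_def)

lemma b_sum_beta:
  assumes "x \<in> T p" "w \<in> T p" shows "met M p (P.b_sum p x) w = beta p x w"
proof -
  have b: "P.b p i x \<in> T p" if "i \<in> {5..11}" for i using assms that by auto
  have "met M p (P.b_sum p x) w = B_ext 5 p x w + B_ext 6 p x w + B_ext 7 p x w + B_ext 8 p x w + B_ext 9 p x w + B_ext 10 p x w"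
    unfolding P.b_sum_def using assms b by (simp add: P.g_b)
  also have "\<dots> = beta p x w"
    using P.component_sum[of p "beta p" "a5 p" "c6 p" x w] by (simp add: B_ext_def P.sym_part_def P.skew_part_def field_simps)
  finally show ?thesis .
qed

lemma b_sum_T [intro, simp]: "x \<in> T p \<Longrightarrow> P.b_sum p x \<in> T p"
  unfolding P.b_sum_def by (intro P.V_closed P.b_V) auto

lemma eta_b_sum [simp]: "x \<in> T p \<Longrightarrow> eta M p (P.b_sum p x) = 0"
  using b_sum_beta[of x p "zeta M p"] P.hor_formD(3)[OF hor_form_beta] by simp

text \<open>\<xi>_\<zeta> contributes C and the multiple of \<zeta>; \<nabla>\<zeta> contributes the
  endomorphism of -\<open>beta\<close>.\<close>

lemma torsion_zeta_eq:
  assumes x: "x \<in> T p"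
  shows "torsion_zeta p x = P.b p 11 x - P.b_sum p x - \<theta> p x *\<^sub>R zeta M p"
proof (rule P.g_eqI)
  have hx: "P.hr p x \<in> T p" using x by simp
  have "x = 1 *\<^sub>R P.hr p x + eta M p x *\<^sub>R zeta M p" by (simp add: P.hr_def)
  then have "torsion_zeta p x = 1 *\<^sub>R torsion_zeta p (P.hr p x) + eta M p x *\<^sub>R torsion_zeta p (zeta M p)"
    using torsion_zeta_lin[OF hx zeta_T, of 1 "eta M p x"] by simp
  \<comment> \<open>The torsion at (\<zeta>, \<zeta>) vanishes, which allows \<open>x\<close> to be
    replaced by its horizontal part.\<close>
  then have S: "torsion_zeta p x = torsion_zeta p (P.hr p x)" by (simp add: torsion_zeta_def xi_zeta)
  fix w assume w: "w \<in> T p"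
  have xh: "xi M p (zeta M p) (P.hr p x) \<in> T p" "nabla_zeta p (P.hr p x) \<in> T p" using hx by auto
  have "met M p (xi M p (zeta M p) (P.hr p x)) w = B_ext 11 p x w + eta M p w * nabla_eta p (zeta M p) (P.hr p x)"
  proof -
    have "w = P.hr p w + eta M p w *\<^sub>R zeta M p" by (simp add: P.hr_def)
    then have "met M p (xi M p (zeta M p) (P.hr p x)) w = met M p (xi M p (zeta M p) (P.hr p x)) (P.hr p w + eta M p w *\<^sub>R zeta M p)"
      by simp
    then show ?thesis using w xh hx by (simp add: B_ext_def eta_xi)
  qed
  moreover have "nabla_eta p (zeta M p) (P.hr p x) = - \<theta> p x"
    using x by (simp add: P.hr_def P.bil_lin[OF bil_nabla_eta] theta_nabla_eta)
  moreover have "met M p (nabla_zeta p (P.hr p x)) w = - beta p x w"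
    using nabla_eta_beta[OF hx w] hx x w P.hor_form_hr(1)[OF hor_form_beta, of x p w] by (simp add: nabla_eta_def)
  ultimately have "met M p (torsion_zeta p (P.hr p x)) w = B_ext 11 p x w - beta p x w - \<theta> p x * eta M p w"
    unfolding torsion_zeta_def using w xh by simp
  then have "met M p (torsion_zeta p x) w = B_ext 11 p x w - beta p x w - \<theta> p x * eta M p w"
    by (simp add: S[symmetric])
  then show "met M p (torsion_zeta p x) w = met M p (P.b p 11 x - P.b_sum p x - \<theta> p x *\<^sub>R zeta M p) w"
    using x w by (simp add: P.g_b b_sum_beta)
qed (use x in auto)

definition eta_theta :: "'a form2" where "eta_theta p x y = eta M p x * \<theta> p y"

lemma sform_eta_theta: "sform eta_theta"
  using sform_lin[OF sform_tensor sform_tensor, of "-1" 0]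
  by (rule sform_cong) (simp add: eta_theta_def theta_nabla_eta)

lemma D_form_eta_theta:
  assumes x: "x \<in> T p" and y: "y \<in> T p"
  shows "D_form eta_theta p x y = eta M p x * D_theta p y"
proof -
  let ?X = "local_ext M p x" and ?Y = "local_ext M p y"
  note X = local_ext[OF x] and Y = local_ext[OF y]
  have "zeta M p (\<lambda>q. eta_theta q (?X q) (?Y q)) = eta M p (nU p ?X) * \<theta> p y + eta M p x * zeta M p (\<lambda>q. \<theta> q (?Y q))"
    unfolding eta_theta_def tangent_mult[OF zeta_T sf_eta[OF X(1)] sf_theta[OF Y(1)]] nU_eta[OF zeta_T X(1)] using X Y by simp
  then show ?thesis unfolding D_form_def D_field_def D_theta_def using X Y by (simp add: eta_theta_def algebra_simps)
qed

lemma D_form_d_eta: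
  assumes x: "x \<in> T p" and y: "y \<in> T p"
  shows "D_form d_eta p x y = - 2 * D_form beta_skew p x y - eta M p x * D_theta p y + eta M p y * D_theta p x"
proof -
  let ?t = "\<lambda>p x y. -1 * eta_theta p x y + 1 * eta_theta p y x"
  have s: "sform ?t" by (rule sform_lin[OF sform_eta_theta sform_swap[OF sform_eta_theta]])
  have "D_form d_eta p x y = D_form (\<lambda>p x y. -2 * beta_skew p x y + 1 * ?t p x y) p x y"
    by (rule D_form_cong[OF _ x y]) (simp add: d_eta_eq eta_theta_def)
  also have "\<dots> = -2 * D_form beta_skew p x y + 1 * D_form ?t p x y" by (rule D_form_lin[OF sform_beta_skew s x y])
  also have "D_form ?t p x y = -1 * D_form eta_theta p x y + 1 * D_form (\<lambda>p x y. eta_theta p y x) p x y"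
    by (rule D_form_lin[OF sform_eta_theta sform_swap[OF sform_eta_theta] x y])
  finally show ?thesis using D_form_swap[of eta_theta p x y] D_form_eta_theta x y by simp
qed

text \<open>The coefficient of \<eta> in d\<theta>; \<open>dtheta_zeta\<close> shows that it is the
  interior product with \<zeta>.\<close>

definition zeta_dtheta :: "'a form1" where "zeta_dtheta p y = D_theta p y + \<theta> p (P.b p 11 y - P.b_sum p y)"

lemma beta_skew_hor: "P.hor_form p (beta_skew p)"
  unfolding beta_skew_def[abs_def] using P.hor_form_parts(4)[OF hor_form_beta] by simp

text \<open>The \<zeta>-component of the torsion produces \<theta>(x)\<theta>(y) with both signs, so
  no term quadratic in \<theta> survives.\<close>

lemma dtheta_master:
  assumes x: "x \<in> T p" and y: "y \<in> T p"
  shows "d1 M \<theta> p x y = 2 * D_form beta_skew p x y + 2 * P.R p x y + eta M p x * zeta_dtheta p y - eta M p y * zeta_dtheta p x"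
proof -
  have V: "P.b p 11 u - P.b_sum p u \<in> T p" "eta M p (P.b p 11 u - P.b_sum p u) = 0" if "u \<in> T p" for u
    using that by auto
  have S: "beta_skew p (torsion_zeta p u) w = beta_skew p (P.b p 11 u - P.b_sum p u) w" "beta_skew p w (torsion_zeta p u) = beta_skew p w (P.b p 11 u - P.b_sum p u)"
    "\<theta> p (torsion_zeta p u) = \<theta> p (P.b p 11 u - P.b_sum p u)" "eta M p (torsion_zeta p u) = - \<theta> p u"
    if "u \<in> T p" "w \<in> T p" for u w
    unfolding torsion_zeta_eq[OF that(1)]
    using V[OF that(1)] that by (simp_all add: P.bil_lin[OF P.hor_formD(1)[OF beta_skew_hor]] P.hor_formD[OF beta_skew_hor])
  have "d_eta p (torsion_zeta p x) y = - 2 * beta_skew p (P.b p 11 x - P.b_sum p x) y + \<theta> p x * \<theta> p y + eta M p y * \<theta> p (P.b p 11 x - P.b_sum p x)"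
    using x y by (simp add: d_eta_eq S)
  moreover have "d_eta p x (torsion_zeta p y) = - 2 * beta_skew p x (P.b p 11 y - P.b_sum p y) - eta M p x * \<theta> p (P.b p 11 y - P.b_sum p y) - \<theta> p y * \<theta> p x"
    using x y by (simp add: d_eta_eq S)
  ultimately show ?thesis
    unfolding dtheta_d_eta[OF x y] D_form_d_eta[OF x y] P.R_def K_beta_skew zeta_dtheta_def by (simp add: algebra_simps)
qed

text \<open>F is parallel, so component 6 contributes only the derivative of its
  coefficient.\<close>

lemma D_form_beta_skew:
  assumes x: "x \<in> T p" and y: "y \<in> T p"
  shows "D_form beta_skew p x y = zeta M p c6 * fund_form M p x y + D_form (B_ext 7) p x y + D_form (B_ext 10) p x y"
proof -
  have s: "sform (\<lambda>p x y. 1 * B_ext 7 p x y + 1 * B_ext 10 p x y)" by (rule sform_lin[OF sform_B_ext_7 sform_B_ext_10])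
  have "D_form beta_skew p x y = D_form (\<lambda>p x y. 1 * B_ext 6 p x y + 1 * (1 * B_ext 7 p x y + 1 * B_ext 10 p x y)) p x y"
    by (rule D_form_cong[OF _ x y]) (simp add: beta_skew_sum)
  also have "\<dots> = 1 * D_form (B_ext 6) p x y + 1 * D_form (\<lambda>p x y. 1 * B_ext 7 p x y + 1 * B_ext 10 p x y) p x y"
    by (rule D_form_lin[OF sform_B_ext_6 s x y])
  also have "D_form (\<lambda>p x y. 1 * B_ext 7 p x y + 1 * B_ext 10 p x y) p x y = 1 * D_form (B_ext 7) p x y + 1 * D_form (B_ext 10) p x y"
    by (rule D_form_lin[OF sform_B_ext_7 sform_B_ext_10 x y])
  also have "D_form (B_ext 6) p x y = D_form (\<lambda>p x y. c6 p * fund_form M p x y + 0 * fund_form M p x y) p x y"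
    by (rule D_form_cong[OF _ x y]) (simp add: B_ext_def P.component_def fund_form_fund)
  also have "\<dots> = zeta M p c6 * fund_form M p x y"
    using D_form_comb[OF sform_fund sform_fund sf_c6 sf_const[of _ 0] x y] D_form_fund[OF x y] tangent_const[OF zeta_T, of p 0] by simp
  finally show ?thesis by simp
qed

lemma D_form_B_ext_phi:
  assumes "sform (B_ext i)" "i \<in> {5..11}" and x: "x \<in> T p" and y: "y \<in> T p"
  shows "D_form (B_ext i) p (phi M p x) (phi M p y) = P.eps i * D_form (B_ext i) p x y"
proof -
  have "D_form (B_ext i) p (phi M p x) (phi M p y) = D_form (\<lambda>p x y. B_ext i p (phi M p x) (phi M p y)) p x y"
    by (rule D_form_phi[OF assms(1) x y, symmetric])
  also have "\<dots> = D_form (\<lambda>p x y. P.eps i * B_ext i p x y + 0 * B_ext i p x y) p x y"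
    by (rule D_form_cong[OF _ x y]) (simp add: P.B_phi[OF assms(2)])
  also have "\<dots> = P.eps i * D_form (B_ext i) p x y" using D_form_lin[OF assms(1,1) x y, of "P.eps i" 0] by simp
  finally show ?thesis .
qed

lemma phi2_T: "x \<in> T p \<Longrightarrow> phi M p (phi M p x) \<in> T p" by auto

lemma B_ext_5_6:
  assumes "x \<in> T p" "y \<in> T p"
  shows "B_ext 5 p x y = a5 p * P.met_hor p x y" "B_ext 6 p x y = c6 p * P.fund p x y"
  by (simp_all add: B_ext_def P.component_def)

lemma D_form_beta_skew_phi:
  assumes x: "x \<in> T p" and y: "y \<in> T p"
  shows "D_form beta_skew p (phi M p x) (phi M p y) = zeta M p c6 * fund_form M p x y + D_form (B_ext 7) p x y - D_form (B_ext 10) p x y"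
    and "D_form beta_skew p (phi M p (phi M p x)) (phi M p (phi M p y)) = zeta M p c6 * fund_form M p x y + D_form (B_ext 7) p x y + D_form (B_ext 10) p x y"
proof -
  have px: "phi M p x \<in> T p" "phi M p y \<in> T p" using x y by auto
  note F = P.fund_phi[of _ p, folded fund_form_fund]
  show "D_form beta_skew p (phi M p x) (phi M p y) = zeta M p c6 * fund_form M p x y + D_form (B_ext 7) p x y - D_form (B_ext 10) p x y"
    unfolding D_form_beta_skew[OF px] using F[OF x y] D_form_B_ext_phi[OF sform_B_ext_7 _ x y] D_form_B_ext_phi[OF sform_B_ext_10 _ x y]
    by (simp add: P.eps_def)
  show "D_form beta_skew p (phi M p (phi M p x)) (phi M p (phi M p y)) = zeta M p c6 * fund_form M p x y + D_form (B_ext 7) p x y + D_form (B_ext 10) p x y"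
    unfolding D_form_beta_skew[OF phi2_T[OF x] phi2_T[OF y]]
    using F[OF x y] F[OF px] D_form_B_ext_phi[OF sform_B_ext_7 _ x y] D_form_B_ext_phi[OF sform_B_ext_10 _ x y]
      D_form_B_ext_phi[OF sform_B_ext_7 _ px] D_form_B_ext_phi[OF sform_B_ext_10 _ px] by (simp add: P.eps_def)
qed

lemma dtheta_phi:
  assumes x: "x \<in> T p" and y: "y \<in> T p"
  shows "d1 M \<theta> p (phi M p x) (phi M p y) = 2 * D_form beta_skew p (phi M p x) (phi M p y) + 2 * P.R p (phi M p x) (phi M p y)"
  using x y by (simp add: dtheta_master)

section \<open>The components of d\<theta> and its pairing with F\<close>

lemma comp_11_dtheta:
  assumes x: "x \<in> T p" and y: "y \<in> T p"
  shows "comp_11 M (d1 M \<theta>) p x y =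
    2 * zeta M p c6 * fund_form M p x y + 2 * D_form (B_ext 7) p x y + 2 * P.R_inv p (a5 p) (c6 p) x y"
proof -
  have "(P.R p (phi M p (phi M p x)) (phi M p (phi M p y)) + P.R p (phi M p x) (phi M p y)) / 2 = P.R_inv p (a5 p) (c6 p) x y"
    by (rule P.R_11[OF x y]) (simp_all add: B_ext_5_6)
  then show ?thesis
    unfolding comp_11_def dtheta_phi[OF x y] dtheta_phi[OF P.phi_V[OF x] P.phi_V[OF y]] D_form_beta_skew_phi[OF x y]
    by simp
qed

lemma comp_20_dtheta:
  assumes x: "x \<in> T p" and y: "y \<in> T p"
  shows "comp_20 M (d1 M \<theta>) p x y = 2 * D_form (B_ext 10) p x y + 2 * P.R_antiinv p (a5 p) (c6 p) x y"
proof -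
  have "(P.R p (phi M p (phi M p x)) (phi M p (phi M p y)) - P.R p (phi M p x) (phi M p y)) / 2 = P.R_antiinv p (a5 p) (c6 p) x y"
    by (rule P.R_20[OF x y]) (simp_all add: B_ext_5_6)
  then show ?thesis
    unfolding comp_20_def dtheta_phi[OF x y] dtheta_phi[OF P.phi_V[OF x] P.phi_V[OF y]] D_form_beta_skew_phi[OF x y]
    by simp
qed

text \<open>Tensoriality allows \<zeta> as its own extension; it is parallel and \<theta>(\<zeta>) =
  0.\<close>

lemma D_theta_zeta: "D_theta p (zeta M p) = 0"
proof -
  have "D_form eta_theta p (zeta M p) (zeta M p) = D_field eta_theta p (zeta M) (zeta M)"
    by (rule D_form_field[OF sform_eta_theta sv_zeta sv_zeta, symmetric])
  also have "\<dots> = 0"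
    unfolding D_field_def nU_zeta[OF zeta_T] using tangent_const[OF zeta_T, of p 0] theta_simps(3)[OF zeta_T, of p 0]
    by (simp add: eta_theta_def)
  finally show ?thesis unfolding D_form_eta_theta[OF zeta_T zeta_T] by simp
qed

lemma b_zeta: "i \<in> {5..11} \<Longrightarrow> P.b p i (zeta M p) = 0"
  by (rule P.g_eqI) (use P.hor_formD(2)[OF P.B_hor] P.bil_lin(9)[OF bil_met] in \<open>auto simp: P.g_b\<close>)

lemma dtheta_zeta:
  assumes x: "x \<in> T p"
  shows "d1 M \<theta> p (zeta M p) x = zeta_dtheta p x"
proof -
  \<comment> \<open>The derivative is unchanged by \<phi> squared in both slots, and \<phi> kills
    \<zeta>.\<close>
  have D: "D_form beta_skew p (zeta M p) x = 0"
  proof -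
    have z: "bil (T p) (D_form beta_skew p)" by (rule D_form_bil[OF sform_beta_skew])
    have "D_form beta_skew p (phi M p (phi M p (zeta M p))) (phi M p (phi M p x)) = D_form beta_skew p (zeta M p) x"
      unfolding D_form_beta_skew_phi[OF zeta_T x] D_form_beta_skew[OF zeta_T x] ..
    then show ?thesis using P.bil_lin(9)[OF z zeta_T phi2_T[OF x]] by simp
  qed
  have bs: "P.b_sum p (zeta M p) = 0" unfolding P.b_sum_def by (simp add: b_zeta)
  have V: "P.b p 11 x - P.b_sum p x \<in> T p" using x by auto
  have "P.R p (zeta M p) x = 0"
    unfolding P.R_def K_beta_skew bs using P.bil_lin(9)[OF P.hor_formD(1)[OF beta_skew_hor] zeta_T x] P.hor_formD(2)[OF beta_skew_hor V] by (simp add: b_zeta)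
  moreover have "zeta_dtheta p (zeta M p) = 0"
    unfolding zeta_dtheta_def bs D_theta_zeta using theta_simps(3)[OF zeta_T, of p 0] by (simp add: b_zeta)
  ultimately show ?thesis unfolding dtheta_master[OF zeta_T x] D by simp
qed

text \<open>\<open>xi_zz p\<close> represents \<theta>, so \<theta>(\<open>b_sum\<close> x) is
  \<open>beta\<close> paired with that vector; moving it to the first slot keeps the symmetric
  components and negates the skew ones.\<close>

lemma zeta_dtheta_eq:
  assumes x: "x \<in> T p"
  shows "zeta_dtheta p x = D_theta p x + \<theta> p (P.b p 11 x) - a5 p * \<theta> p x - B_ext 8 p (xi_zz p) x - B_ext 9 p (xi_zz p) x
    + c6 p * \<theta> p (phi M p x) + B_ext 7 p (xi_zz p) x + B_ext 10 p (xi_zz p) x"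
proof -
  have t: "xi_zz p \<in> T p" by auto
  have "\<theta> p (P.b_sum p x) = beta p x (xi_zz p)"
    using theta_xi_zz[OF b_sum_T[OF x]] met_sym[OF t b_sum_T[OF x]] b_sum_beta[OF x t] by simp
  also have "\<dots> = B_ext 5 p x (xi_zz p) + B_ext 8 p x (xi_zz p) + B_ext 9 p x (xi_zz p) + B_ext 6 p x (xi_zz p) + B_ext 7 p x (xi_zz p) + B_ext 10 p x (xi_zz p)"
    using P.component_sum[of p "beta p" "a5 p" "c6 p" x "xi_zz p"] by (simp add: B_ext_def P.sym_part_def P.skew_part_def field_simps)
  also have "\<dots> = B_ext 5 p (xi_zz p) x + B_ext 8 p (xi_zz p) x + B_ext 9 p (xi_zz p) x - B_ext 6 p (xi_zz p) x - B_ext 7 p (xi_zz p) x - B_ext 10 p (xi_zz p) x"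
    using P.B_swap[OF _ t x] by (simp add: P.sg_def)
  also have "B_ext 5 p (xi_zz p) x = a5 p * \<theta> p x"
    using B_ext_5_6(1)[OF t x] x t by (simp add: P.met_hor_def P.g_phi_phi eta_xi_zz theta_xi_zz)
  also have "B_ext 6 p (xi_zz p) x = c6 p * \<theta> p (phi M p x)"
    using B_ext_5_6(2)[OF t x] x by (simp add: P.fund_def theta_xi_zz)
  finally show ?thesis unfolding zeta_dtheta_def using x by simp
qed

text \<open>\<open>d1\<close> is evaluated on chosen extensions, so bilinearity is read off from
  \<open>dtheta_d_eta\<close>.\<close>

lemma bil_dtheta: "bil (T p) (d1 M \<theta> p)"
proof -
  note a = sform_bil[OF sform_d_eta, of p]
  have 1: "bil (T p) (\<lambda>x y. d_eta p (torsion_zeta p x) y)" "bil (T p) (\<lambda>x y. d_eta p x (torsion_zeta p y))"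
    using a unfolding bil_def by (simp_all add: torsion_zeta_lin)
  have "bil (T p) (\<lambda>x y. -1 * D_form d_eta p x y + 1 * (-1 * d_eta p (torsion_zeta p x) y + -1 * d_eta p x (torsion_zeta p y)))"
    by (rule P.bil_comb[OF D_form_bil[OF sform_d_eta] P.bil_comb[OF 1]])
  moreover have "\<forall>x\<in>T p. \<forall>y\<in>T p. d1 M \<theta> p x y = -1 * D_form d_eta p x y + 1 * (-1 * d_eta p (torsion_zeta p x) y + -1 * d_eta p x (torsion_zeta p y))"
    by (simp add: dtheta_d_eta)
  ultimately show ?thesis
    unfolding bil_def by (simp add: T_add T_scale)
qed

text \<open>The pairing is half the trace of d\<theta>(\<phi>x, y), which sees only the [1,1]-part.
  The derivative of component 7 drops out because the F-pairing of that component vanishes at every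
  point.\<close>

lemma inner2_dtheta:
  assumes e: "adapted_frame M p e"
  shows "inner2 M (d1 M \<theta>) (fund_form M) p = - zeta M p \<delta>F - 4 * n * a5 p * c6 p
    + 2 * (\<Sum>i<2*n. B_ext 7 p (e i) (phi M p (P.b p 8 (e i)))) + 2 * (\<Sum>i<2*n. B_ext 10 p (e i) (phi M p (P.b p 11 (e i))))"
proof -
  have e: "P.adapted p e" using e by (simp add: adapted_frame_iff)
  note f = frame_adapted[of p] and eD = P.adaptedD[OF e]
  let ?d = "d1 M \<theta> p" and ?\<phi> = "phi M p"
  have z: "B_ext i p (zeta M p) w = 0" if "i \<in> {5..11}" "w \<in> T p" for i w
    by (rule P.hor_formD(2)[OF P.B_hor[OF that(1)] that(2)])
  have bd: "bil (T p) (\<lambda>x y. ?d (?\<phi> x) y)"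
    using bil_dtheta[of p] unfolding bil_def by (simp add: P.phi_lin)
  have "inner2 M (d1 M \<theta>) (fund_form M) p = 1/2 * P.tr (frame M p) (\<lambda>x y. ?d (?\<phi> x) y)"
    unfolding inner2_def acm_dim fund_form_fund P.pairing_F[OF f bil_dtheta] ..
  also have "P.tr (frame M p) (\<lambda>x y. ?d (?\<phi> x) y) = P.tr e (\<lambda>x y. ?d (?\<phi> x) y)"
    by (rule P.tr_frame[OF e f bd])
  \<comment> \<open>Rotating both slots by \<phi> keeps the trace, as the form vanishes at (\<zeta>,
    \<zeta>); the average involves only \<open>comp_11\<close>.\<close>
  also have "\<dots> = P.tr e (\<lambda>x y. 1/2 * ?d (?\<phi> x) y + 1/2 * ?d (?\<phi> (?\<phi> x)) (?\<phi> y))"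
    unfolding P.tr_comb P.tr_phi[OF e bd] using P.bil_lin(9)[OF bil_dtheta zeta_T zeta_T] by simp
  also have "\<dots> = P.tr e (\<lambda>x y. comp_11 M (d1 M \<theta>) p (?\<phi> x) y)"
    unfolding P.tr_def
  proof (intro sum.cong refl)
    fix i assume i: "i \<in> {..<Suc (2*n)}"
    have eV: "e i \<in> T p" using eD(1) i by simp
    \<comment> \<open>On horizontal frame vectors \<phi> squared gives a sign in each slot; on
      \<zeta> both sides vanish.\<close>
    have "?d (?\<phi> (?\<phi> (?\<phi> (e i)))) (?\<phi> (?\<phi> (e i))) = ?d (?\<phi> (e i)) (e i)"
    proof (cases "i = 2*n")
      case True
      then have "?\<phi> (e i) = 0" using eD(3) by simp
      then show ?thesis using eV P.bil_lin(9)[OF bil_dtheta zeta_T] by simp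
    next
      case False
      then have "?\<phi> (?\<phi> (e i)) = - e i" using P.phi_phi[OF eV] eD(4) i by simp
      then show ?thesis using eV P.bil_lin(5,6)[OF bil_dtheta] by simp
    qed
    then show "1/2 * ?d (?\<phi> (e i)) (e i) + 1/2 * ?d (?\<phi> (?\<phi> (e i))) (?\<phi> (e i)) = comp_11 M (d1 M \<theta>) p (?\<phi> (e i)) (e i)"
      by (simp add: comp_11_def)
  qed
  also have "\<dots> = P.tr e (\<lambda>x y. 1 * (2 * zeta M p c6 * P.fund p (?\<phi> x) y + 2 * D_form (B_ext 7) p (?\<phi> x) y)
      + 2 * P.R_inv p (a5 p) (c6 p) (?\<phi> x) y)"
    by (rule P.tr_cong[OF e]) (simp add: comp_11_dtheta fund_form_fund)
  also have "\<dots> = 2 * zeta M p c6 * (2 * n) + 2 * (- 4 * n * a5 p * c6 p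
      + 2 * P.tr e (\<lambda>x y. B_ext 7 p x (?\<phi> (P.b p 8 y))) + 2 * P.tr e (\<lambda>x y. B_ext 10 p x (?\<phi> (P.b p 11 y))))"
  proof -
    have ca: "a5 p = P.c5 e (beta p)" "c6 p = P.c6 p e (beta p)" if "P.adapted p e" for p e
      unfolding a5_def c6_def
      using P.tr_frame[OF that frame_adapted P.hor_formD(1)[OF hor_form_beta]] P.tr_frame[OF that frame_adapted P.hor_formD(1)[OF P.hor_form_phi_left[OF hor_form_beta]]]
      by simp_all
    have t7: "P.tr e (\<lambda>x y. B_ext 7 p (phi M p x) y) = 0" if "P.adapted p e" for p e
    proof -
      have "P.tr e (\<lambda>x y. B_ext 7 p (phi M p x) y) = P.tr e (\<lambda>x y. P.component p (beta p) (a5 p) (c6 p) 7 (phi M p x) y)"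
        by (simp add: B_ext_def)
      then show ?thesis unfolding P.component_tr7[OF that hor_form_beta] using ca(2)[OF that] acm_n by simp
    qed
    have t8: "P.tr e (B_ext 8 p) = 0"
    proof -
      have "P.tr e (B_ext 8 p) = P.tr e (P.component p (beta p) (a5 p) (c6 p) 8)"
        by (rule P.tr_cong[OF e]) (simp add: B_ext_def)
      then show ?thesis unfolding P.component_tr8[OF e hor_form_beta] using ca(1)[OF e] acm_n by simp
    qed
    have "P.tr e (\<lambda>x y. D_form (B_ext 7) p (?\<phi> x) y) = P.tr e (D_form (\<lambda>p x y. B_ext 7 p (phi M p x) y) p)"
      by (rule P.tr_cong[OF e]) (simp add: D_form_phi_left[OF sform_B_ext_7])
    also have "\<dots> = 0" by (rule tr_D_form[OF sform_phi_left[OF sform_B_ext_7] e t7])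
    finally have D7: "P.tr e (\<lambda>x y. D_form (B_ext 7) p (?\<phi> x) y) = 0" .
    show ?thesis unfolding P.tr_comb P.tr_R_11[OF e t7[OF e] t8] D7 P.tr_fund_phi[OF e] by simp
  qed
  also have "P.tr e (\<lambda>x y. B_ext 7 p x (?\<phi> (P.b p 8 y))) = (\<Sum>i<2*n. B_ext 7 p (e i) (?\<phi> (P.b p 8 (e i))))"
    using eD(3) z[of 7 "?\<phi> (P.b p 8 (zeta M p))"] by (simp add: P.tr_def)
  also have "P.tr e (\<lambda>x y. B_ext 10 p x (?\<phi> (P.b p 11 y))) = (\<Sum>i<2*n. B_ext 10 p (e i) (?\<phi> (P.b p 11 (e i))))"
    using eD(3) z[of 10 "?\<phi> (P.b p 11 (zeta M p))"] by (simp add: P.tr_def)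
  finally show ?thesis
    unfolding zeta_c6 using acm_n by simp
qed

end

theorem lemma3p9:
  fixes M :: "('a::{t2_space,second_countable_topology}, 'e::euclidean_space) acm"
    and n :: nat and p :: 'a and x y :: "'a tvec"
  assumes "almost_contact_metric_manifold n M"
    and "levi_civita M"
    and "x \<in> tangent_space M p" and "y \<in> tangent_space M p"
  defines "\<phi> \<equiv> phi M p" and "\<zeta> \<equiv> zeta M p" and "F \<equiv> fund_form M p"
    and "d\<theta> \<equiv> d1 M (xi_zeta_eta M)"
    and "\<delta>\<eta> \<equiv> codiff1 M (eta M) p"
    and "\<delta>F \<equiv> (\<lambda>q. codiff2 M (fund_form M) q (zeta M q))"
    and "\<xi> \<equiv> (\<lambda>i. xi_comp M i p)"
    and "\<xi>\<eta> \<equiv> (\<lambda>i u. act_eta M p (xi_comp M i p u))"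
    and "D\<xi>\<eta> \<equiv> (\<lambda>i u. act_eta M p (nablaU_tensor12 M (xi_comp M i) p (zeta M p) u))"
  shows
    "(comp_F n M d\<theta> p x y = 1 / real n * inner2 M d\<theta> (fund_form M) p * F x y \<and>
     (\<forall>e. adapted_frame M p e \<longrightarrow>
       inner2 M d\<theta> (fund_form M) p =
         - \<zeta> \<delta>F + 1 / real n * \<delta>\<eta> * \<delta>F p
         + 2 * (\<Sum>i<2*n. \<xi>\<eta> 7 (e i) (\<phi> (\<xi> 8 (e i) \<zeta>)))
         + 2 * (\<Sum>i<2*n. \<xi>\<eta> 10 (e i) (\<phi> (\<xi> 11 \<zeta> (e i)))))) \<and>
     (comp_11 M d\<theta> p x y =
       - (1 / real n) * \<zeta> \<delta>F * F x y + 1 / (real n)^2 * \<delta>\<eta> * \<delta>F p * F x y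
       + 2 * D\<xi>\<eta> 7 x y
       - 2 / real n * \<delta>\<eta> * \<xi>\<eta> 7 x y + 2 / real n * \<delta>F p * \<xi>\<eta> 8 x (\<phi> y)
       - 2 * \<xi>\<eta> 7 x (\<xi> 8 y \<zeta>) + 2 * \<xi>\<eta> 7 y (\<xi> 8 x \<zeta>)
       + 2 * \<xi>\<eta> 9 x (\<xi> 10 y \<zeta>) - 2 * \<xi>\<eta> 9 y (\<xi> 10 x \<zeta>)
       + 2 * \<xi>\<eta> 10 x (\<xi> 11 \<zeta> y) - 2 * \<xi>\<eta> 10 y (\<xi> 11 \<zeta> x)) \<and>
     (comp_20 M d\<theta> p x y =
       2 * D\<xi>\<eta> 10 x y - 2 / real n * \<delta>F p * met M p (\<xi> 11 \<zeta> x) (\<phi> y)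
       - 2 * \<xi>\<eta> 7 x (\<xi> 9 y \<zeta>) + 2 * \<xi>\<eta> 7 y (\<xi> 9 x \<zeta>)
       + 2 * \<xi>\<eta> 7 x (\<xi> 11 \<zeta> y) - 2 * \<xi>\<eta> 7 y (\<xi> 11 \<zeta> x)
       - 2 / real n * \<delta>\<eta> * \<xi>\<eta> 10 x y
       + 2 * \<xi>\<eta> 8 x (\<xi> 10 y \<zeta>) - 2 * \<xi>\<eta> 8 y (\<xi> 10 x \<zeta>)) \<and>
     (comp_eta M d\<theta> p x y = wedge11 (eta M) (int_prod (zeta M) d\<theta>) p x y \<and>
     int_prod (zeta M) d\<theta> p x =
       D\<xi>\<eta> 12 \<zeta> x + \<xi>\<eta> 12 \<zeta> (\<xi> 11 \<zeta> x) - 1 / (2 * real n) * \<delta>\<eta> * \<xi>\<eta> 12 \<zeta> x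
       - \<xi>\<eta> 8 (\<xi> 12 \<zeta> \<zeta>) x - \<xi>\<eta> 9 (\<xi> 12 \<zeta> \<zeta>) x
       - 1 / (2 * real n) * \<delta>F p * \<xi>\<eta> 12 \<zeta> (\<phi> x)
       + \<xi>\<eta> 7 (\<xi> 12 \<zeta> \<zeta>) x + \<xi>\<eta> 10 (\<xi> 12 \<zeta> \<zeta>) x)"
proof -
  interpret acm_lc M n by standard (rule assms(1,2))+
  note x = assms(3) and y = assms(4)
  have n0: "real n \<noteq> 0" using acm_n by simp
  have a5: "a5 p = \<delta>\<eta> / (2 * real n)" using a5_eq[of p] by (simp add: \<delta>\<eta>_def)
  have c6: "c6 p = - \<delta>F p / (2 * real n)" using c6_eq[of p] by (simp add: \<delta>F_def)
  have zc6: "zeta M p c6 = - \<zeta> \<delta>F / (2 * real n)" using zeta_c6[of p] by (simp add: \<delta>F_def \<zeta>_def)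
  have X: "\<xi>\<eta> i u v = B_ext i p u v" if "i \<in> {5..10}" "u \<in> T p" "v \<in> T p" for i u v
    using act_eta_xi_comp[OF that] by (simp add: \<xi>\<eta>_def)
  have Xz: "\<xi> i u \<zeta> = P.b p i u" if "i \<in> {5..10}" "u \<in> T p" for i u
    using xi_comp_zeta[OF that] by (simp add: \<xi>_def \<zeta>_def)
  have X11: "\<xi> 11 \<zeta> u = P.b p 11 u" if "u \<in> T p" for u
    using xi_comp_11[OF that] by (simp add: \<xi>_def \<zeta>_def)
  have X12: "\<xi>\<eta> 12 \<zeta> u = xi_zeta_eta M p u" if "u \<in> T p" for u
    using act_eta_xi_comp_12[OF that] by (simp add: \<xi>\<eta>_def \<zeta>_def)
  have t: "\<xi> 12 \<zeta> \<zeta> = xi M p (zeta M p) (zeta M p)" using xi_comp_12_zeta[of p] by (simp add: \<xi>_def \<zeta>_def)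
  have D7: "D\<xi>\<eta> 7 x y = D_form (B_ext 7) p x y" using D_xi_comp[OF _ sform_B_ext_7 x y] by (simp add: D\<xi>\<eta>_def)
  have D10: "D\<xi>\<eta> 10 x y = D_form (B_ext 10) p x y" using D_xi_comp[OF _ sform_B_ext_10 x y] by (simp add: D\<xi>\<eta>_def)
  have D12: "D\<xi>\<eta> 12 \<zeta> x = D_theta p x" using D_xi_comp_12[OF x] by (simp add: D\<xi>\<eta>_def \<zeta>_def)
  have bT: "P.b p i u \<in> T p" if "i \<in> {5..11}" "u \<in> T p" for i u using that by auto
  have 1: "inner2 M d\<theta> (fund_form M) p =
         - \<zeta> \<delta>F + 1 / real n * \<delta>\<eta> * \<delta>F p
         + 2 * (\<Sum>i<2*n. \<xi>\<eta> 7 (e i) (\<phi> (\<xi> 8 (e i) \<zeta>)))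
         + 2 * (\<Sum>i<2*n. \<xi>\<eta> 10 (e i) (\<phi> (\<xi> 11 \<zeta> (e i))))" if e: "adapted_frame M p e" for e
  proof -
    have eV: "e i \<in> T p" if "i < 2*n" for i
      using e that P.adaptedD(1)[of p e i] by (simp add: adapted_frame_iff)
    have "(\<Sum>i<2*n. \<xi>\<eta> 7 (e i) (\<phi> (\<xi> 8 (e i) \<zeta>))) = (\<Sum>i<2*n. B_ext 7 p (e i) (phi M p (P.b p 8 (e i))))"
      "(\<Sum>i<2*n. \<xi>\<eta> 10 (e i) (\<phi> (\<xi> 11 \<zeta> (e i)))) = (\<Sum>i<2*n. B_ext 10 p (e i) (phi M p (P.b p 11 (e i))))"
      by (intro sum.cong refl; use eV in \<open>simp add: X Xz X11 bT \<phi>_def\<close>)+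
    \<comment> \<open>The minus sign in \<open>c6\<close> makes the product positive: -4n
      (\<delta>\<eta> / 2n)(-\<delta>F / 2n).\<close>
    moreover have "- 4 * n * a5 p * c6 p = 1 / real n * \<delta>\<eta> * \<delta>F p"
      using n0 by (simp add: a5 c6 field_simps)
    ultimately show ?thesis
      using inner2_dtheta[OF e] by (simp add: d\<theta>_def \<zeta>_def \<delta>F_def)
  qed
  show ?thesis
  proof (intro conjI allI impI, goal_cases)
    case 1
    show ?case by (simp add: comp_F_def F_def)
  next
    case (2 e)
    then show ?case by (rule 1)
  next
    \<comment> \<open>In twice \<open>R_inv\<close> the coefficients -4ac, -4a and -4c become those
      of F, \<xi>_(7) and \<xi>_(8): \<delta>\<eta> \<delta>F / n^2, -2 \<delta>\<eta> / n and 2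
      \<delta>F / n.\<close>
    case 3
    show ?case
      unfolding d\<theta>_def comp_11_dtheta[OF x y] zc6 a5 c6 D7
      using n0 x y by (simp add: P.R_inv_def X Xz X11 bT \<phi>_def F_def fund_form_fund power2_eq_square field_simps)
  next
    case 4
    show ?case
      unfolding d\<theta>_def comp_20_dtheta[OF x y] a5 c6 D10
      using n0 x y by (simp add: P.R_antiinv_def X Xz X11 bT \<phi>_def field_simps)
  next
    case 5
    show ?case by (simp add: comp_eta_def)
  next
    case 6
    show ?case
      unfolding int_prod_def d\<theta>_def dtheta_zeta[OF x] zeta_dtheta_eq[OF x] a5 c6 D12 t
      using n0 x by (simp add: X X11 X12 bT \<phi>_def field_simps)
  qed
qed

end
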